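(* Let $k$ be a field of characteristic $0$ and let $\mathfrak a$ be a DG Lie algebra over $k$. There are Adams operations $$\psi^p:\overline{\mathrm{HC}}_\bullet[\mathcal U(\mathfrak a)]\to\overline{\mathrm{HC}}_\bullet[\mathcal U(\mathfrak a)],\qquad p\ge2,$$ (induced by the maps $\psi^p=m_p\circ\Delta^p$ on $\boldsymbol\Omega(C)$). Further, for each $d\ge1$, the summand $\mathrm{HC}^{(d)}_\bullet(\mathtt{Lie},\mathfrak a)$ of $\overline{\mathrm{HC}}_\bullet[\mathcal U(\mathfrak a)]$ is precisely the (graded) eigenspace of $\psi^p$ corresponding to the eigenvalue $p^d$, for each $p\ge2$.
   Context: Let $C$ be a coaugmented conilpotent cocommutative DG coalgebra Koszul dual to $\mathfrak a$: there is a quasi-isomorphism $\boldsymbol\Omega_{\mathtt{Comm}}(C)\xrightarrow{\sim}\mathfrak a$, where $\boldsymbol\Omega_{\mathtt{Comm}}(C)$ is the free graded Lie algebra on $\bar C[-1]$ ($\bar C$ the cokernel of the coaugmentation, $V[-1]_j=V_{j+1}$) with differential induced by $d_C$ and the coproduct (e.g. $C$ the Chevalley–Eilenberg chain coalgebra of $\mathfrak a$). The cobar construction $\boldsymbol\Omega(C)$ (tensor algebra on $\bar C[-1]$ with the cobar differential) is isomorphic to $\mathcal U(\boldsymbol\Omega_{\mathtt{Comm}}(C))$, hence is a cocommutative DG Hopf algebra with primitives $\boldsymbol\Omega_{\mathtt{Comm}}(C)$; let $m_p:\boldsymbol\Omega(C)^{\otimes p}\to\boldsymbol\Omega(C)$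 be the $p$-fold product, $\Delta^p:\boldsymbol\Omega(C)\to\boldsymbol\Omega(C)^{\otimes p}$ the $p$-fold coproduct, and $\psi^p:=m_p\circ\Delta^p$. For an augmented DG algebra $R$, $R_\natural:=R/(k+[R,R])$. $\boldsymbol\Omega(C)\to\mathcal U(\mathfrak a)$ is a cofibrant resolution of augmented DG algebras, and $\overline{\mathrm{HC}}_\bullet[\mathcal U(\mathfrak a)]=\mathrm H_\bullet[\boldsymbol\Omega(C)_\natural]$ (reduced cyclic homology); the operations $\psi^p$ on homology are those induced by the maps on $\boldsymbol\Omega(C)_\natural$ to which $\psi^p$ descends. $\mathrm{HC}^{(d)}_\bullet(\mathtt{Lie},\mathfrak a)$ is the homology of $\mathrm{Sym}^d(\mathfrak L)/[\mathfrak L,\mathrm{Sym}^d(\mathfrak L)]$ for a cofibrant resolution $\mathfrak L$ of $\mathfrak a$; taking $\mathfrak L=\boldsymbol\Omega_{\mathtt{Comm}}(C)$, it is regarded as a summand of $\overline{\mathrm{HC}}_\bullet[\mathcal U(\mathfrak a)]$ via the decomposition $\boldsymbol\Omega(C)_\natural\cong\bigoplus_{d\ge1}\mathrm{Sym}^d(\mathfrak L)/[\mathfrak L,\mathrm{Sym}^d(\mathfrak L)]$ induced by the symmetrization isomorphism $\mathbf{Sym}(\mathfrak L)\cong\mathcal U(\mathfrak L)=\boldsymbol\Omega(C)$. *)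

theory Defs
  imports Complex_Main "HOL-Library.Poly_Mapping" "HOL-Library.FuncSet" "HOL-Combinatorics.Permutations"
begin

section \<open>Free vector spaces and tensor powers\<close>

text \<open>
  A vector space with basis \<open>X\<close> is rendered as \<open>X \<Rightarrow>\<^sub>0 k\<close>.  The tensor product of the spaces with
  bases \<open>X\<close> and \<open>Y\<close> is \<open>X \<times> Y \<Rightarrow>\<^sub>0 k\<close>, the direct sum of all tensor powers of the space with basis
  \<open>X\<close> is \<open>X list \<Rightarrow>\<^sub>0 k\<close>.  With lists regarded as the free monoid, the (convolution) product that
  \<^theory>\<open>HOL-Library.Poly_Mapping\<close> puts on \<open>X list \<Rightarrow>\<^sub>0 k\<close> is the product of the tensor algebra,
  i.e. concatenation of tensors.
\<close>

instantiation list :: (type) monoid_add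
begin
definition zero_list_def: "0 = []"
definition plus_list_def: "xs + ys = xs @ ys"
instance by standard (simp_all add: zero_list_def plus_list_def)
end

definition psc :: "'k::field \<Rightarrow> ('x \<Rightarrow>\<^sub>0 'k) \<Rightarrow> 'x \<Rightarrow>\<^sub>0 'k"
  where "psc c x = Poly_Mapping.map ((*) c) x"

lemma lookup_psc [simp]: "Poly_Mapping.lookup (psc c x) i = c * Poly_Mapping.lookup x i"
  by (simp add: psc_def Poly_Mapping.map.rep_eq when_def)

global_interpretation pm: vector_space "psc :: 'k::field \<Rightarrow> ('x \<Rightarrow>\<^sub>0 'k) \<Rightarrow> 'x \<Rightarrow>\<^sub>0 'k"
  by unfold_locales
    (auto intro!: poly_mapping_eqI simp: Poly_Mapping.lookup_add algebra_simps)

abbreviation bas :: "'x \<Rightarrow> 'x \<Rightarrow>\<^sub>0 'k::field"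
  where "bas x \<equiv> Poly_Mapping.single x 1"

text \<open>The linear map with prescribed values on the basis.\<close>

definition lin :: "('x \<Rightarrow> 'y \<Rightarrow>\<^sub>0 'k::field) \<Rightarrow> ('x \<Rightarrow>\<^sub>0 'k) \<Rightarrow> 'y \<Rightarrow>\<^sub>0 'k"
  where "lin f x = (\<Sum>i\<in>Poly_Mapping.keys x. psc (Poly_Mapping.lookup x i) (f i))"

text \<open>The inclusion of \<open>V\<close> as the tensors of length one, and \<open>v\<^sub>1 \<otimes> \<dots> \<otimes> v\<^sub>d\<close>.\<close>

definition emb :: "('x \<Rightarrow>\<^sub>0 'k::field) \<Rightarrow> 'x list \<Rightarrow>\<^sub>0 'k"
  where "emb = lin (\<lambda>x. bas [x])"

definition tens :: "('x \<Rightarrow>\<^sub>0 'k::field) list \<Rightarrow> 'x list \<Rightarrow>\<^sub>0 'k"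
  where "tens vs = prod_list (map emb vs)"


section \<open>Homology of quotient complexes\<close>

text \<open>
  A record \<open>X\<close> stands for the complex \<open>A / N\<close>, where \<open>A = \<Oplus>\<^sub>n grd X n\<close> is a graded space,
  \<open>N = rel X\<close> a graded subspace, and the differential of degree \<open>-1\<close> is induced by \<open>dif X\<close>.
  Homology classes are cosets of cycles modulo boundaries (in representatives from \<open>A\<close>).
\<close>

record 'v qcomplex =
  grd :: "int \<Rightarrow> 'v set"
  rel :: "'v set"
  dif :: "'v \<Rightarrow> 'v"

definition total :: "('k::field \<Rightarrow> 'v \<Rightarrow> 'v) \<Rightarrow> 'v::ab_group_add qcomplex \<Rightarrow> 'v set"
  where "total s X = module.span s (\<Union>n. grd X n)"

definition cyc :: "'v::ab_group_add qcomplex \<Rightarrow> int \<Rightarrow> 'v set"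
  where "cyc X n = {x \<in> grd X n. dif X x \<in> rel X}"

definition bdr :: "'v::ab_group_add qcomplex \<Rightarrow> int \<Rightarrow> 'v set"
  where "bdr X n = {x \<in> grd X n. \<exists>y\<in>grd X (n + 1). x - dif X y \<in> rel X}"

definition hclass :: "'v::ab_group_add qcomplex \<Rightarrow> int \<Rightarrow> 'v \<Rightarrow> 'v set"
  where "hclass X n x = {y. y - x \<in> bdr X n}"

definition homology :: "'v::ab_group_add qcomplex \<Rightarrow> int \<Rightarrow> 'v set set"
  where "homology X n = hclass X n ` cyc X n"

text \<open>The map on homology induced by \<open>f\<close>, with values in the homology of \<open>Y\<close>.\<close>

definition hmap :: "('v \<Rightarrow> 'w) \<Rightarrow> 'w::ab_group_add qcomplex \<Rightarrow> int \<Rightarrow> 'v set \<Rightarrow> 'w set"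
  where "hmap f Y n K = (\<Union>x\<in>K. hclass Y n (f x))"

definition chain_map ::
  "('k::field \<Rightarrow> 'v \<Rightarrow> 'v) \<Rightarrow> ('k \<Rightarrow> 'w \<Rightarrow> 'w) \<Rightarrow> ('v \<Rightarrow> 'w) \<Rightarrow>
    'v::ab_group_add qcomplex \<Rightarrow> 'w::ab_group_add qcomplex \<Rightarrow> bool"
  where "chain_map s s' f X Y \<longleftrightarrow>
    (\<forall>x\<in>total s X. \<forall>y\<in>total s X. f (x + y) = f x + f y) \<and>
    (\<forall>c. \<forall>x\<in>total s X. f (s c x) = s' c (f x)) \<and>
    (\<forall>n. f ` grd X n \<subseteq> grd Y n) \<and>
    f ` rel X \<subseteq> rel Y \<and>
    (\<forall>x\<in>total s X. f (dif X x) - dif Y (f x) \<in> rel Y)"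

definition quasi_iso ::
  "('k::field \<Rightarrow> 'v \<Rightarrow> 'v) \<Rightarrow> ('k \<Rightarrow> 'w \<Rightarrow> 'w) \<Rightarrow> ('v \<Rightarrow> 'w) \<Rightarrow>
    'v::ab_group_add qcomplex \<Rightarrow> 'w::ab_group_add qcomplex \<Rightarrow> bool"
  where "quasi_iso s s' f X Y \<longleftrightarrow> chain_map s s' f X Y \<and>
    (\<forall>n. bij_betw (hmap f Y n) (homology X n) (homology Y n))"

text \<open>The eigenspace, in degree \<open>n\<close>, of the endomorphism of homology induced by \<open>f\<close>.\<close>

definition heigenspace ::
  "('k::field \<Rightarrow> 'v \<Rightarrow> 'v) \<Rightarrow> 'v::ab_group_add qcomplex \<Rightarrow> ('v \<Rightarrow> 'v) \<Rightarrow> 'k \<Rightarrow> int \<Rightarrow> 'v set set"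
  where "heigenspace s X f c n = {K \<in> homology X n. hmap f X n K = hmap (s c) X n K}"

text \<open>The chain maps \<open>\<phi> i\<close> induce an isomorphism of complexes from \<open>\<Oplus>\<^sub>i\<^sub>\<in>\<^sub>I Y i\<close> onto \<open>X\<close>.\<close>

definition direct_sum_decomposition ::
  "('k::field \<Rightarrow> 'v \<Rightarrow> 'v) \<Rightarrow> 'v::ab_group_add qcomplex \<Rightarrow> 'i set \<Rightarrow>
    ('k \<Rightarrow> 'w \<Rightarrow> 'w) \<Rightarrow> ('i \<Rightarrow> 'w::ab_group_add qcomplex) \<Rightarrow> ('i \<Rightarrow> 'w \<Rightarrow> 'v) \<Rightarrow> bool"
  where "direct_sum_decomposition s X I s' Y \<phi> \<longleftrightarrow>
    (\<forall>i\<in>I. chain_map s' s (\<phi> i) (Y i) X) \<and>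
    (\<forall>x\<in>total s X. \<exists>J t. finite J \<and> J \<subseteq> I \<and> (\<forall>i\<in>J. t i \<in> total s' (Y i)) \<and>
        x - (\<Sum>i\<in>J. \<phi> i (t i)) \<in> rel X) \<and>
    (\<forall>J t. finite J \<and> J \<subseteq> I \<and> (\<forall>i\<in>J. t i \<in> total s' (Y i)) \<and>
        (\<Sum>i\<in>J. \<phi> i (t i)) \<in> rel X \<longrightarrow> (\<forall>i\<in>J. t i \<in> rel (Y i)))"


section \<open>DG Lie algebras\<close>

locale dg_lie_algebra = vector_space scale
  for scale :: "'k::field_char_0 \<Rightarrow> 'a::ab_group_add \<Rightarrow> 'a" +
  fixes G :: "int \<Rightarrow> 'a set"
    and bracket :: "'a \<Rightarrow> 'a \<Rightarrow> 'a"
    and \<delta> :: "'a \<Rightarrow> 'a"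
  assumes grading_subspace: "subspace (G n)"
    and grading_direct:
      "\<exists>!g. (\<forall>n. g n \<in> G n) \<and> finite {n. g n \<noteq> 0} \<and> x = (\<Sum>n | g n \<noteq> 0. g n)"
    and bracket_add_left: "bracket (x + y) z = bracket x z + bracket y z"
    and bracket_add_right: "bracket x (y + z) = bracket x y + bracket x z"
    and bracket_scale_left: "bracket (scale c x) y = scale c (bracket x y)"
    and bracket_scale_right: "bracket x (scale c y) = scale c (bracket x y)"
    and bracket_degree: "x \<in> G m \<Longrightarrow> y \<in> G n \<Longrightarrow> bracket x y \<in> G (m + n)"
    and antisymmetry:
      "x \<in> G m \<Longrightarrow> y \<in> G n \<Longrightarrow> bracket x y = - scale ((-1) powi (m * n)) (bracket y x)"
    and jacobi:
      "x \<in> G l \<Longrightarrow> y \<in> G m \<Longrightarrow> z \<in> G n \<Longrightarrow>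
        bracket x (bracket y z) =
          bracket (bracket x y) z + scale ((-1) powi (l * m)) (bracket y (bracket x z))"
    and diff_add: "\<delta> (x + y) = \<delta> x + \<delta> y"
    and diff_scale: "\<delta> (scale c x) = scale c (\<delta> x)"
    and diff_degree: "x \<in> G n \<Longrightarrow> \<delta> x \<in> G (n - 1)"
    and diff_diff: "\<delta> (\<delta> x) = 0"
    and diff_bracket:
      "x \<in> G m \<Longrightarrow> y \<in> G n \<Longrightarrow>
        \<delta> (bracket x y) = bracket (\<delta> x) y + scale ((-1) powi m) (bracket x (\<delta> y))"


section \<open>Coaugmented conilpotent cocommutative DG coalgebras\<close>

text \<open>
  Every graded vector space has a homogeneous basis, and this basis can be chosen to contain a
  given nonzero homogeneous element.  A coaugmented DG coalgebra is therefore given on the space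
  \<open>C = 'b \<Rightarrow>\<^sub>0 k\<close>, where the basis element \<open>coaug C\<close> is the image of \<open>1\<close> under the coaugmentation;
  the other basis elements represent a basis of the cokernel \<open>C / k\<close> of the coaugmentation.
  The structure maps are recorded by their values on the basis.
\<close>

record (overloaded) ('b, 'k::zero) dgcoalg =
  cdeg :: "'b \<Rightarrow> int"
  coaug :: 'b
  counit :: "'b \<Rightarrow> 'k"
  cdiff :: "'b \<Rightarrow> 'b \<Rightarrow>\<^sub>0 'k"
  coprod :: "'b \<Rightarrow> 'b \<times> 'b \<Rightarrow>\<^sub>0 'k"

definition dg_coalgebra :: "('b, 'k::field) dgcoalg \<Rightarrow> bool"
  where "dg_coalgebra C \<longleftrightarrow>
    (\<forall>c. \<forall>b\<in>Poly_Mapping.keys (cdiff C c). cdeg C b = cdeg C c - 1) \<and>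
    (\<forall>c. \<forall>(a, b)\<in>Poly_Mapping.keys (coprod C c). cdeg C a + cdeg C b = cdeg C c) \<and>
    (\<forall>c. counit C c \<noteq> 0 \<longrightarrow> cdeg C c = 0) \<and>
    (\<forall>c. lin (cdiff C) (cdiff C c) = 0) \<and>
    (\<forall>c. lin (\<lambda>(a, b). lin (\<lambda>(a', a''). bas (a', a'', b)) (coprod C a)) (coprod C c) =
         lin (\<lambda>(a, b). lin (\<lambda>(b', b''). bas (a, b', b'')) (coprod C b)) (coprod C c)) \<and>
    (\<forall>c. lin (\<lambda>(a, b). psc (counit C a) (bas b)) (coprod C c) = bas c) \<and>
    (\<forall>c. lin (\<lambda>(a, b). psc (counit C b) (bas a)) (coprod C c) = bas c) \<and>
    (\<forall>c. lin (coprod C) (cdiff C c) =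
         lin (\<lambda>(a, b). lin (\<lambda>a'. bas (a', b)) (cdiff C a) +
                       psc ((-1) powi cdeg C a) (lin (\<lambda>b'. bas (a, b')) (cdiff C b)))
           (coprod C c)) \<and>
    (\<forall>c. (\<Sum>b\<in>Poly_Mapping.keys (cdiff C c). Poly_Mapping.lookup (cdiff C c) b * counit C b) = 0)"

definition cocommutative :: "('b, 'k::field) dgcoalg \<Rightarrow> bool"
  where "cocommutative C \<longleftrightarrow>
    (\<forall>c. lin (\<lambda>(a, b). psc ((-1) powi (cdeg C a * cdeg C b)) (bas (b, a))) (coprod C c) =
         coprod C c)"

definition coaugmented :: "('b, 'k::field) dgcoalg \<Rightarrow> bool"
  where "coaugmented C \<longleftrightarrow>
    cdeg C (coaug C) = 0 \<and> counit C (coaug C) = 1 \<and> cdiff C (coaug C) = 0 \<and>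
    coprod C (coaug C) = bas (coaug C, coaug C)"

text \<open>
  The coproduct induced on \<open>C / k\<close>.  Conilpotency says that its iterates
  \<open>C / k \<rightarrow> (C / k)\<^bsup>\<otimes>(n+1)\<^esup>\<close> eventually vanish on each element; it is enough to say this on a basis.
\<close>

definition reduced_coprod :: "('b, 'k::field) dgcoalg \<Rightarrow> 'b \<Rightarrow> 'b \<times> 'b \<Rightarrow>\<^sub>0 'k"
  where "reduced_coprod C c =
    lin (\<lambda>(a, b). if a = coaug C \<or> b = coaug C then 0 else bas (a, b)) (coprod C c)"

fun reduced_coprod_first :: "('b, 'k::field) dgcoalg \<Rightarrow> 'b list \<Rightarrow> 'b list \<Rightarrow>\<^sub>0 'k"
  where
    "reduced_coprod_first C [] = 0"
  | "reduced_coprod_first C (c # w) = lin (\<lambda>(a, b). bas (a # b # w)) (reduced_coprod C c)"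

definition conilpotent :: "('b, 'k::field) dgcoalg \<Rightarrow> bool"
  where "conilpotent C \<longleftrightarrow>
    (\<forall>c. c \<noteq> coaug C \<longrightarrow> (\<exists>n. (lin (reduced_coprod_first C) ^^ n) (bas [c]) = 0))"


section \<open>The cobar construction\<close>

text \<open>
  A letter \<open>c \<noteq> coaug C\<close> stands for the desuspension of \<open>c\<close>, of degree \<open>\<bar>c\<bar> - 1\<close>; the tensor
  algebra on the desuspension of \<open>C / k\<close> consists of the combinations of words in these letters.
\<close>

definition wdeg :: "('b, 'k::field) dgcoalg \<Rightarrow> 'b list \<Rightarrow> int"
  where "wdeg C w = (\<Sum>c\<leftarrow>w. cdeg C c - 1)"

definition cobar :: "('b, 'k::field) dgcoalg \<Rightarrow> ('b list \<Rightarrow>\<^sub>0 'k) set"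
  where "cobar C = {x. \<forall>w\<in>Poly_Mapping.keys x. coaug C \<notin> set w}"

definition cobar_grd :: "('b, 'k::field) dgcoalg \<Rightarrow> int \<Rightarrow> ('b list \<Rightarrow>\<^sub>0 'k) set"
  where "cobar_grd C n = {x \<in> cobar C. \<forall>w\<in>Poly_Mapping.keys x. wdeg C w = n}"

text \<open>
  \<open>d (s\<^sup>-\<^sup>1c) = - s\<^sup>-\<^sup>1(d c) + \<Sum> (-1)\<^bsup>\<bar>c'\<bar>\<^esup> s\<^sup>-\<^sup>1c' \<otimes> s\<^sup>-\<^sup>1c''\<close>, the sum being the reduced coproduct of \<open>c\<close>.
\<close>

definition cobar_diff_letter :: "('b, 'k::field) dgcoalg \<Rightarrow> 'b \<Rightarrow> 'b list \<Rightarrow>\<^sub>0 'k"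
  where "cobar_diff_letter C c =
    - lin (\<lambda>b. if b = coaug C then 0 else bas [b]) (cdiff C c) +
    lin (\<lambda>(a, b). psc ((-1) powi cdeg C a) (bas [a, b])) (reduced_coprod C c)"

fun cobar_diff_word :: "('b, 'k::field) dgcoalg \<Rightarrow> 'b list \<Rightarrow> 'b list \<Rightarrow>\<^sub>0 'k"
  where
    "cobar_diff_word C [] = 0"
  | "cobar_diff_word C (c # w) =
      cobar_diff_letter C c * bas w +
      psc ((-1) powi (cdeg C c - 1)) (bas [c] * cobar_diff_word C w)"

definition cobar_diff :: "('b, 'k::field) dgcoalg \<Rightarrow> ('b list \<Rightarrow>\<^sub>0 'k) \<Rightarrow> 'b list \<Rightarrow>\<^sub>0 'k"
  where "cobar_diff C = lin (cobar_diff_word C)"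

text \<open>The bilinear extension of the graded commutator.\<close>

definition gcomm ::
  "('b, 'k::field) dgcoalg \<Rightarrow> ('b list \<Rightarrow>\<^sub>0 'k) \<Rightarrow> ('b list \<Rightarrow>\<^sub>0 'k) \<Rightarrow> 'b list \<Rightarrow>\<^sub>0 'k"
  where "gcomm C x y =
    lin (\<lambda>u. lin (\<lambda>v. bas u * bas v - psc ((-1) powi (wdeg C u * wdeg C v)) (bas v * bas u)) y) x"

text \<open>\<open>\<Omega>(C)\<^sub>\<natural> = \<Omega>(C) / (k + [\<Omega>(C), \<Omega>(C)])\<close>\<close>

definition cobar_natural :: "('b, 'k::field) dgcoalg \<Rightarrow> ('b list \<Rightarrow>\<^sub>0 'k) qcomplex"
  where "cobar_natural C =
    \<lparr>grd = cobar_grd C,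
     rel = pm.span (insert 1 {gcomm C x y | x y. x \<in> cobar C \<and> y \<in> cobar C}),
     dif = cobar_diff C\<rparr>"

text \<open>
  The reduced cyclic homology of \<open>\<U>(\<aa>)\<close>, computed by the cofibrant resolution
  \<open>\<Omega>(C) \<rightarrow> \<U>(\<aa>)\<close> for \<open>C\<close> Koszul dual to \<open>\<aa>\<close>.
\<close>

definition reduced_HC :: "('b, 'k::field) dgcoalg \<Rightarrow> int \<Rightarrow> ('b list \<Rightarrow>\<^sub>0 'k) set set"
  where "reduced_HC C n = homology (cobar_natural C) n"


section \<open>The free graded Lie algebra\<close>

text \<open>
  The free graded Lie algebra on a graded vector space \<open>V\<close> over a field of characteristic \<open>0\<close> is
  taken to be the graded Lie subalgebra of the tensor algebra \<open>T(V)\<close> generated by \<open>V\<close>; its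
  enveloping algebra is \<open>T(V)\<close>.  By cocommutativity of \<open>C\<close> it is preserved by the cobar
  differential, which restricts to the differential of \<open>\<Omega>\<^sub>C\<^sub>o\<^sub>m\<^sub>m(C)\<close>.
\<close>

inductive_set cobar_lie :: "('b, 'k::field) dgcoalg \<Rightarrow> ('b list \<Rightarrow>\<^sub>0 'k) set"
  for C :: "('b, 'k) dgcoalg"
  where
    letter: "c \<noteq> coaug C \<Longrightarrow> bas [c] \<in> cobar_lie C"
  | zero: "0 \<in> cobar_lie C"
  | add: "x \<in> cobar_lie C \<Longrightarrow> y \<in> cobar_lie C \<Longrightarrow> x + y \<in> cobar_lie C"
  | scale: "x \<in> cobar_lie C \<Longrightarrow> psc a x \<in> cobar_lie C"
  | bracket: "x \<in> cobar_lie C \<Longrightarrow> y \<in> cobar_lie C \<Longrightarrow> gcomm C x y \<in> cobar_lie C"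

definition cobar_lie_grd :: "('b, 'k::field) dgcoalg \<Rightarrow> int \<Rightarrow> ('b list \<Rightarrow>\<^sub>0 'k) set"
  where "cobar_lie_grd C n = cobar_lie C \<inter> cobar_grd C n"

definition cobar_comm :: "('b, 'k::field) dgcoalg \<Rightarrow> ('b list \<Rightarrow>\<^sub>0 'k) qcomplex"
  where "cobar_comm C = \<lparr>grd = cobar_lie_grd C, rel = {0}, dif = cobar_diff C\<rparr>"

text \<open>A quasi-isomorphism of DG Lie algebras from \<open>\<Omega>\<^sub>C\<^sub>o\<^sub>m\<^sub>m(C)\<close> to \<open>\<aa>\<close>.\<close>

definition koszul_dual_via ::
  "('b, 'k::field) dgcoalg \<Rightarrow> ('k \<Rightarrow> 'a \<Rightarrow> 'a) \<Rightarrow> (int \<Rightarrow> 'a set) \<Rightarrow> ('a \<Rightarrow> 'a \<Rightarrow> 'a) \<Rightarrow>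
    ('a::ab_group_add \<Rightarrow> 'a) \<Rightarrow> (('b list \<Rightarrow>\<^sub>0 'k) \<Rightarrow> 'a) \<Rightarrow> bool"
  where "koszul_dual_via C scale G bracket \<delta> f \<longleftrightarrow>
    (\<forall>x\<in>cobar_lie C. \<forall>y\<in>cobar_lie C. f (gcomm C x y) = bracket (f x) (f y)) \<and>
    quasi_iso psc scale f (cobar_comm C) \<lparr>grd = G, rel = {0}, dif = \<delta>\<rparr>"


section \<open>The Hopf algebra structure and the Adams operations\<close>

text \<open>
  The product of \<open>\<Omega>(C) \<otimes> \<Omega>(C)\<close>, with the Koszul sign, and the coproduct: the homomorphism of
  algebras \<open>\<Omega>(C) \<rightarrow> \<Omega>(C) \<otimes> \<Omega>(C)\<close> for which the letters are primitive.
\<close>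

definition tprod ::
  "('b, 'k::field) dgcoalg \<Rightarrow> ('b list \<times> 'b list \<Rightarrow>\<^sub>0 'k) \<Rightarrow> ('b list \<times> 'b list \<Rightarrow>\<^sub>0 'k) \<Rightarrow>
    'b list \<times> 'b list \<Rightarrow>\<^sub>0 'k"
  where "tprod C x y =
    lin (\<lambda>(u, v). lin (\<lambda>(u', v'). psc ((-1) powi (wdeg C v * wdeg C u')) (bas (u @ u', v @ v'))) y) x"

fun coprod_word :: "('b, 'k::field) dgcoalg \<Rightarrow> 'b list \<Rightarrow> 'b list \<times> 'b list \<Rightarrow>\<^sub>0 'k"
  where
    "coprod_word C [] = bas ([], [])"
  | "coprod_word C (c # w) = tprod C (bas ([c], []) + bas ([], [c])) (coprod_word C w)"

text \<open>
  The \<open>p\<close>-fold coproduct \<open>\<Omega>(C) \<rightarrow> \<Omega>(C)\<^bsup>\<otimes>p\<^esup>\<close>: the counit for \<open>p = 0\<close>, then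
  \<open>\<Delta>\<^bsup>p+1\<^esup> = (id \<otimes> \<Delta>\<^bsup>p\<^esup>) \<circ> \<Delta>\<close>.
\<close>

fun iter_coprod_word :: "('b, 'k::field) dgcoalg \<Rightarrow> nat \<Rightarrow> 'b list \<Rightarrow> 'b list list \<Rightarrow>\<^sub>0 'k"
  where
    "iter_coprod_word C 0 w = (if w = [] then bas [] else 0)"
  | "iter_coprod_word C (Suc p) w =
      lin (\<lambda>(u, v). bas [u] * iter_coprod_word C p v) (coprod_word C w)"

definition iter_coprod ::
  "('b, 'k::field) dgcoalg \<Rightarrow> nat \<Rightarrow> ('b list \<Rightarrow>\<^sub>0 'k) \<Rightarrow> 'b list list \<Rightarrow>\<^sub>0 'k"
  where "iter_coprod C p = lin (iter_coprod_word C p)"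

text \<open>This is \<open>m\<^sub>p\<close> on \<open>\<Omega>(C)\<^bsup>\<otimes>p\<^esup>\<close>.\<close>

definition iter_prod :: "('b list list \<Rightarrow>\<^sub>0 'k::field) \<Rightarrow> 'b list \<Rightarrow>\<^sub>0 'k"
  where "iter_prod = lin (\<lambda>ws. bas (concat ws))"

definition psi :: "('b, 'k::field) dgcoalg \<Rightarrow> nat \<Rightarrow> ('b list \<Rightarrow>\<^sub>0 'k) \<Rightarrow> 'b list \<Rightarrow>\<^sub>0 'k"
  where "psi C p = iter_prod \<circ> iter_coprod C p"

definition adams ::
  "('b, 'k::field) dgcoalg \<Rightarrow> nat \<Rightarrow> int \<Rightarrow> ('b list \<Rightarrow>\<^sub>0 'k) set \<Rightarrow> ('b list \<Rightarrow>\<^sub>0 'k) set"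
  where "adams C p n = hmap (psi C p) (cobar_natural C) n"


section \<open>Symmetric powers and Lie coinvariants\<close>

text \<open>
  Throughout, \<open>\<LL> = \<Omega>\<^sub>C\<^sub>o\<^sub>m\<^sub>m(C)\<close>.  As \<open>k\<close> is a field, \<open>\<LL>\<^bsup>\<otimes>d\<^esup>\<close> is a subspace of \<open>\<Omega>(C)\<^bsup>\<otimes>d\<^esup>\<close>.  The
  complex \<open>Sym\<^sup>d(\<LL>) / [\<LL>, Sym\<^sup>d(\<LL>)]\<close> is presented as the quotient of \<open>\<LL>\<^bsup>\<otimes>d\<^esup>\<close> by the symmetry
  relations and by the image of the action of \<open>\<LL>\<close> by derivations.
\<close>

definition lie_power :: "('b, 'k::field) dgcoalg \<Rightarrow> nat \<Rightarrow> ('b list list \<Rightarrow>\<^sub>0 'k) set"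
  where "lie_power C d = pm.span {tens xs | xs. length xs = d \<and> set xs \<subseteq> cobar_lie C}"

definition lie_power_grd :: "('b, 'k::field) dgcoalg \<Rightarrow> nat \<Rightarrow> int \<Rightarrow> ('b list list \<Rightarrow>\<^sub>0 'k) set"
  where "lie_power_grd C d n =
    {t \<in> lie_power C d. \<forall>ws\<in>Poly_Mapping.keys t. (\<Sum>w\<leftarrow>ws. wdeg C w) = n}"

fun tensor_diff_words :: "('b, 'k::field) dgcoalg \<Rightarrow> 'b list list \<Rightarrow> 'b list list \<Rightarrow>\<^sub>0 'k"
  where
    "tensor_diff_words C [] = 0"
  | "tensor_diff_words C (w # ws) =
      emb (cobar_diff C (bas w)) * bas ws +
      psc ((-1) powi wdeg C w) (bas [w] * tensor_diff_words C ws)"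

definition tensor_diff ::
  "('b, 'k::field) dgcoalg \<Rightarrow> ('b list list \<Rightarrow>\<^sub>0 'k) \<Rightarrow> 'b list list \<Rightarrow>\<^sub>0 'k"
  where "tensor_diff C = lin (tensor_diff_words C)"

definition sym_relations :: "('b, 'k::field) dgcoalg \<Rightarrow> nat \<Rightarrow> ('b list list \<Rightarrow>\<^sub>0 'k) set"
  where "sym_relations C d =
    {tens (xs @ [x, y] @ ys) - psc ((-1) powi (m * n)) (tens (xs @ [y, x] @ ys)) | xs x y ys m n.
      length (xs @ [x, y] @ ys) = d \<and> set xs \<subseteq> cobar_lie C \<and> set ys \<subseteq> cobar_lie C \<and>
      x \<in> cobar_lie_grd C m \<and> y \<in> cobar_lie_grd C n}"

text \<open>
  The adjoint action \<open>x \<cdot> (y\<^sub>1 \<otimes> \<dots> \<otimes> y\<^sub>d) = \<Sum>\<^sub>i \<plusminus> y\<^sub>1 \<otimes> \<dots> \<otimes> [x, y\<^sub>i] \<otimes> \<dots> \<otimes> y\<^sub>d\<close>, with the Koszul sign for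
  moving \<open>x\<close> past \<open>y\<^sub>1, \<dots>, y\<^sub>i\<^sub>-\<^sub>1\<close>.
\<close>

fun ad_words :: "('b, 'k::field) dgcoalg \<Rightarrow> 'b list \<Rightarrow> 'b list list \<Rightarrow> 'b list list \<Rightarrow>\<^sub>0 'k"
  where
    "ad_words C u [] = 0"
  | "ad_words C u (w # ws) =
      emb (gcomm C (bas u) (bas w)) * bas ws +
      psc ((-1) powi (wdeg C u * wdeg C w)) (bas [w] * ad_words C u ws)"

definition ad_action ::
  "('b, 'k::field) dgcoalg \<Rightarrow> ('b list \<Rightarrow>\<^sub>0 'k) \<Rightarrow> ('b list list \<Rightarrow>\<^sub>0 'k) \<Rightarrow> 'b list list \<Rightarrow>\<^sub>0 'k"
  where "ad_action C x t = lin (\<lambda>u. lin (ad_words C u) t) x"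

definition sym_coinvariants ::
  "('b, 'k::field) dgcoalg \<Rightarrow> nat \<Rightarrow> ('b list list \<Rightarrow>\<^sub>0 'k) qcomplex"
  where "sym_coinvariants C d =
    \<lparr>grd = lie_power_grd C d,
     rel = pm.span (sym_relations C d \<union>
             {ad_action C x t | x t. x \<in> cobar_lie C \<and> t \<in> lie_power C d}),
     dif = tensor_diff C\<rparr>"

definition HC_Lie :: "('b, 'k::field) dgcoalg \<Rightarrow> nat \<Rightarrow> int \<Rightarrow> ('b list list \<Rightarrow>\<^sub>0 'k) set set"
  where "HC_Lie C d n = homology (sym_coinvariants C d) n"

text \<open>
  The symmetrization map \<open>Sym\<^sup>d(\<LL>) \<rightarrow> \<U>(\<LL>) = \<Omega>(C)\<close>, that is
  \<open>y\<^sub>1 \<dots> y\<^sub>d \<mapsto> 1/d! \<Sum>\<^sub>\<sigma> \<plusminus> y\<^bsub>\<sigma>1\<^esub> \<dots> y\<^bsub>\<sigma>d\<^esub>\<close>; the Koszul sign has one factor for each inversion of \<open>\<sigma>\<close>.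
\<close>

definition koszul_sign :: "('b, 'k::field) dgcoalg \<Rightarrow> 'b list list \<Rightarrow> (nat \<Rightarrow> nat) \<Rightarrow> 'k"
  where "koszul_sign C ws \<sigma> =
    (\<Prod>(i, j)\<in>{(i, j). i < j \<and> j < length ws \<and> \<sigma> j < \<sigma> i}.
      (-1) powi (wdeg C (ws ! \<sigma> i) * wdeg C (ws ! \<sigma> j)))"

definition symmetrize_words :: "('b, 'k::field_char_0) dgcoalg \<Rightarrow> 'b list list \<Rightarrow> 'b list \<Rightarrow>\<^sub>0 'k"
  where "symmetrize_words C ws =
    psc (1 / fact (length ws))
      (\<Sum>\<sigma> | \<sigma> permutes {..<length ws}.
        psc (koszul_sign C ws \<sigma>) (bas (concat (map (\<lambda>i. ws ! \<sigma> i) [0..<length ws]))))"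

definition symmetrize ::
  "('b, 'k::field_char_0) dgcoalg \<Rightarrow> ('b list list \<Rightarrow>\<^sub>0 'k) \<Rightarrow> 'b list \<Rightarrow>\<^sub>0 'k"
  where "symmetrize C = lin (symmetrize_words C)"

text \<open>The map \<open>HC\<^sup>(\<^sup>d\<^sup>)(Lie, \<aa>) \<rightarrow> HC(\<U>(\<aa>))\<close> induced by symmetrization.\<close>

definition HC_Lie_inclusion ::
  "('b, 'k::field_char_0) dgcoalg \<Rightarrow> int \<Rightarrow> ('b list list \<Rightarrow>\<^sub>0 'k) set \<Rightarrow> ('b list \<Rightarrow>\<^sub>0 'k) set"
  where "HC_Lie_inclusion C n = hmap (symmetrize C) (cobar_natural C) n"

end

theory Submission
  imports Defs "HOL-Combinatorics.Multiset_Permutations"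
begin

text \<open>
  Write \<open>S\<close> for symmetrization.  Since Lie elements are primitive, \<open>\<psi>\<^sup>p\<close> sends a product \<open>y\<^sub>1 \<dots> y\<^sub>d\<close> of Lie
  elements to the sum of the \<open>p\<^sup>d\<close> signed rearrangements obtained by distributing the factors over \<open>p\<close>
  places, so \<open>S(y\<^sub>1, \<dots>, y\<^sub>d)\<close> is an eigenvector of eigenvalue \<open>p\<^sup>d\<close>.  As \<open>y\<^sub>1 \<dots> y\<^sub>d - S(y\<^sub>1, \<dots>, y\<^sub>d)\<close> is a sum of
  products of fewer Lie elements, these eigenvectors span \<open>\<Omega>(C)\<close>; the eigenvalues being distinct, every
  subspace stable under \<open>\<psi>\<^sup>2\<close> (boundaries, \<open>k + [\<Omega>(C), \<Omega>(C)]\<close>) splits accordingly.  The differential and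
  the brackets with Lie elements are derivations preserving the Lie elements; they commute with \<open>S\<close>,
  hence with \<open>\<psi>\<^sup>p\<close>.

  The kernel of \<open>S\<close> on the \<open>d\<close>-th tensor power of the Lie algebra consists of the symmetry relations: for
  any linear projection \<open>e\<close> of \<open>\<Omega>(C)\<close> onto the Lie elements with \<open>e(1) = 0\<close>, the map \<open>e\<^sup>\<otimes>\<^sup>d \<circ> \<Delta>\<^sup>d\<close> sends
  \<open>y\<^sub>1 \<dots> y\<^sub>d\<close> to the sum of the signed permutations of \<open>y\<^sub>1 \<otimes> \<dots> \<otimes> y\<^sub>d\<close>.  Finally \<open>[\<Omega>(C), \<Omega>(C)]\<close> is spanned by
  brackets with letters \<open>[c, S(t)] = S(c \<cdot> t)\<close>, so an element \<open>S(t)\<close> of \<open>k + [\<Omega>(C), \<Omega>(C)]\<close> comes from the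
  coinvariance relations.
\<close>

section \<open>Linear maps on free vector spaces\<close>

text \<open>In general \<psi>^p is not multiplicative, because the product of \<Omega>(C) is not
  graded commutative. Neither its compatibility with the differential nor the stability of
  commutators can therefore be checked on letters; both come from operators that commute with
  symmetrization and so preserve its eigenspaces. Koszul signs make sense for homogeneous factors
  only, and a Lie element is a combination of many words. Identities are therefore verified on words
  over an alphabet whose letters are whole tensor factors, and are transferred by multilinearity.
  The symmetrization isomorphism is established along the way: spanning by induction on the number
  of factors, injectivity by counting the d! terms of the d-fold coproduct that have one letter in
  each factor. A single operator \<psi>^2 separates the components, since its eigenvalues 2^d are
  distinct in characteristic 0. The component d = 0 is the ground field, which is a relation of the
  natural quotient; hence the condition d > 0 wherever relations are compared.\<close>

definition plin :: "(('x \<Rightarrow>\<^sub>0 'k::field) \<Rightarrow> 'y \<Rightarrow>\<^sub>0 'k) \<Rightarrow> bool"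
  where "plin F \<longleftrightarrow> (\<forall>x y. F (x + y) = F x + F y) \<and> (\<forall>c x. F (psc c x) = psc c (F x))"

lemma plinI:
  assumes "\<And>x y. F (x + y) = F x + F y" and "\<And>c x. F (psc c x) = psc c (F x)"
  shows "plin F"
  using assms by (auto simp: plin_def)

lemma plin_add: "plin F \<Longrightarrow> F (x + y) = F x + F y"
  by (simp add: plin_def)

lemma plin_psc: "plin F \<Longrightarrow> F (psc c x) = psc c (F x)"
  by (simp add: plin_def)

lemma plin_0: "plin F \<Longrightarrow> F 0 = 0"
  using plin_psc[of F 0 0] by simp

lemma plin_uminus: "plin F \<Longrightarrow> F (- x) = - F x"
  using plin_psc[of F "-1" x] by simp

lemma plin_diff: "plin F \<Longrightarrow> F (x - y) = F x - F y"
  using plin_add[of F x "- y"] plin_uminus[of F y] by simp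

lemma plin_sum: "plin F \<Longrightarrow> F (sum g A) = (\<Sum>a\<in>A. F (g a))"
  by (induction A rule: infinite_finite_induct) (simp_all add: plin_0[of F] plin_add[of F])

lemma lin_eq_sum:
  assumes "finite A" "Poly_Mapping.keys x \<subseteq> A"
  shows "lin f x = (\<Sum>i\<in>A. psc (Poly_Mapping.lookup x i) (f i))"
  unfolding lin_def by (rule sum.mono_neutral_left) (use assms in \<open>auto simp: in_keys_iff\<close>)

lemma lin_add: "lin f (x + y) = lin f x + lin f y"
proof -
  let ?A = "Poly_Mapping.keys x \<union> Poly_Mapping.keys y"
  have "lin f (x + y) = (\<Sum>i\<in>?A. psc (Poly_Mapping.lookup (x + y) i) (f i))"
    by (rule lin_eq_sum) (use Poly_Mapping.keys_add[of x y] in auto)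
  moreover have "lin f x = (\<Sum>i\<in>?A. psc (Poly_Mapping.lookup x i) (f i))"
    by (rule lin_eq_sum) auto
  moreover have "lin f y = (\<Sum>i\<in>?A. psc (Poly_Mapping.lookup y i) (f i))"
    by (rule lin_eq_sum) auto
  ultimately show ?thesis
    by (simp add: Poly_Mapping.lookup_add pm.scale_left_distrib sum.distrib)
qed

lemma lin_psc: "lin f (psc c x) = psc c (lin f x)"
proof -
  have "lin f (psc c x) = (\<Sum>i\<in>Poly_Mapping.keys x. psc (Poly_Mapping.lookup (psc c x) i) (f i))"
    by (rule lin_eq_sum) (auto simp: in_keys_iff)
  then show ?thesis
    by (simp add: lin_def pm.scale_sum_right)
qed

lemma plin_lin: "plin (lin f)"
  by (simp add: plin_def lin_add lin_psc)

lemmas lin_0 [simp] = plin_0[OF plin_lin]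
lemmas lin_diff = plin_diff[OF plin_lin]
lemmas lin_sum = plin_sum[OF plin_lin]

lemma lin_bas [simp]: "lin f (bas i) = f i"
  by (simp add: lin_def)

lemma poly_mapping_eq_sum:
  "x = (\<Sum>i\<in>Poly_Mapping.keys x. psc (Poly_Mapping.lookup x i) (bas i :: _ \<Rightarrow>\<^sub>0 'k::field))"
proof (rule poly_mapping_eqI)
  fix j
  have "(\<Sum>i\<in>Poly_Mapping.keys x. Poly_Mapping.lookup x i * Poly_Mapping.lookup (bas i) j) =
    (\<Sum>i\<in>Poly_Mapping.keys x. if i = j then Poly_Mapping.lookup x j else (0::'k))"
    by (rule sum.cong) (auto simp: lookup_single when_def)
  then show "Poly_Mapping.lookup x j =
      Poly_Mapping.lookup (\<Sum>i\<in>Poly_Mapping.keys x. psc (Poly_Mapping.lookup x i) (bas i)) j"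
    by (simp add: Poly_Mapping.lookup_sum in_keys_iff)
qed

lemma plin_eq_lin:
  assumes "plin F"
  shows "F x = lin (\<lambda>i. F (bas i)) x"
proof -
  have "F x = F (\<Sum>i\<in>Poly_Mapping.keys x. psc (Poly_Mapping.lookup x i) (bas i))"
    by (rule arg_cong[OF poly_mapping_eq_sum])
  then show ?thesis
    by (simp only: plin_sum[OF assms] plin_psc[OF assms] lin_def)
qed

lemma lin_cong: "(\<And>i. i \<in> Poly_Mapping.keys x \<Longrightarrow> f i = g i) \<Longrightarrow> lin f x = lin g x"
  by (simp add: lin_def)

text \<open>Only the basis elements occurring in \<open>x\<close> are tested. For homogeneous
  \<open>x\<close> the sign in a formula can thus be evaluated at one fixed degree, and identities
  between words become identities between homogeneous elements.\<close>

lemma plin_eqI: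
  assumes "plin F" "plin G" "\<And>i. i \<in> Poly_Mapping.keys x \<Longrightarrow> F (bas i) = G (bas i)"
  shows "F x = G x"
  unfolding plin_eq_lin[OF assms(1), of x] plin_eq_lin[OF assms(2), of x]
  by (rule lin_cong) (rule assms(3))

lemma lin_in_subspace:
  assumes "pm.subspace V" "\<And>i. i \<in> Poly_Mapping.keys x \<Longrightarrow> f i \<in> V"
  shows "lin f x \<in> V"
  unfolding lin_def by (intro pm.subspace_sum pm.subspace_scale assms)

lemma plin_in_subspace:
  assumes "plin F" "pm.subspace V" "\<And>i. i \<in> Poly_Mapping.keys x \<Longrightarrow> F (bas i) \<in> V"
  shows "F x \<in> V"
  by (subst plin_eq_lin[OF assms(1)]) (intro lin_in_subspace assms)

lemma lin_bas_id [simp]: "lin bas x = x"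
  using plin_eq_lin[of "\<lambda>x. x" x] by (simp add: plin_def[of "\<lambda>x. x"])

lemma psc_single: "psc c (Poly_Mapping.single i v) = Poly_Mapping.single i (c * v)"
  by (rule poly_mapping_eqI) (simp add: lookup_single when_def)

lemma psc_eq_mult: "psc c z = Poly_Mapping.single 0 c * (z :: 'x::monoid_add \<Rightarrow>\<^sub>0 'k::field)"
proof -
  have z: "z = (\<Sum>i\<in>Poly_Mapping.keys z. Poly_Mapping.single i (Poly_Mapping.lookup z i))"
    by (rule poly_mapping_eq_sum[of z, unfolded psc_single mult_1_right])
  have "psc c z = (\<Sum>i\<in>Poly_Mapping.keys z. psc c (Poly_Mapping.single i (Poly_Mapping.lookup z i)))"
    using arg_cong[OF z, of "psc c"] by (simp only: pm.scale_sum_right)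
  also have "\<dots> = (\<Sum>i\<in>Poly_Mapping.keys z.
      Poly_Mapping.single 0 c * Poly_Mapping.single i (Poly_Mapping.lookup z i))"
    by (simp add: psc_single mult_single)
  also have "\<dots> = Poly_Mapping.single 0 c * z"
    using arg_cong[OF z, of "(*) (Poly_Mapping.single 0 c)"] by (simp only: sum_distrib_left)
  finally show ?thesis .
qed

lemma psc_mult_left [simp]: "psc c x * y = psc c (x * (y :: 'x::monoid_add \<Rightarrow>\<^sub>0 'k::field))"
  by (simp add: psc_eq_mult mult.assoc)

text \<open>Concatenation is not commutative, so scalars have to be shown central: multiplication by
  \<open>Poly_Mapping.single 0 c\<close> from either side is scaling by \<open>c\<close>.\<close>

lemma psc_mult_right [simp]: "x * psc c y = psc c (x * (y :: 'x::monoid_add \<Rightarrow>\<^sub>0 'k::field))"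
proof -
  have single: "psc c z = z * Poly_Mapping.single 0 c" for z :: "'x \<Rightarrow>\<^sub>0 'k"
  proof -
    have z: "z = (\<Sum>i\<in>Poly_Mapping.keys z. Poly_Mapping.single i (Poly_Mapping.lookup z i))"
      by (rule poly_mapping_eq_sum[of z, unfolded psc_single mult_1_right])
    have "psc c z = (\<Sum>i\<in>Poly_Mapping.keys z. psc c (Poly_Mapping.single i (Poly_Mapping.lookup z i)))"
      using arg_cong[OF z, of "psc c"] by (simp only: pm.scale_sum_right)
    also have "\<dots> = (\<Sum>i\<in>Poly_Mapping.keys z.
        Poly_Mapping.single i (Poly_Mapping.lookup z i) * Poly_Mapping.single 0 c)"
      by (simp add: psc_single mult_single mult.commute)
    also have "\<dots> = z * Poly_Mapping.single 0 c"
      using arg_cong[OF z, of "\<lambda>z. z * Poly_Mapping.single 0 c"] by (simp only: sum_distrib_right)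
    finally show ?thesis .
  qed
  show ?thesis by (simp add: single mult.assoc)
qed

lemma plin_id: "plin (\<lambda>x. x)"
  by (simp add: plin_def)

lemma plin_zero: "plin (\<lambda>x. 0)"
  by (simp add: plin_def)

lemma plin_comp: "plin F \<Longrightarrow> plin G \<Longrightarrow> plin (\<lambda>x. F (G x))"
  by (simp add: plin_def)

lemma plin_lin_comp: "plin G \<Longrightarrow> plin (\<lambda>x. lin f (G x))"
  by (rule plin_comp[OF plin_lin])

lemma plin_plus: "plin F \<Longrightarrow> plin G \<Longrightarrow> plin (\<lambda>x. F x + G x)"
  by (simp add: plin_def pm.scale_right_distrib algebra_simps)

lemma plin_minus: "plin F \<Longrightarrow> plin G \<Longrightarrow> plin (\<lambda>x. F x - G x)"
  by (simp add: plin_def pm.scale_right_diff_distrib algebra_simps)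

lemma plin_scale: "plin F \<Longrightarrow> plin (\<lambda>x. psc c (F x))"
  by (simp add: plin_def pm.scale_right_distrib mult.commute)

lemma plin_mult_left: "plin F \<Longrightarrow> plin (\<lambda>x. a * F x)"
  for F :: "_ \<Rightarrow> 'x::monoid_add \<Rightarrow>\<^sub>0 'k::field"
  by (simp add: plin_def distrib_left)

lemma plin_mult_right: "plin F \<Longrightarrow> plin (\<lambda>x. F x * a)"
  for F :: "_ \<Rightarrow> 'x::monoid_add \<Rightarrow>\<^sub>0 'k::field"
  by (simp add: plin_def distrib_right)

lemma plin_sum_fun: "(\<And>a. a \<in> A \<Longrightarrow> plin (F a)) \<Longrightarrow> plin (\<lambda>x. \<Sum>a\<in>A. F a x)"
  by (simp add: plin_def sum.distrib pm.scale_sum_right)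

lemma plin_lin_fun: "(\<And>i. plin (F i)) \<Longrightarrow> plin (\<lambda>x. lin (\<lambda>i. F i x) y)"
  unfolding lin_def by (intro plin_sum_fun plin_scale)

lemma plin_case_prod: "(\<And>a b. plin (F a b)) \<Longrightarrow> plin (\<lambda>x. case p of (a, b) \<Rightarrow> F a b x)"
  by (cases p) simp

lemmas plin_intros = plin_id plin_zero plin_lin plin_lin_comp plin_plus plin_minus plin_scale
  plin_mult_left plin_mult_right plin_sum_fun plin_lin_fun plin_case_prod

lemma lin_zero [simp]: "lin (\<lambda>i. 0) x = 0"
  by (simp add: lin_def)

lemma lin_lin: "lin f (lin g x) = lin (\<lambda>i. lin f (g i)) x"
  by (rule plin_eqI) ((intro plin_intros)?; simp)+

lemma plin_lin_image: "plin F \<Longrightarrow> F (lin g x) = lin (\<lambda>i. F (g i)) x"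
  by (rule plin_eqI) (auto intro: plin_comp plin_lin)

lemma lin_plus_fun: "lin (\<lambda>i. f i + g i) x = lin f x + lin g x"
  by (rule plin_eqI) ((intro plin_intros)?; simp)+

lemma lin_psc_fun: "lin (\<lambda>i. psc c (f i)) x = psc c (lin f x)"
  by (rule plin_eqI) ((intro plin_intros)?; simp)+

lemma bas_mult [simp]: "bas u * bas v = (bas (u @ v) :: _ \<Rightarrow>\<^sub>0 'k::field)"
  by (simp add: mult_single plus_list_def)

lemma one_eq_bas: "(1 :: _ list \<Rightarrow>\<^sub>0 'k::field) = bas []"
  by (metis single_one zero_list_def)

section \<open>Signs and degrees\<close>

text \<open>A separate constant keeps exponents out of the simplifier: signs are handled as a
  symmetric bicharacter whose values have square 1.\<close>

definition ksign :: "int \<Rightarrow> int \<Rightarrow> 'k::field"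
  where "ksign m n = (-1) powi (m * n)"

lemma ksign_add_left: "ksign (a + b) c = (ksign a c * ksign b c :: 'k::field)"
  by (simp add: ksign_def distrib_right power_int_add)

lemma ksign_add_right: "ksign a (b + c) = (ksign a b * ksign a c :: 'k::field)"
  by (simp add: ksign_def distrib_left power_int_add)

lemma ksign_commute: "ksign a b = ksign b a"
  by (simp add: ksign_def mult.commute)

lemma ksign_square [simp]: "ksign a b * ksign a b = (1 :: 'k::field)"
  by (simp add: ksign_def flip: power_int_add power_int_mult_distrib)

lemma ksign_square_left [simp]: "ksign a b * (ksign a b * x) = (x :: 'k::field)"
  by (simp flip: mult.assoc)

lemma ksign_0 [simp]: "ksign 0 a = 1" "ksign a 0 = 1"
  by (simp_all add: ksign_def)

lemma wdeg_Nil [simp]: "wdeg C [] = 0"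
  and wdeg_Cons: "wdeg C (c # w) = cdeg C c - 1 + wdeg C w"
  and wdeg_append [simp]: "wdeg C (u @ v) = wdeg C u + wdeg C v"
  by (simp_all add: wdeg_def)

definition hom :: "('b, 'k::field) dgcoalg \<Rightarrow> int \<Rightarrow> ('b list \<Rightarrow>\<^sub>0 'k) \<Rightarrow> bool"
  where "hom C n x \<longleftrightarrow> (\<forall>w\<in>Poly_Mapping.keys x. wdeg C w = n)"

definition supp :: "'x set \<Rightarrow> ('x \<Rightarrow>\<^sub>0 'k::field) set"
  where "supp A = {x. Poly_Mapping.keys x \<subseteq> A}"

lemma subspace_supp: "pm.subspace (supp A :: ('x \<Rightarrow>\<^sub>0 'k::field) set)"
proof (rule pm.subspaceI)
  fix x y :: "'x \<Rightarrow>\<^sub>0 'k" assume "x \<in> supp A" "y \<in> supp A"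
  then show "x + y \<in> supp A"
    using Poly_Mapping.keys_add[of x y] by (auto simp: supp_def)
qed (auto simp: supp_def in_keys_iff subset_iff)

lemma bas_in_supp [simp]: "bas w \<in> supp A \<longleftrightarrow> w \<in> A"
  by (simp add: supp_def)

lemma hom_iff_supp: "hom C n x \<longleftrightarrow> x \<in> supp {w. wdeg C w = n}"
  by (auto simp: hom_def supp_def)

lemma hom_0 [simp]: "hom C n 0"
  by (simp add: hom_def)

lemma hom_bas [simp]: "hom C n (bas w) \<longleftrightarrow> wdeg C w = n"
  by (simp add: hom_def)

lemma hom_add: "hom C n x \<Longrightarrow> hom C n y \<Longrightarrow> hom C n (x + y)"
  unfolding hom_iff_supp by (rule pm.subspace_add[OF subspace_supp])

lemma hom_diff: "hom C n x \<Longrightarrow> hom C n y \<Longrightarrow> hom C n (x - y)"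
  unfolding hom_iff_supp by (rule pm.subspace_diff[OF subspace_supp])

lemma hom_psc: "hom C n x \<Longrightarrow> hom C n (psc c x)"
  unfolding hom_iff_supp by (rule pm.subspace_scale[OF subspace_supp])

lemma hom_lin: "(\<And>i. i \<in> Poly_Mapping.keys x \<Longrightarrow> hom C n (f i)) \<Longrightarrow> hom C n (lin f x)"
  unfolding hom_iff_supp by (rule lin_in_subspace[OF subspace_supp])

lemma plin_hom: "plin F \<Longrightarrow> (\<And>w. wdeg C w = n \<Longrightarrow> hom C' m (F (bas w))) \<Longrightarrow> hom C n x \<Longrightarrow> hom C' m (F x)"
  unfolding hom_iff_supp[of C'] by (rule plin_in_subspace[OF _ subspace_supp]) (auto simp: hom_def)

lemma hom_mult:
  assumes "hom C m x" "hom C n y"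
  shows "hom C (m + n) (x * y)"
proof (rule plin_hom[of "\<lambda>x. x * y", OF _ _ assms(1)])
  fix w assume w: "wdeg C w = m"
  show "hom C (m + n) (bas w * y)"
    by (rule plin_hom[of "\<lambda>y. bas w * y", OF _ _ assms(2)]) (auto intro!: plin_intros simp: w)
qed (intro plin_intros)

lemma gcomm_ksign: "gcomm C x y = lin (\<lambda>u. lin (\<lambda>v.
    bas u * bas v - psc (ksign (wdeg C u) (wdeg C v)) (bas v * bas u)) y) x"
  by (simp add: gcomm_def ksign_def)

lemma plin_gcomm_left: "plin (\<lambda>x. gcomm C x y)"
  unfolding gcomm_def by (intro plin_intros)

lemma plin_gcomm_right: "plin (\<lambda>y. gcomm C x y)"
  unfolding gcomm_def by (intro plin_intros)

lemma gcomm_hom: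
  assumes "hom C m x" "hom C n y"
  shows "gcomm C x y = x * y - psc (ksign m n) (y * x)"
proof (rule plin_eqI[of "\<lambda>x. gcomm C x y"])
  fix u assume "u \<in> Poly_Mapping.keys x"
  then have u: "wdeg C u = m" using assms by (auto simp: hom_def)
  show "gcomm C (bas u) y = bas u * y - psc (ksign m n) (y * bas u)"
    by (rule plin_eqI[of "\<lambda>y. gcomm C (bas u) y"])
      (use assms u in \<open>auto intro!: plin_intros plin_gcomm_right simp: hom_def gcomm_ksign\<close>)
qed (intro plin_intros plin_gcomm_left)+

section \<open>Diagonal extensions of maps to tensor powers\<close>

lemma plin_emb: "plin emb"
  by (simp add: emb_def plin_lin)

lemma emb_bas [simp]: "emb (bas w) = bas [w]"
  by (simp add: emb_def)

lemma tens_Nil [simp]: "tens [] = bas []"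
  by (simp add: tens_def one_eq_bas)

lemma tens_Cons [simp]: "tens (x # xs) = emb x * tens xs"
  by (simp add: tens_def)

lemma tens_append: "tens (xs @ ys) = tens xs * tens ys"
  by (simp add: tens_def)

lemma plin_emb_comp: "plin F \<Longrightarrow> plin (\<lambda>x. emb (F x))"
  by (rule plin_comp[OF plin_emb])

lemmas plin_intros' = plin_intros plin_emb_comp

lemma plin_iter_prod: "plin iter_prod"
  by (simp add: iter_prod_def plin_lin)

lemma plin_iter_prod_comp: "plin F \<Longrightarrow> plin (\<lambda>x. iter_prod (F x))"
  by (rule plin_comp[OF plin_iter_prod])

lemma iter_prod_bas [simp]: "iter_prod (bas ws) = bas (concat ws)"
  by (simp add: iter_prod_def)

lemma bas_mult_assoc [simp]: "bas u * (bas v * z) = (bas (u @ v) :: _ \<Rightarrow>\<^sub>0 'k::field) * z"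
  by (simp flip: mult.assoc)

lemma iter_prod_mult [simp]: "iter_prod (x * y) = iter_prod x * iter_prod y"
proof (rule plin_eqI[of "\<lambda>x. iter_prod (x * y)"])
  fix u
  show "iter_prod (bas u * y) = iter_prod (bas u) * iter_prod y"
    by (rule plin_eqI[of "\<lambda>y. iter_prod (bas u * y)"])
      (simp | intro plin_intros plin_iter_prod_comp)+
qed (intro plin_intros plin_iter_prod_comp)+

lemma iter_prod_emb [simp]: "iter_prod (emb x) = x"
  by (rule plin_eqI[of "\<lambda>x. iter_prod (emb x)"])
      (simp | intro plin_intros' plin_iter_prod_comp)+

fun diag_op_words :: "('b, 'k::field) dgcoalg \<Rightarrow> int \<Rightarrow> (('b list \<Rightarrow>\<^sub>0 'k) \<Rightarrow> 'b list \<Rightarrow>\<^sub>0 'k) \<Rightarrow>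
    'b list list \<Rightarrow> 'b list list \<Rightarrow>\<^sub>0 'k"
  where
    "diag_op_words C m D [] = 0"
  | "diag_op_words C m D (w # ws) =
      emb (D (bas w)) * bas ws + psc (ksign m (wdeg C w)) (bas [w] * diag_op_words C m D ws)"

text \<open>
  The operator \<open>\<Sum>\<^sub>i 1 \<otimes> \<dots> \<otimes> D \<otimes> \<dots> \<otimes> 1\<close> induced on tensor powers by an operator \<open>D\<close> of degree \<open>m\<close>, with
  Koszul signs.  It covers the differential, the adjoint action and left multiplication.
\<close>

definition diag_op :: "('b, 'k::field) dgcoalg \<Rightarrow> int \<Rightarrow> (('b list \<Rightarrow>\<^sub>0 'k) \<Rightarrow> 'b list \<Rightarrow>\<^sub>0 'k) \<Rightarrow>
    ('b list list \<Rightarrow>\<^sub>0 'k) \<Rightarrow> 'b list list \<Rightarrow>\<^sub>0 'k"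
  where "diag_op C m D = lin (diag_op_words C m D)"

lemma plin_diag_op: "plin (diag_op C m D)"
  by (simp add: diag_op_def plin_lin)

lemma plin_diag_op_comp: "plin F \<Longrightarrow> plin (\<lambda>x. diag_op C m D (F x))"
  by (rule plin_comp[OF plin_diag_op])

lemma diag_op_bas: "diag_op C m D (bas ws) = diag_op_words C m D ws"
  by (simp add: diag_op_def)

lemma diag_op_bas_mult:
  "diag_op C m D (bas [w] * t) = emb (D (bas w)) * t + psc (ksign m (wdeg C w)) (bas [w] * diag_op C m D t)"
  by (rule plin_eqI[of "\<lambda>t. diag_op C m D (bas [w] * t)"])
    (simp add: diag_op_bas | intro plin_intros plin_diag_op_comp plin_diag_op)+

lemma diag_op_emb_mult:
  assumes "plin D" "hom C n x"
  shows "diag_op C m D (emb x * t) = emb (D x) * t + psc (ksign m n) (emb x * diag_op C m D t)"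
proof (rule plin_eqI[of "\<lambda>x. diag_op C m D (emb x * t)"])
  fix w assume "w \<in> Poly_Mapping.keys x"
  then have "wdeg C w = n" using assms(2) by (auto simp: hom_def)
  then show "diag_op C m D (emb (bas w) * t) = emb (D (bas w)) * t + psc (ksign m n) (emb (bas w) * diag_op C m D t)"
    by (simp add: diag_op_bas_mult)
qed (use assms in \<open>intro plin_intros' plin_diag_op_comp plin_diag_op\<close>)+

definition degree_op :: "('b, 'k::field) dgcoalg \<Rightarrow> int \<Rightarrow> (('b list \<Rightarrow>\<^sub>0 'k) \<Rightarrow> 'b list \<Rightarrow>\<^sub>0 'k) \<Rightarrow> bool"
  where "degree_op C m D \<longleftrightarrow> plin D \<and> (\<forall>w. hom C (m + wdeg C w) (D (bas w)))"

lemma degree_op_plin: "degree_op C m D \<Longrightarrow> plin D"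
  by (simp add: degree_op_def)

lemma degree_op_hom: "degree_op C m D \<Longrightarrow> hom C n x \<Longrightarrow> hom C (m + n) (D x)"
  by (rule plin_hom[of D]) (auto simp: degree_op_def)

lemma degree_op_mult: "hom C n y \<Longrightarrow> degree_op C n ((*) y)"
  by (auto simp: degree_op_def intro!: hom_mult plin_intros)

text \<open>Terms with \<open>D\<close> and \<open>E\<close> on different factors occur in both
  orders with signs that cancel; what remains is the graded commutator applied to one factor. For
  left multiplications by \<open>y\<close> and \<open>z\<close> this yields that a bracket of
  primitive elements is primitive.\<close>

lemma diag_op_commutator:
  assumes D: "degree_op C m D" and E: "degree_op C n E"
  shows "diag_op C m D (diag_op C n E t) - psc (ksign m n) (diag_op C n E (diag_op C m D t)) =
    diag_op C (m + n) (\<lambda>x. D (E x) - psc (ksign m n) (E (D x))) t"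
proof (rule plin_eqI[of "\<lambda>t. diag_op C m D (diag_op C n E t) - psc (ksign m n) (diag_op C n E (diag_op C m D t))"])
  fix ws
  note pD = degree_op_plin[OF D] and pE = degree_op_plin[OF E]
  let ?F = "\<lambda>x. D (E x) - psc (ksign m n) (E (D x))"
  show "diag_op C m D (diag_op C n E (bas ws)) - psc (ksign m n) (diag_op C n E (diag_op C m D (bas ws))) =
      diag_op C (m + n) ?F (bas ws)"
  proof (induction ws)
    case Nil
    then show ?case by (simp add: diag_op_bas plin_0[OF plin_diag_op])
  next
    case (Cons w ws)
    have hD: "hom C (m + wdeg C w) (D (bas w))" and hE: "hom C (n + wdeg C w) (E (bas w))"
      using D E by (auto simp: degree_op_def)
    have split: "bas (w # ws) = bas [w] * bas ws" by simp
    define X where "X = diag_op C m D (diag_op C n E (bas ws))"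
    define Y where "Y = diag_op C n E (diag_op C m D (bas ws))"
    have IH: "diag_op C (m + n) ?F (bas ws) = X - psc (ksign m n) Y"
      using Cons.IH by (simp add: X_def Y_def)
    have 1: "diag_op C m D (diag_op C n E (bas (w # ws))) = emb (D (E (bas w))) * bas ws
        + psc (ksign m n * ksign m (wdeg C w)) (emb (E (bas w)) * diag_op C m D (bas ws))
        + psc (ksign n (wdeg C w)) (emb (D (bas w)) * diag_op C n E (bas ws))
        + psc (ksign n (wdeg C w) * ksign m (wdeg C w)) (bas [w] * X)"
      by (simp add: split diag_op_bas_mult plin_add[OF plin_diag_op] plin_psc[OF plin_diag_op] X_def
          diag_op_emb_mult[OF pD hE] pm.scale_right_distrib ksign_add_right del: bas_mult)
    have 2: "diag_op C n E (diag_op C m D (bas (w # ws))) = emb (E (D (bas w))) * bas ws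
        + psc (ksign n m * ksign n (wdeg C w)) (emb (D (bas w)) * diag_op C n E (bas ws))
        + psc (ksign m (wdeg C w)) (emb (E (bas w)) * diag_op C m D (bas ws))
        + psc (ksign m (wdeg C w) * ksign n (wdeg C w)) (bas [w] * Y)"
      by (simp add: split diag_op_bas_mult plin_add[OF plin_diag_op] plin_psc[OF plin_diag_op] Y_def
          diag_op_emb_mult[OF pE hD] pm.scale_right_distrib ksign_add_right del: bas_mult)
    have 3: "diag_op C (m + n) ?F (bas (w # ws)) = emb (D (E (bas w))) * bas ws
        - psc (ksign m n) (emb (E (D (bas w))) * bas ws)
        + psc (ksign m (wdeg C w) * ksign n (wdeg C w)) (bas [w] * (X - psc (ksign m n) Y))"
      by (simp add: split diag_op_bas_mult IH plin_diff[OF plin_emb] plin_psc[OF plin_emb]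
          left_diff_distrib ksign_add_left del: bas_mult)
    show ?case
      unfolding 1 2 3
      by (simp add: pm.scale_right_distrib pm.scale_right_diff_distrib right_diff_distrib
          ksign_commute[of n m] algebra_simps)
  qed
qed (intro plin_intros plin_diag_op_comp plin_diag_op)+

definition derivation :: "('b, 'k::field) dgcoalg \<Rightarrow> int \<Rightarrow> (('b list \<Rightarrow>\<^sub>0 'k) \<Rightarrow> 'b list \<Rightarrow>\<^sub>0 'k) \<Rightarrow> bool"
  where "derivation C m D \<longleftrightarrow> degree_op C m D \<and> D (bas []) = 0 \<and>
    (\<forall>u v. D (bas (u @ v)) = D (bas u) * bas v + psc (ksign m (wdeg C u)) (bas u * D (bas v)))"

lemma derivation_mult:
  assumes "derivation C m D" "hom C n x"
  shows "D (x * y) = D x * y + psc (ksign m n) (x * D y)"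
proof (rule plin_eqI[of "\<lambda>x. D (x * y)"])
  have pD: "plin D" using assms by (simp add: derivation_def degree_op_def)
  show "plin (\<lambda>x. D (x * y))" "plin (\<lambda>x. D x * y + psc (ksign m n) (x * D y))"
    by (intro plin_intros plin_comp[OF pD] pD)+
  fix u assume "u \<in> Poly_Mapping.keys x"
  then have "wdeg C u = n" using assms(2) by (auto simp: hom_def)
  show "D (bas u * y) = D (bas u) * y + psc (ksign m n) (bas u * D y)"
  proof (rule plin_eqI[of "\<lambda>y. D (bas u * y)"])
    show "plin (\<lambda>y. D (bas u * y))" "plin (\<lambda>y. D (bas u) * y + psc (ksign m n) (bas u * D y))"
      by (intro plin_intros plin_comp[OF pD] pD)+
  qed (use assms(1) \<open>wdeg C u = n\<close> in \<open>simp add: derivation_def\<close>)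
qed

text \<open>The Leibniz rule for a product of several factors; \<open>diag_op\<close> carries the
  signs of that rule.\<close>

lemma iter_prod_diag_op:
  assumes "derivation C m D"
  shows "iter_prod (diag_op C m D t) = D (iter_prod t)"
proof (rule plin_eqI[of "\<lambda>t. iter_prod (diag_op C m D t)"])
  fix ws :: "'a list list"
  show "iter_prod (diag_op C m D (bas ws)) = D (iter_prod (bas ws))"
  proof (induction ws)
    case Nil
    then show ?case using assms by (simp add: diag_op_bas plin_0[OF plin_iter_prod] derivation_def)
  next
    case (Cons w ws)
    then show ?case using assms
      by (simp add: diag_op_bas plin_add[OF plin_iter_prod] plin_psc[OF plin_iter_prod] derivation_def)
  qed
next
  have "plin D" using assms by (simp add: derivation_def degree_op_def)
  then show "plin (\<lambda>t. D (iter_prod t))"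
    by (rule plin_comp[OF _ plin_iter_prod])
qed (intro plin_iter_prod_comp plin_diag_op)

lemma derivation_gcomm:
  assumes "hom C n x"
  shows "derivation C n (gcomm C x)"
proof -
  have bas: "gcomm C x (bas w) = x * bas w - psc (ksign n (wdeg C w)) (bas w * x)" for w
    by (rule gcomm_hom) (use assms in auto)
  show ?thesis
    unfolding derivation_def degree_op_def
  proof (intro conjI allI plin_gcomm_right)
    fix w
    have "hom C (wdeg C w + n) (bas w * x)" "hom C (n + wdeg C w) (x * bas w)"
      by (intro hom_mult assms; simp)+
    then show "hom C (n + wdeg C w) (gcomm C x (bas w))"
      unfolding bas by (intro hom_diff hom_psc) (simp_all add: add.commute)
  next
    show "gcomm C x (bas []) = 0"
      unfolding bas by (simp flip: one_eq_bas)
  next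
    fix u v :: "'a list"
    have b: "bas (u @ v) = (bas u * bas v :: 'a list \<Rightarrow>\<^sub>0 'b)" by simp
    show "gcomm C x (bas (u @ v)) =
        gcomm C x (bas u) * bas v + psc (ksign n (wdeg C u)) (bas u * gcomm C x (bas v))"
      unfolding bas unfolding b wdeg_append
      by (simp add: algebra_simps pm.scale_right_diff_distrib ksign_add_right del: bas_mult bas_mult_assoc)
  qed
qed

section \<open>Lie monomials\<close>

lemma subspace_vimage: "plin F \<Longrightarrow> pm.subspace V \<Longrightarrow> pm.subspace {x. F x \<in> V}"
  by (auto simp: pm.subspace_def plin_0[of F] plin_add[of F] plin_psc[of F])

lemma subspace_image: "plin F \<Longrightarrow> pm.subspace V \<Longrightarrow> pm.subspace (F ` V)"
proof (rule pm.subspaceI)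
  assume F: "plin F" and V: "pm.subspace V"
  show "0 \<in> F ` V"
    using pm.subspace_0[OF V] plin_0[OF F] by force
  show "x + y \<in> F ` V" if "x \<in> F ` V" "y \<in> F ` V" for x y
    using that pm.subspace_add[OF V] plin_add[OF F] by (smt (verit) imageE imageI)
  show "psc c x \<in> F ` V" if "x \<in> F ` V" for c x
    using that pm.subspace_scale[OF V] plin_psc[OF F] by (smt (verit) imageE imageI)
qed

lemma span_induct_mem:
  "x \<in> pm.span S \<Longrightarrow> pm.subspace V \<Longrightarrow> (\<And>x. x \<in> S \<Longrightarrow> x \<in> V) \<Longrightarrow> x \<in> V"
  using pm.span_minimal[of S V] by auto

lemma subspace_ker: "plin F \<Longrightarrow> plin G \<Longrightarrow> pm.subspace {x. F x = G x}"
  by (auto simp: pm.subspace_def plin_0[of F] plin_add[of F] plin_psc[of F]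
      plin_0[of G] plin_add[of G] plin_psc[of G])

lemma subspace_cobar_lie: "pm.subspace (cobar_lie C)"
  by (auto simp: pm.subspace_def intro: cobar_lie.intros)

text \<open>Iterated brackets of letters, with their degree recorded. They span the Lie elements and
  are homogeneous, whereas a general element of \<open>cobar_lie C\<close> mixes degrees and admits
  no sign rule.\<close>

inductive lie_mono :: "('b, 'k::field) dgcoalg \<Rightarrow> int \<Rightarrow> ('b list \<Rightarrow>\<^sub>0 'k) \<Rightarrow> bool"
  for C :: "('b, 'k) dgcoalg"
  where
    letter: "c \<noteq> coaug C \<Longrightarrow> lie_mono C (wdeg C [c]) (bas [c])"
  | bracket: "lie_mono C m x \<Longrightarrow> lie_mono C n y \<Longrightarrow> lie_mono C (m + n) (gcomm C x y)"

lemma lie_mono_cobar_lie: "lie_mono C n x \<Longrightarrow> x \<in> cobar_lie C"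
  by (induction rule: lie_mono.induct) (auto intro: cobar_lie.intros)

lemma lie_mono_hom: "lie_mono C n x \<Longrightarrow> hom C n x"
proof (induction rule: lie_mono.induct)
  case (bracket m x n y)
  then have "hom C (m + n) (x * y)" "hom C (n + m) (y * x)"
    by (auto intro: hom_mult)
  then show ?case
    by (simp add: gcomm_hom[OF bracket.IH] hom_diff hom_psc add.commute)
qed simp

text \<open>By bilinearity the span of the Lie monomials is closed under brackets, so it contains
  every Lie element.\<close>

lemma cobar_lie_induct:
  assumes "x \<in> cobar_lie C" "pm.subspace V" "\<And>n x. lie_mono C n x \<Longrightarrow> x \<in> V"
  shows "x \<in> V"
proof -
  let ?M = "{x. \<exists>n. lie_mono C n x}"
  have gcomm: "gcomm C x y \<in> pm.span ?M" if x: "x \<in> pm.span ?M" and y: "y \<in> pm.span ?M" for x y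
  proof -
    have "x \<in> {x. gcomm C x y \<in> pm.span ?M}"
    proof (rule span_induct_mem[OF x])
      show "pm.subspace {x. gcomm C x y \<in> pm.span ?M}"
        by (rule subspace_vimage[OF plin_gcomm_left pm.subspace_span])
      fix x assume "x \<in> ?M"
      then obtain m where m: "lie_mono C m x" by auto
      have "y \<in> {y. gcomm C x y \<in> pm.span ?M}"
      proof (rule span_induct_mem[OF y])
        show "pm.subspace {y. gcomm C x y \<in> pm.span ?M}"
          by (rule subspace_vimage[OF plin_gcomm_right pm.subspace_span])
      qed (use m in \<open>auto intro!: pm.span_base lie_mono.bracket\<close>)
      then show "x \<in> {x. gcomm C x y \<in> pm.span ?M}" by simp
    qed
    then show ?thesis by simp
  qed
  have "x \<in> pm.span ?M"
    using assms(1)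
    by induction
      (auto intro: gcomm pm.span_zero pm.span_add pm.span_scale pm.span_base lie_mono.letter)
  moreover have "pm.span ?M \<subseteq> V"
    by (rule pm.span_minimal) (use assms in auto)
  ultimately show ?thesis by auto
qed

lemma cobar_eq_supp: "cobar C = supp {w. coaug C \<notin> set w}"
  by (auto simp: cobar_def supp_def)

lemma subspace_cobar: "pm.subspace (cobar C)"
  unfolding cobar_eq_supp by (rule subspace_supp)

lemma bas_in_cobar [simp]: "bas w \<in> cobar C \<longleftrightarrow> coaug C \<notin> set w"
  by (simp add: cobar_eq_supp)

lemma cobar_induct:
  assumes "x \<in> cobar C" "pm.subspace V" "\<And>w. coaug C \<notin> set w \<Longrightarrow> bas w \<in> V"
  shows "x \<in> V"
  using plin_in_subspace[OF plin_id assms(2), of x] assms by (auto simp: cobar_def)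

lemma cobar_mult:
  assumes "x \<in> cobar C" "y \<in> cobar C"
  shows "x * y \<in> cobar C"
proof -
  have "x \<in> {x. x * y \<in> cobar C}"
  proof (rule cobar_induct[OF assms(1)])
    fix w assume w: "coaug C \<notin> set w"
    have "y \<in> {y. bas w * y \<in> cobar C}"
      by (rule cobar_induct[OF assms(2)])
        (use w in \<open>(intro subspace_vimage subspace_cobar plin_intros)?; simp\<close>)+
    then show "bas w \<in> {x. x * y \<in> cobar C}" by simp
  qed (intro subspace_vimage subspace_cobar plin_intros)
  then show ?thesis by simp
qed

lemma gcomm_in_cobar:
  assumes "x \<in> cobar C" "y \<in> cobar C"
  shows "gcomm C x y \<in> cobar C"
  unfolding gcomm_def
  by (intro lin_in_subspace subspace_cobar pm.subspace_diff pm.subspace_scale cobar_mult)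
    (use assms in \<open>auto simp: cobar_def\<close>)

lemma cobar_lie_subset: "x \<in> cobar_lie C \<Longrightarrow> x \<in> cobar C"
  by (induction rule: cobar_lie.induct)
    (auto intro: gcomm_in_cobar pm.subspace_0 pm.subspace_add pm.subspace_scale subspace_cobar)

lemma hom_cobar_grd: "cobar_grd C n = {x \<in> cobar C. hom C n x}"
  by (simp add: cobar_grd_def hom_def)

lemma cobar_lie_grd_iff: "x \<in> cobar_lie_grd C n \<longleftrightarrow> x \<in> cobar_lie C \<and> hom C n x"
  using cobar_lie_subset by (auto simp: cobar_lie_grd_def hom_cobar_grd)

lemma lie_mono_grd: "lie_mono C n x \<Longrightarrow> x \<in> cobar_lie_grd C n"
  by (simp add: cobar_lie_grd_iff lie_mono_hom lie_mono_cobar_lie)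

lemma subspace_lie_power: "pm.subspace (lie_power C d)"
  by (simp add: lie_power_def)

lemma tens_in_lie_power: "set xs \<subseteq> cobar_lie C \<Longrightarrow> tens xs \<in> lie_power C (length xs)"
  unfolding lie_power_def by (rule pm.span_base) auto

abbreviation lie_monos :: "('b, 'k::field) dgcoalg \<Rightarrow> ('b list \<Rightarrow>\<^sub>0 'k) list \<Rightarrow> bool"
  where "lie_monos C xs \<equiv> (\<forall>x\<in>set xs. \<exists>n. lie_mono C n x)"

lemma lie_monos_cobar_lie: "lie_monos C xs \<Longrightarrow> set xs \<subseteq> cobar_lie C"
  using lie_mono_cobar_lie by auto

text \<open>Multilinear expansion of every factor into Lie monomials. \<open>V\<close> is
  generalized in the induction because the tail is expanded inside the preimage of \<open>V\<close>
  under multiplication by the first factor.\<close>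

lemma lie_power_induct:
  assumes "t \<in> lie_power C d" "pm.subspace V"
    and "\<And>xs. length xs = d \<Longrightarrow> lie_monos C xs \<Longrightarrow> tens xs \<in> V"
  shows "t \<in> V"
proof -
  have *: "tens xs \<in> V" if "set xs \<subseteq> cobar_lie C" "pm.subspace V"
      "\<And>ys. length ys = length xs \<Longrightarrow> lie_monos C ys \<Longrightarrow> tens ys \<in> V"
    for xs and V :: "('a list list \<Rightarrow>\<^sub>0 'b) set"
    using that
  proof (induction xs arbitrary: V)
    case (Cons x xs)
    have "x \<in> {x. emb x * tens xs \<in> V}"
    proof (rule cobar_lie_induct)
      show "x \<in> cobar_lie C" using Cons.prems by auto
      show "pm.subspace {x. emb x * tens xs \<in> V}"
        by (intro subspace_vimage Cons.prems plin_intros plin_emb)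
      fix n y assume y: "lie_mono C n y"
      have "tens xs \<in> {t. emb y * t \<in> V}"
      proof (rule Cons.IH)
        show "pm.subspace {t. emb y * t \<in> V}"
          by (intro subspace_vimage Cons.prems plin_intros plin_emb)
        fix ys assume "length ys = length xs" "lie_monos C ys"
        then show "tens ys \<in> {t. emb y * t \<in> V}"
          using Cons.prems(3)[of "y # ys"] y by auto
      qed (use Cons.prems in auto)
      then show "y \<in> {x. emb x * tens xs \<in> V}" by simp
    qed
    then show ?case by simp
  qed simp
  have "pm.span {tens xs | xs. length xs = d \<and> set xs \<subseteq> cobar_lie C} \<subseteq> V"
    by (rule pm.span_minimal) (use * assms in auto)
  then show ?thesis using assms(1) by (auto simp: lie_power_def)
qed

lemma emb_mult_lie_power:
  assumes "x \<in> cobar_lie C" "t \<in> lie_power C d"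
  shows "emb x * t \<in> lie_power C (Suc d)"
proof -
  have "t \<in> {t. emb x * t \<in> lie_power C (Suc d)}"
  proof (rule lie_power_induct[OF assms(2)])
    show "pm.subspace {t. emb x * t \<in> lie_power C (Suc d)}"
      by (intro subspace_vimage subspace_lie_power plin_intros)
    fix xs assume "length xs = d" "lie_monos C xs"
    then show "tens xs \<in> {t. emb x * t \<in> lie_power C (Suc d)}"
      using tens_in_lie_power[of "x # xs" C] assms(1) lie_monos_cobar_lie[of xs C] by auto
  qed
  then show ?thesis by simp
qed

lemma lie_power_length:
  assumes "t \<in> lie_power C d"
  shows "t \<in> supp {ws. length ws = d}"
proof (rule lie_power_induct[OF assms subspace_supp])
  have *: "tens xs \<in> supp {ws. length ws = length xs}" for xs :: "('a list \<Rightarrow>\<^sub>0 'b) list"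
  proof (induction xs)
    case (Cons x xs)
    have "emb x * bas ws \<in> supp {vs. length vs = Suc (length ws)}" for ws
      by (rule plin_in_subspace[of "\<lambda>x. emb x * bas ws"])
        ((intro plin_intros plin_emb subspace_supp)?; simp)+
    then have e: "emb x * bas ws \<in> supp {vs. length vs = Suc (length xs)}" if "length ws = length xs" for ws
      using that by metis
    have "emb x * tens xs \<in> supp {ws. length ws = Suc (length xs)}"
    proof (rule plin_in_subspace[of "\<lambda>t. emb x * t", OF _ subspace_supp])
      fix ws assume "ws \<in> Poly_Mapping.keys (tens xs)"
      then have "length ws = length xs" using Cons by (auto simp: supp_def)
      then show "emb x * bas ws \<in> supp {ws. length ws = Suc (length xs)}" by (rule e)
    qed (intro plin_intros)
    then show ?case by simp
  qed simp
  show "tens xs \<in> supp {ws. length ws = d}" if "length xs = d"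
    for xs :: "('a list \<Rightarrow>\<^sub>0 'b) list"
    using *[of xs] that by simp
qed

section \<open>The iterated coproduct\<close>

text \<open>The primitive letter \<open>c\<close> enters the left factor, or crosses the left part
  \<open>u\<close> with its Koszul sign and enters the right factor.\<close>

lemma coprod_word_Cons:
  "coprod_word C (c # w) = lin (\<lambda>(u, v). bas (c # u, v) +
     psc (ksign (wdeg C [c]) (wdeg C u)) (bas (u, c # v))) (coprod_word C w)"
  by (simp add: tprod_def lin_add ksign_def case_prod_unfold lin_plus_fun)

declare coprod_word.simps(2) [simp del]

lemma iter_coprod_word_Nil: "iter_coprod_word C p [] = bas (replicate p [])"
  by (induction p) simp_all

text \<open>Primitivity of a letter for the \<open>p\<close>-fold coproduct: it is multiplied into
  each of the \<open>p\<close> factors in turn, crossing the earlier ones with a sign.\<close>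

lemma iter_coprod_word_Cons:
  "iter_coprod_word C p (c # w) = diag_op C (wdeg C [c]) ((*) (bas [c])) (iter_coprod_word C p w)"
proof (induction p arbitrary: w)
  case 0
  then show ?case
    by (auto simp: plin_0[OF plin_diag_op] diag_op_bas)
next
  case (Suc p)
  let ?L = "diag_op C (wdeg C [c]) ((*) (bas [c]))"
  have "iter_coprod_word C (Suc p) (c # w) = lin (\<lambda>(u, v). bas [c # u] * iter_coprod_word C p v +
      psc (ksign (wdeg C [c]) (wdeg C u)) (bas [u] * ?L (iter_coprod_word C p v))) (coprod_word C w)"
    unfolding iter_coprod_word.simps coprod_word_Cons lin_lin
    by (rule lin_cong) (auto simp: lin_add lin_psc Suc.IH)
  also have "\<dots> = lin (\<lambda>(u, v). ?L (bas [u] * iter_coprod_word C p v)) (coprod_word C w)"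
    by (rule lin_cong) (auto simp: diag_op_bas_mult)
  also have "\<dots> = ?L (iter_coprod_word C (Suc p) w)"
    by (simp add: plin_lin_image[OF plin_diag_op] case_prod_unfold)
  finally show ?case .
qed

lemma plin_iter_coprod: "plin (iter_coprod C p)"
  by (simp add: iter_coprod_def plin_lin)

lemma iter_coprod_bas: "iter_coprod C p (bas w) = iter_coprod_word C p w"
  by (simp add: iter_coprod_def)

lemma iter_coprod_letter_mult:
  "iter_coprod C p (bas [c] * x) = diag_op C (wdeg C [c]) ((*) (bas [c])) (iter_coprod C p x)"
  by (rule plin_eqI[of "\<lambda>x. iter_coprod C p (bas [c] * x)"])
    (simp add: iter_coprod_bas iter_coprod_word_Cons
      | intro plin_intros plin_comp[OF plin_iter_coprod] plin_comp[OF plin_diag_op] plin_iter_coprod)+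

text \<open>Lie elements are primitive.\<close>

lemma iter_coprod_lie_mult:
  assumes "lie_mono C n y"
  shows "iter_coprod C p (y * x) = diag_op C n ((*) y) (iter_coprod C p x)"
  using assms
proof (induction arbitrary: x)
  case (letter c)
  then show ?case by (rule_tac iter_coprod_letter_mult)
next
  case (bracket m y n z)
  note hy = lie_mono_hom[OF bracket.hyps(1)] and hz = lie_mono_hom[OF bracket.hyps(2)]
  have "iter_coprod C p (gcomm C y z * x) =
      iter_coprod C p (y * (z * x)) - psc (ksign m n) (iter_coprod C p (z * (y * x)))"
    by (simp add: gcomm_hom[OF hy hz] left_diff_distrib plin_diff[OF plin_iter_coprod]
        plin_psc[OF plin_iter_coprod] mult.assoc)
  \<comment> \<open>Left multiplication by the bracket is the graded commutator of the two left
    multiplications.\<close>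
  also have "\<dots> = diag_op C (m + n) (\<lambda>x. y * (z * x) - psc (ksign m n) (z * (y * x))) (iter_coprod C p x)"
    unfolding bracket.IH by (intro diag_op_commutator degree_op_mult hy hz)
  also have "(\<lambda>x. y * (z * x) - psc (ksign m n) (z * (y * x))) = (*) (gcomm C y z)"
    by (simp add: gcomm_hom[OF hy hz] left_diff_distrib mult.assoc fun_eq_iff)
  finally show ?case .
qed

section \<open>Words of Lie elements\<close>

text \<open>
  The operations \<open>coprod_word\<close>, \<open>psi\<close>, \dots\ depend on the coalgebra only through the degrees of the letters.
  Here the words are the letters of a new alphabet, with unchanged degrees, so that the tensor powers
  of \<open>\<Omega>(C)\<close> become a tensor algebra.
\<close>

definition lift :: "('b, 'k::field) dgcoalg \<Rightarrow> ('b list, 'k) dgcoalg"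
  where "lift C = \<lparr>cdeg = (\<lambda>w. wdeg C w + 1), coaug = undefined, counit = (\<lambda>_. 0),
    cdiff = (\<lambda>_. 0), coprod = (\<lambda>_. 0)\<rparr>"

lemma wdeg_lift: "wdeg (lift C) ws = (\<Sum>w\<leftarrow>ws. wdeg C w)"
  by (simp add: wdeg_def lift_def)

lemma wdeg_concat: "wdeg C (concat ws) = wdeg (lift C) ws"
  by (simp add: wdeg_lift) (induction ws; simp)

lemma wdeg_lift_Cons [simp]: "wdeg (lift C) (w # ws) = wdeg C w + wdeg (lift C) ws"
  by (simp add: wdeg_lift)

lemma hom_emb: "hom C n x \<Longrightarrow> hom (lift C) n (emb x)"
  by (rule plin_hom[OF plin_emb]) auto

text \<open>The tensor power of \<open>iter_prod\<close>: factors are multiplied out inside each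
  place of the iterated coproduct, and the places stay apart.\<close>

definition map_concat :: "('b list list list \<Rightarrow>\<^sub>0 'k::field) \<Rightarrow> 'b list list \<Rightarrow>\<^sub>0 'k"
  where "map_concat = lin (\<lambda>wss. bas (map concat wss))"

lemma plin_map_concat: "plin map_concat"
  by (simp add: map_concat_def plin_lin)

lemma map_concat_bas [simp]: "map_concat (bas wss) = bas (map concat wss)"
  by (simp add: map_concat_def)

lemma map_concat_mult: "map_concat (x * y) = map_concat x * map_concat y"
proof (rule plin_eqI[of "\<lambda>x. map_concat (x * y)"])
  fix u
  show "map_concat (bas u * y) = map_concat (bas u) * map_concat y"
    by (rule plin_eqI[of "\<lambda>y. map_concat (bas u * y)"])
      (simp | intro plin_intros plin_comp[OF plin_map_concat] plin_map_concat)+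
qed (intro plin_intros plin_comp[OF plin_map_concat] plin_map_concat)+

lemma map_concat_emb: "map_concat (emb x) = emb (iter_prod x)"
  by (rule plin_eqI[of "\<lambda>x. map_concat (emb x)"])
    (simp | intro plin_comp[OF plin_map_concat] plin_comp[OF plin_emb] plin_emb plin_iter_prod)+

lemma map_concat_diag_op:
  "map_concat (diag_op (lift C) n ((*) (emb y)) t) = diag_op C n ((*) y) (map_concat t)"
proof (rule plin_eqI[of "\<lambda>t. map_concat (diag_op (lift C) n ((*) (emb y)) t)"])
  fix wss :: "'a list list list"
  show "map_concat (diag_op (lift C) n ((*) (emb y)) (bas wss)) = diag_op C n ((*) y) (map_concat (bas wss))"
    by (induction wss)
      (simp_all add: diag_op_bas plin_0[OF plin_map_concat] plin_add[OF plin_map_concat]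
        plin_psc[OF plin_map_concat] map_concat_mult map_concat_emb wdeg_concat)
qed (intro plin_comp[OF plin_map_concat] plin_comp[OF plin_diag_op] plin_diag_op plin_map_concat)+

lemma diag_op_lin_fun:
  assumes "\<And>x. D x = lin (\<lambda>i. E i x) y"
  shows "diag_op C n D t = lin (\<lambda>i. diag_op C n (E i) t) y"
proof (rule plin_eqI[of "diag_op C n D"])
  fix ws
  show "diag_op C n D (bas ws) = lin (\<lambda>i. diag_op C n (E i) (bas ws)) y"
  proof (induction ws)
    case (Cons w ws)
    have "emb (D (bas w)) * bas ws = lin (\<lambda>i. emb (E i (bas w)) * bas ws) y"
      unfolding assms
      by (rule plin_lin_image[of "\<lambda>x. emb x * bas ws"]) (intro plin_intros plin_emb)
    moreover have "psc (ksign n (wdeg C w)) (bas [w] * lin (\<lambda>i. diag_op_words C n (E i) ws) y) =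
        lin (\<lambda>i. psc (ksign n (wdeg C w)) (bas [w] * diag_op_words C n (E i) ws)) y"
      by (rule plin_lin_image[of "\<lambda>x. psc (ksign n (wdeg C w)) (bas [w] * x)"]) (intro plin_intros)
    ultimately show ?case using Cons by (simp add: diag_op_bas lin_plus_fun)
  qed (simp add: diag_op_bas)
qed (intro plin_intros plin_diag_op)+

text \<open>Any homogeneous \<open>y\<close>, Lie or not, is primitive here: over the new alphabet
  it is a combination of letters of one degree.\<close>

lemma iter_coprod_lift_mult:
  assumes "hom C n y"
  shows "iter_coprod (lift C) p (emb y * t) = diag_op (lift C) n ((*) (emb y)) (iter_coprod (lift C) p t)"
proof -
  have "iter_coprod (lift C) p (emb y * t) = lin (\<lambda>w. iter_coprod (lift C) p (bas [w] * t)) y"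
    by (rule plin_eqI[of "\<lambda>y. iter_coprod (lift C) p (emb y * t)"])
      (simp | intro plin_intros plin_comp[OF plin_iter_coprod] plin_emb)+
  also have "\<dots> = lin (\<lambda>w. diag_op (lift C) n ((*) (bas [w])) (iter_coprod (lift C) p t)) y"
    using assms by (intro lin_cong) (auto simp: iter_coprod_letter_mult hom_def)
  also have "\<dots> = diag_op (lift C) n ((*) (emb y)) (iter_coprod (lift C) p t)"
  proof (rule diag_op_lin_fun[symmetric])
    show "emb y * x = lin (\<lambda>w. bas [w] * x) y" for x
      by (rule plin_eqI[of "\<lambda>y. emb y * x"]) (simp | intro plin_intros plin_emb)+
  qed
  finally show ?thesis .
qed

text \<open>Both sides obey the same recursion when a factor is added in front. On the right every
  factor is primitive by construction of \<open>lift C\<close>; on the left this holds because the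
  factors are Lie monomials.\<close>

lemma iter_coprod_iter_prod:
  assumes "t \<in> lie_power C d"
  shows "iter_coprod C p (iter_prod t) = map_concat (iter_coprod (lift C) p t)"
proof -
  have *: "iter_coprod C p (iter_prod (tens xs)) = map_concat (iter_coprod (lift C) p (tens xs))"
    if "lie_monos C xs" for xs
    using that
  proof (induction xs)
    case Nil
    then show ?case by (simp add: iter_coprod_bas iter_coprod_word_Nil)
  next
    case (Cons x xs)
    then obtain n where x: "lie_mono C n x" by auto
    then show ?case using Cons
      by (simp add: iter_coprod_lie_mult[OF x] iter_coprod_lift_mult[OF lie_mono_hom[OF x]] map_concat_diag_op)
  qed
  have "t \<in> {t. iter_coprod C p (iter_prod t) = map_concat (iter_coprod (lift C) p t)}"
    by (rule lie_power_induct[OF assms subspace_ker])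
      (use * in \<open>auto intro!: plin_comp[OF plin_iter_coprod] plin_comp[OF plin_map_concat]
        plin_iter_prod plin_iter_coprod\<close>)
  then show ?thesis by simp
qed

lemma concat_map_concat: "concat (map concat wss) = concat (concat wss)"
  by (induction wss) auto

lemma psi_iter_prod:
  assumes "t \<in> lie_power C d"
  shows "psi C p (iter_prod t) = iter_prod (psi (lift C) p t)"
proof -
  have "iter_prod (map_concat s) = iter_prod (iter_prod s)" for s :: "'a list list list \<Rightarrow>\<^sub>0 'b"
    by (rule plin_eqI[of "\<lambda>s. iter_prod (map_concat s)"])
      (simp add: concat_map_concat | intro plin_comp[OF plin_iter_prod] plin_map_concat plin_iter_prod)+
  then show ?thesis
    by (simp add: psi_def iter_coprod_iter_prod[OF assms])
qed

section \<open>Adams operations on symmetric tensors\<close>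

text \<open>The signed transposition of positions \<open>i\<close> and \<open>i + 1\<close>. It is
  the identity when the word is too short, so invariance can be required for all \<open>i\<close> at
  once.\<close>

fun swap_at :: "('b, 'k::field) dgcoalg \<Rightarrow> nat \<Rightarrow> 'b list \<Rightarrow> 'b list \<Rightarrow>\<^sub>0 'k"
  where
    "swap_at C 0 (a # b # w) = psc (ksign (wdeg C [a]) (wdeg C [b])) (bas (b # a # w))"
  | "swap_at C (Suc i) (a # w) = bas [a] * swap_at C i w"
  | "swap_at C i w = bas w"

lemma swap_at_Nil [simp]: "swap_at C i [] = bas []"
  by (cases i) auto

definition symmetric_tensor :: "('b, 'k::field) dgcoalg \<Rightarrow> ('b list \<Rightarrow>\<^sub>0 'k) \<Rightarrow> bool"
  where "symmetric_tensor C t \<longleftrightarrow> (\<forall>i. lin (swap_at C i) t = t)"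

lemma bas_Nil_mult: "bas [] * x = (x :: _ list \<Rightarrow>\<^sub>0 'k::field)"
  by (simp flip: one_eq_bas)

text \<open>\<open>from_pos k X\<close> is \<open>1\<^bsup>\<otimes>k\<^esup> \<otimes> X\<close>.\<close>

definition from_pos :: "nat \<Rightarrow> ('b list \<Rightarrow> 'b list \<Rightarrow>\<^sub>0 'k::field) \<Rightarrow> 'b list \<Rightarrow> 'b list \<Rightarrow>\<^sub>0 'k"
  where "from_pos k X w = bas (take k w) * X (drop k w)"

lemma from_pos_append [simp]: "length u = k \<Longrightarrow> from_pos (k + j) X (u @ v) = bas u * from_pos j X v"
  by (simp add: from_pos_def flip: mult.assoc)

lemma from_pos_append0 [simp]: "length u = k \<Longrightarrow> from_pos k X (u @ v) = bas u * X v"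
  by (simp add: from_pos_def)

lemma lin_from_pos_mult:
  "length u = k \<Longrightarrow> lin (from_pos (k + j) X) (bas u * y) = bas u * lin (from_pos j X) y"
  by (rule plin_eqI[of "\<lambda>y. lin (from_pos (k + j) X) (bas u * y)"])
    (simp | intro plin_intros)+

lemma swap_at_eq_from_pos: "swap_at C k w = from_pos k (swap_at C 0) w"
proof (induction k arbitrary: w)
  case (Suc k)
  then show ?case by (cases w) (simp_all add: from_pos_def flip: mult.assoc)
qed (simp add: from_pos_def flip: one_eq_bas)

fun move_first :: "('b, 'k::field) dgcoalg \<Rightarrow> nat \<Rightarrow> 'b list \<Rightarrow> 'b list \<Rightarrow>\<^sub>0 'k"
  where
    "move_first C (Suc j) (c # b # w) =
      psc (ksign (wdeg C [c]) (wdeg C [b])) (bas [b] * move_first C j (c # w))"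
  | "move_first C j w = bas w"

lemma move_first_append:
  "length u = j \<Longrightarrow> move_first C j (c # u @ v) = psc (ksign (wdeg C [c]) (wdeg C u)) (bas (u @ c # v))"
proof (induction u arbitrary: j)
  case (Cons b u)
  have "wdeg C (b # u) = wdeg C [b] + wdeg C u" by (simp add: wdeg_Cons)
  then show ?case using Cons by (auto simp: ksign_add_right)
qed simp

lemma move_first_Suc: "move_first C (Suc j) w = lin (from_pos 1 (move_first C j)) (swap_at C 0 w)"
proof (cases w)
  case (Cons c w')
  then show ?thesis by (cases w') (simp_all add: lin_psc from_pos_def)
qed (simp add: from_pos_def)

text \<open>Moving a letter past \<open>j\<close> others is a product of \<open>j\<close> adjacent
  transpositions, each of which fixes \<open>t\<close>. The position \<open>k\<close> varies because
  after one transposition the letter stands at \<open>k + 1\<close>.\<close>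

lemma symmetric_tensor_move_first:
  assumes "symmetric_tensor C t"
  shows "lin (from_pos k (move_first C j)) t = t"
proof (induction j arbitrary: k)
  case 0
  have "from_pos k (move_first C 0) = (bas :: _ \<Rightarrow> _ \<Rightarrow>\<^sub>0 'b)"
    by (simp add: from_pos_def fun_eq_iff)
  then show ?case by (simp only: lin_bas_id)
next
  case (Suc j)
  have "from_pos k (move_first C (Suc j)) w = lin (from_pos (k + 1) (move_first C j)) (swap_at C k w)" for w
  proof (cases "length w < k")
    case True
    then show ?thesis
      by (simp add: swap_at_eq_from_pos[of C k]) (simp add: from_pos_def)
  next
    case False
    then show ?thesis
      unfolding swap_at_eq_from_pos[of C k] move_first_Suc from_pos_def[of k]
      by (subst lin_from_pos_mult) simp_all
  qed
  then have "from_pos k (move_first C (Suc j)) = (\<lambda>w. lin (from_pos (k + 1) (move_first C j)) (swap_at C k w))"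
    by (simp add: fun_eq_iff)
  then show ?case
    using Suc.IH[of "k + 1"] assms by (simp add: symmetric_tensor_def flip: lin_lin)
qed

lemma coprod_word_length:
  "coprod_word C w \<in> supp {(u, v). length u + length v = length w}"
proof (induction w)
  case (Cons c w)
  show ?case
    unfolding coprod_word_Cons
    by (rule lin_in_subspace[OF subspace_supp])
      (use Cons in \<open>auto simp: supp_def[of "{(u, v). length u + length v = length w}"]
        intro!: pm.subspace_add pm.subspace_scale subspace_supp\<close>)
qed simp

text \<open>The part of \<open>m\<^sub>2 \<circ> \<Delta>\<close> that cuts after \<open>j\<close> letters.\<close>

definition cut_coprod :: "('b, 'k::field) dgcoalg \<Rightarrow> nat \<Rightarrow> 'b list \<Rightarrow> 'b list \<Rightarrow>\<^sub>0 'k"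
  where "cut_coprod C j w = lin (\<lambda>(u, v). if length u = j then bas (u @ v) else 0) (coprod_word C w)"

text \<open>The first letter goes to the left of the cut, leaving \<open>j - 1\<close> letters to
  choose, or to the right, crossing the \<open>j\<close> letters already chosen. This is a signed
  form of Pascal's rule.\<close>

lemma cut_coprod_Cons:
  "cut_coprod C j (c # w) = (if j = 0 then 0 else bas [c] * cut_coprod C (j - 1) w) +
     lin (move_first C j) (bas [c] * cut_coprod C j w)"
proof -
  have 1: "(if j = 0 then 0 else bas [c] * cut_coprod C (j - 1) w) =
      lin (\<lambda>(u, v). if Suc (length u) = j then bas (c # u @ v) else 0) (coprod_word C w)"
    unfolding cut_coprod_def plin_lin_image[OF plin_mult_left[OF plin_id]]
    by (cases j) (auto intro!: lin_cong simp: case_prod_unfold)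
  have 2: "lin (move_first C j) (bas [c] * cut_coprod C j w) =
      lin (\<lambda>(u, v). if length u = j then psc (ksign (wdeg C [c]) (wdeg C u)) (bas (u @ c # v)) else 0)
        (coprod_word C w)"
    unfolding cut_coprod_def plin_lin_image[OF plin_mult_left[OF plin_id]] lin_lin
    by (rule lin_cong) (auto simp: move_first_append)
  show ?thesis
    unfolding 1 2 unfolding lin_plus_fun[symmetric] unfolding cut_coprod_def coprod_word_Cons lin_lin
    by (rule lin_cong) (auto simp: lin_add lin_psc)
qed

text \<open>Each of the \<open>d choose j\<close> shuffles fixes a symmetric tensor. The induction
  does not shorten \<open>t\<close>, since single words of \<open>t\<close> are not symmetric;
  instead the untouched prefix of length \<open>k\<close> grows while \<open>t\<close> stays the
  same.\<close>

lemma symmetric_tensor_cut_coprod: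
  assumes "symmetric_tensor C t" "t \<in> supp {w. length w = k + d}"
  shows "lin (from_pos k (cut_coprod C j)) t = psc (of_nat (d choose j)) t"
  using assms(2)
proof (induction d arbitrary: j k)
  case 0
  have "lin (from_pos k (cut_coprod C j)) t = lin (\<lambda>w. psc (of_nat (0 choose j)) (bas w)) t"
  proof (rule lin_cong)
    fix w assume "w \<in> Poly_Mapping.keys t"
    then have "length w = k" using 0 by (auto simp: supp_def)
    then show "from_pos k (cut_coprod C j) w = psc (of_nat (0 choose j)) (bas w)"
      by (cases j) (simp_all add: from_pos_def cut_coprod_def)
  qed
  then show ?case by (simp add: lin_psc_fun)
next
  case (Suc d)
  have t: "t \<in> supp {w. length w = (k + 1) + d}" using Suc.prems by simp
  have "lin (from_pos k (cut_coprod C j)) t = lin (\<lambda>w.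
      (if j = 0 then 0 else from_pos (k + 1) (cut_coprod C (j - 1)) w) +
      lin (from_pos k (move_first C j)) (from_pos (k + 1) (cut_coprod C j) w)) t"
  proof (rule lin_cong)
    fix w assume "w \<in> Poly_Mapping.keys t"
    then have len: "length w = Suc (k + d)" using Suc.prems by (auto simp: supp_def)
    define u c v where "u = take k w" and "c = w ! k" and "v = drop (Suc k) w"
    have w: "w = u @ c # v"
      unfolding u_def c_def v_def by (rule id_take_nth_drop) (simp add: len)
    have u: "length u = k" using len by (simp add: u_def)
    have *: "lin (from_pos k X) (bas u * y) = bas u * lin X y" for X :: "'a list \<Rightarrow> 'a list \<Rightarrow>\<^sub>0 'b" and y
      by (rule plin_eqI[of "\<lambda>y. lin (from_pos k X) (bas u * y)"]) (simp add: u | intro plin_intros)+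
    have **: "from_pos (Suc k) X w = bas u * (bas [c] * X v)" for X :: "'a list \<Rightarrow> 'a list \<Rightarrow>\<^sub>0 'b"
      using u by (simp add: from_pos_def w)
    show "from_pos k (cut_coprod C j) w = (if j = 0 then 0 else from_pos (k + 1) (cut_coprod C (j - 1)) w) +
        lin (from_pos k (move_first C j)) (from_pos (k + 1) (cut_coprod C j) w)"
      unfolding add.commute[of k 1] plus_1_eq_Suc ** *
      by (simp add: w u cut_coprod_Cons distrib_left)
  qed
  also have "\<dots> = (if j = 0 then 0 else lin (from_pos (k + 1) (cut_coprod C (j - 1))) t) +
      lin (from_pos k (move_first C j)) (lin (from_pos (k + 1) (cut_coprod C j)) t)"
    by (simp add: lin_plus_fun lin_lin)
  also have "\<dots> = psc (of_nat (Suc d choose j)) t"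
    using symmetric_tensor_move_first[OF assms(1), of k j] unfolding Suc.IH[OF t]
    by (cases j) (simp_all add: lin_psc pm.scale_left_distrib)
  finally show ?case .
qed

text \<open>The terms of the coproduct are sorted by the length \<open>j\<close> of the first
  factor; the operation of index \<open>p\<close> takes care of the rest.\<close>

lemma psi_Suc_bas:
  "psi C (Suc p) (bas w) =
    (\<Sum>j\<le>length w. lin (from_pos j (\<lambda>w. psi C p (bas w))) (cut_coprod C j w))"
proof -
  have "psi C (Suc p) (bas w) = lin (\<lambda>(u, v). bas u * psi C p (bas v)) (coprod_word C w)"
    unfolding psi_def comp_def iter_coprod_bas iter_coprod_word.simps
      plin_lin_image[OF plin_iter_prod]
    by (rule lin_cong) auto
  also have "\<dots> = lin (\<lambda>(u, v). \<Sum>j\<le>length w. if length u = j then bas u * psi C p (bas v) else 0)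
      (coprod_word C w)"
    by (rule lin_cong) (use coprod_word_length[of C w] in \<open>auto simp: supp_def\<close>)
  also have "\<dots> = (\<Sum>j\<le>length w.
      lin (\<lambda>(u, v). if length u = j then bas u * psi C p (bas v) else 0) (coprod_word C w))"
    unfolding lin_def case_prod_unfold pm.scale_sum_right by (rule sum.swap)
  also have "\<dots> = (\<Sum>j\<le>length w. lin (from_pos j (\<lambda>w. psi C p (bas w))) (cut_coprod C j w))"
    unfolding cut_coprod_def lin_lin by (intro sum.cong refl lin_cong) auto
  finally show ?thesis .
qed

text \<open>Of the \<open>d\<close> letters, \<open>j\<close> go to the first place and the others
  are distributed over the remaining \<open>p\<close>, so the eigenvalue is the binomial expansion
  of \<open>(1 + p) ^ d\<close>.\<close>

lemma symmetric_tensor_psi_from_pos: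
  assumes "symmetric_tensor C t" "t \<in> supp {w. length w = k + d}"
  shows "lin (from_pos k (\<lambda>w. psi C p (bas w))) t = psc (of_nat p ^ d) t"
  using assms(2)
proof (induction p arbitrary: d k)
  case 0
  \<comment> \<open>Index 0 is the counit followed by the unit: it keeps the empty word only, in
    agreement with \<open>0 ^ 0 = 1\<close>.\<close>
  have "lin (from_pos k (\<lambda>w. psi C 0 (bas w))) t = lin (\<lambda>w. psc (0 ^ d) (bas w)) t"
    by (rule lin_cong)
      (use 0 in \<open>auto simp: supp_def from_pos_def psi_def iter_coprod_bas plin_0[OF plin_iter_prod]\<close>)
  then show ?case by (simp add: lin_psc_fun)
next
  case (Suc p)
  have "lin (from_pos k (\<lambda>w. psi C (Suc p) (bas w))) t = lin (\<lambda>w. \<Sum>j\<le>d.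
      lin (from_pos (k + j) (\<lambda>w. psi C p (bas w))) (from_pos k (cut_coprod C j) w)) t"
  proof (rule lin_cong)
    fix w assume "w \<in> Poly_Mapping.keys t"
    then have len: "length w = k + d" using Suc.prems by (auto simp: supp_def)
    then show "from_pos k (\<lambda>w. psi C (Suc p) (bas w)) w = (\<Sum>j\<le>d.
      lin (from_pos (k + j) (\<lambda>w. psi C p (bas w))) (from_pos k (cut_coprod C j) w))"
      by (simp add: from_pos_def[of k] psi_Suc_bas sum_distrib_left lin_from_pos_mult)
  qed
  also have "\<dots> = (\<Sum>j\<le>d.
      lin (from_pos (k + j) (\<lambda>w. psi C p (bas w))) (lin (from_pos k (cut_coprod C j)) t))"
    unfolding lin_def[of "\<lambda>w. \<Sum>j\<le>d. _ j w"] lin_lin pm.scale_sum_right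
    by (subst sum.swap) (simp add: lin_def)
  also have "\<dots> = (\<Sum>j\<le>d. psc (of_nat (d choose j) * of_nat p ^ (d - j)) t)"
  proof (rule sum.cong[OF refl])
    fix j assume "j \<in> {..d}"
    then have "t \<in> supp {w. length w = (k + j) + (d - j)}" using Suc.prems by simp
    then show "lin (from_pos (k + j) (\<lambda>w. psi C p (bas w))) (lin (from_pos k (cut_coprod C j)) t) =
        psc (of_nat (d choose j) * of_nat p ^ (d - j)) t"
      by (simp add: symmetric_tensor_cut_coprod[OF assms(1) Suc.prems] lin_psc Suc.IH)
  qed
  also have "\<dots> = psc ((1 + of_nat p) ^ d) t"
    by (simp add: binomial_ring pm.scale_sum_left)
  finally show ?case by simp
qed

lemma plin_psi: "plin (psi C p)"
  unfolding psi_def comp_def by (rule plin_comp[OF plin_iter_prod plin_iter_coprod])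

lemma symmetric_tensor_psi:
  assumes "symmetric_tensor C t" "t \<in> supp {w. length w = d}"
  shows "psi C p t = psc (of_nat p ^ d) t"
proof -
  have "psi C p t = lin (from_pos 0 (\<lambda>w. psi C p (bas w))) t"
    by (subst plin_eq_lin[OF plin_psi]) (simp add: from_pos_def[abs_def] bas_Nil_mult)
  then show ?thesis using symmetric_tensor_psi_from_pos[of C t 0 d p] assms by simp
qed

lemma symmetric_tensor_lift_psi:
  assumes "t \<in> lie_power C d" "symmetric_tensor (lift C) t"
  shows "psi C p (iter_prod t) = psc (of_nat p ^ d) (iter_prod t)"
  unfolding psi_iter_prod[OF assms(1)] symmetric_tensor_psi[OF assms(2) lie_power_length[OF assms(1)]]
  by (rule plin_psc[OF plin_iter_prod])

section \<open>Symmetrization\<close>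

text \<open>The graded shuffle product of the one-letter word \<open>a\<close> with a word.\<close>

fun insert_word :: "('b, 'k::field) dgcoalg \<Rightarrow> 'b list \<Rightarrow> 'b list list \<Rightarrow> 'b list list \<Rightarrow>\<^sub>0 'k"
  where
    "insert_word C a [] = bas [a]"
  | "insert_word C a (v # vs) =
      bas (a # v # vs) + psc (ksign (wdeg C a) (wdeg C v)) (bas [v] * insert_word C a vs)"

definition insert_factor :: "('b, 'k::field) dgcoalg \<Rightarrow> ('b list \<Rightarrow>\<^sub>0 'k) \<Rightarrow> ('b list list \<Rightarrow>\<^sub>0 'k) \<Rightarrow>
    'b list list \<Rightarrow>\<^sub>0 'k"
  where "insert_factor C x t = lin (\<lambda>a. lin (insert_word C a) t) x"

text \<open>The sum of all signed permutations of a word of tensor factors, without the factor \<open>1/d!\<close>.\<close>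

fun perm_sum_words :: "('b, 'k::field) dgcoalg \<Rightarrow> 'b list list \<Rightarrow> 'b list list \<Rightarrow>\<^sub>0 'k"
  where
    "perm_sum_words C [] = bas []"
  | "perm_sum_words C (w # ws) = lin (insert_word C w) (perm_sum_words C ws)"

definition perm_sum :: "('b, 'k::field) dgcoalg \<Rightarrow> ('b list list \<Rightarrow>\<^sub>0 'k) \<Rightarrow> 'b list list \<Rightarrow>\<^sub>0 'k"
  where "perm_sum C = lin (perm_sum_words C)"

lemma plin_insert_factor_left: "plin (\<lambda>x. insert_factor C x t)"
  unfolding insert_factor_def by (rule plin_lin)

lemma plin_insert_factor_right: "plin (\<lambda>t. insert_factor C x t)"
  unfolding insert_factor_def by (intro plin_intros)

lemma plin_perm_sum: "plin (perm_sum C)"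
  by (simp add: perm_sum_def plin_lin)

lemma mult_bas_Nil: "x * bas [] = (x :: _ list \<Rightarrow>\<^sub>0 'k::field)"
  by (simp flip: one_eq_bas)

lemma insert_factor_bas: "insert_factor C (bas a) t = lin (insert_word C a) t"
  by (simp add: insert_factor_def)

lemma insert_factor_Nil: "insert_factor C x (bas []) = emb x"
  by (rule plin_eqI[of "\<lambda>x. insert_factor C x (bas [])"]) (simp add: insert_factor_bas | intro plin_insert_factor_left plin_emb)+

lemma perm_sum_bas: "perm_sum C (bas ws) = perm_sum_words C ws"
  by (simp add: perm_sum_def)

lemma insert_factor_bas_bas_mult:
  "insert_factor C (bas a) (bas [v] * t) =
    bas [a, v] * t + psc (ksign (wdeg C a) (wdeg C v)) (bas [v] * insert_factor C (bas a) t)"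
  by (rule plin_eqI[of "\<lambda>t. insert_factor C (bas a) (bas [v] * t)"])
    (simp add: insert_factor_bas | intro plin_intros plin_comp[OF plin_insert_factor_right] plin_insert_factor_right)+

lemma insert_factor_emb_mult:
  assumes "hom C m x" "hom C n y"
  shows "insert_factor C x (emb y * t) = emb x * (emb y * t) + psc (ksign m n) (emb y * insert_factor C x t)"
proof (rule plin_eqI[of "\<lambda>x. insert_factor C x (emb y * t)"])
  fix a assume "a \<in> Poly_Mapping.keys x"
  then have a: "wdeg C a = m" using assms by (auto simp: hom_def)
  show "insert_factor C (bas a) (emb y * t) =
      emb (bas a) * (emb y * t) + psc (ksign m n) (emb y * insert_factor C (bas a) t)"
  proof (rule plin_eqI[of "\<lambda>y. insert_factor C (bas a) (emb y * t)"])
    fix v assume "v \<in> Poly_Mapping.keys y"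
    then have "wdeg C v = n" using assms by (auto simp: hom_def)
    then show "insert_factor C (bas a) (emb (bas v) * t) =
        emb (bas a) * (emb (bas v) * t) + psc (ksign m n) (emb (bas v) * insert_factor C (bas a) t)"
      using a by (simp add: insert_factor_bas_bas_mult)
  qed (intro plin_intros plin_emb plin_comp[OF plin_insert_factor_right])+
qed (intro plin_intros plin_emb plin_insert_factor_left)+

lemma perm_sum_emb_mult: "perm_sum C (emb x * t) = insert_factor C x (perm_sum C t)"
proof (rule plin_eqI[of "\<lambda>x. perm_sum C (emb x * t)"])
  fix a
  show "perm_sum C (emb (bas a) * t) = insert_factor C (bas a) (perm_sum C t)"
    by (rule plin_eqI[of "\<lambda>t. perm_sum C (emb (bas a) * t)"])
      (simp add: insert_factor_bas perm_sum_bas | intro plin_intros plin_comp[OF plin_perm_sum] plin_comp[OF plin_insert_factor_right] plin_perm_sum)+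
qed (intro plin_intros plin_emb plin_comp[OF plin_perm_sum] plin_insert_factor_left)+

text \<open>Graded commutativity of the shuffle product, for factors of length one. It stands in for
  any discussion of permutations when \<open>perm_sum\<close> is shown to kill the symmetry
  relations.\<close>

lemma insert_factor_commute:
  assumes "hom C m x" "hom C n y"
  shows "insert_factor C x (insert_factor C y t) = psc (ksign m n) (insert_factor C y (insert_factor C x t))"
proof (rule plin_eqI[of "\<lambda>x. insert_factor C x (insert_factor C y t)"])
  fix a assume "a \<in> Poly_Mapping.keys x"
  then have a: "wdeg C a = m" using assms by (auto simp: hom_def)
  show "insert_factor C (bas a) (insert_factor C y t) = psc (ksign m n) (insert_factor C y (insert_factor C (bas a) t))"
  proof (rule plin_eqI[of "\<lambda>y. insert_factor C (bas a) (insert_factor C y t)"])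
    fix b assume "b \<in> Poly_Mapping.keys y"
    then have b: "wdeg C b = n" using assms by (auto simp: hom_def)
    show "insert_factor C (bas a) (insert_factor C (bas b) t) = psc (ksign m n) (insert_factor C (bas b) (insert_factor C (bas a) t))"
    proof (rule plin_eqI[of "\<lambda>t. insert_factor C (bas a) (insert_factor C (bas b) t)"])
      fix vs
      show "insert_factor C (bas a) (insert_factor C (bas b) (bas vs)) =
          psc (ksign m n) (insert_factor C (bas b) (insert_factor C (bas a) (bas vs)))"
      proof (induction vs)
        case Nil
        then show ?case using a b
          by (simp add: insert_factor_bas pm.scale_right_distrib ksign_commute[of n m] add.commute)
      next
        case (Cons v vs)
        have s: "bas (v # vs) = (bas [v] * bas vs :: _ \<Rightarrow>\<^sub>0 'b)" "bas [a, v] = (bas [a] * bas [v] :: _ \<Rightarrow>\<^sub>0 'b)"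
          "bas [b, v] = (bas [b] * bas [v] :: _ \<Rightarrow>\<^sub>0 'b)"
          "bas [a, b] = (bas [a] * bas [b] :: _ \<Rightarrow>\<^sub>0 'b)" "bas [b, a] = (bas [b] * bas [a] :: _ \<Rightarrow>\<^sub>0 'b)"
          by simp_all
        show ?case
          unfolding s insert_factor_bas_bas_mult plin_add[OF plin_insert_factor_right] plin_psc[OF plin_insert_factor_right] mult.assoc
          using a b
          by (simp add: pm.scale_right_distrib Cons.IH ksign_commute[of n m] distrib_left
              mult.left_commute mult.commute add_ac del: bas_mult bas_mult_assoc)
      qed
    qed (intro plin_intros plin_comp[OF plin_insert_factor_right] plin_insert_factor_right)+
  qed (intro plin_intros plin_comp[OF plin_insert_factor_right] plin_insert_factor_left)+
qed (intro plin_intros plin_comp[OF plin_insert_factor_right] plin_insert_factor_left)+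

text \<open>\<open>diag_op\<close> is a derivation of the shuffle product: the operator hits the
  inserted factor or, after crossing it, one of the others.\<close>

lemma diag_op_insert_factor:
  assumes D: "degree_op C m D" and x: "hom C n x"
  shows "diag_op C m D (insert_factor C x t) = insert_factor C (D x) t + psc (ksign m n) (insert_factor C x (diag_op C m D t))"
proof (rule plin_eqI[of "\<lambda>x. diag_op C m D (insert_factor C x t)"])
  note pD = degree_op_plin[OF D]
  show "plin (\<lambda>x. diag_op C m D (insert_factor C x t))"
    "plin (\<lambda>x. insert_factor C (D x) t + psc (ksign m n) (insert_factor C x (diag_op C m D t)))"
    by (intro plin_intros plin_comp[OF plin_diag_op] plin_comp[OF plin_insert_factor_left pD] plin_insert_factor_left)+
  fix a assume "a \<in> Poly_Mapping.keys x"
  then have a: "wdeg C a = n" using x by (auto simp: hom_def)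
  show "diag_op C m D (insert_factor C (bas a) t) = insert_factor C (D (bas a)) t + psc (ksign m n) (insert_factor C (bas a) (diag_op C m D t))"
  proof (rule plin_eqI[of "\<lambda>t. diag_op C m D (insert_factor C (bas a) t)"])
    fix vs
    show "diag_op C m D (insert_factor C (bas a) (bas vs)) =
        insert_factor C (D (bas a)) (bas vs) + psc (ksign m n) (insert_factor C (bas a) (diag_op C m D (bas vs)))"
    proof (induction vs)
      case Nil
      show ?case
        by (simp add: diag_op_bas mult_bas_Nil plin_0[OF plin_insert_factor_right] insert_factor_bas insert_factor_Nil)
    next
      case (Cons v vs)
      have hv: "hom C (m + wdeg C v) (D (bas v))" and ha: "hom C (m + n) (D (bas a))" and hv0: "hom C (wdeg C v) (bas v)"
        and ha0: "hom C n (bas a)"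
        using D a by (auto simp: degree_op_def)
      have s: "bas (v # vs) = (bas [v] * bas vs :: _ \<Rightarrow>\<^sub>0 'b)" "bas [a, v] = (bas [a] * bas [v] :: _ \<Rightarrow>\<^sub>0 'b)"
        by simp_all
      define X where "X = insert_factor C (bas a) (bas vs)"
      define Y where "Y = insert_factor C (D (bas a)) (bas vs)"
      define Z where "Z = insert_factor C (bas a) (diag_op C m D (bas vs))"
      have IH: "diag_op C m D X = Y + psc (ksign m n) Z"
        using Cons.IH by (simp add: X_def Y_def Z_def)
      have 1: "diag_op C m D (insert_factor C (bas a) (bas (v # vs))) = emb (D (bas a)) * (bas [v] * bas vs) +
          psc (ksign m n) (bas [a] * (emb (D (bas v)) * bas vs + psc (ksign m (wdeg C v)) (bas [v] * diag_op C m D (bas vs)))) +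
          psc (ksign n (wdeg C v)) (emb (D (bas v)) * X + psc (ksign m (wdeg C v)) (bas [v] * (Y + psc (ksign m n) Z)))"
        unfolding s insert_factor_bas_bas_mult plin_add[OF plin_diag_op] plin_psc[OF plin_diag_op] mult.assoc diag_op_bas_mult a
        by (simp only: IH flip: X_def)
      have 2: "insert_factor C (D (bas a)) (bas (v # vs)) = emb (D (bas a)) * (bas [v] * bas vs) +
          psc (ksign (m + n) (wdeg C v)) (bas [v] * Y)"
        using insert_factor_emb_mult[OF ha hv0, of "bas vs"] by (simp add: Y_def)
      have 3: "insert_factor C (bas a) (diag_op C m D (bas (v # vs))) =
          bas [a] * (emb (D (bas v)) * bas vs) + psc (ksign n (m + wdeg C v)) (emb (D (bas v)) * X) +
          psc (ksign m (wdeg C v)) (bas [a] * (bas [v] * diag_op C m D (bas vs)) + psc (ksign n (wdeg C v)) (bas [v] * Z))"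
        unfolding s diag_op_bas_mult plin_add[OF plin_insert_factor_right] plin_psc[OF plin_insert_factor_right] insert_factor_bas_bas_mult
          insert_factor_emb_mult[OF ha0 hv] emb_bas mult.assoc a by (simp only: flip: X_def Z_def)
      show ?case
        unfolding 1 2 3
        by (simp add: pm.scale_right_distrib distrib_left ksign_add_left ksign_add_right
            ksign_commute[of n m] mult.left_commute mult.commute add_ac del: bas_mult bas_mult_assoc)
    qed
  qed (intro plin_intros plin_comp[OF plin_diag_op] plin_comp[OF plin_insert_factor_right] plin_insert_factor_right plin_diag_op)+
qed

lemma diag_op_perm_sum:
  assumes "degree_op C m D"
  shows "diag_op C m D (perm_sum C t) = perm_sum C (diag_op C m D t)"
proof (rule plin_eqI[of "\<lambda>t. diag_op C m D (perm_sum C t)"])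
  fix ws
  show "diag_op C m D (perm_sum C (bas ws)) = perm_sum C (diag_op C m D (bas ws))"
  proof (induction ws)
    case Nil
    then show ?case by (simp add: perm_sum_bas diag_op_bas plin_0[OF plin_perm_sum])
  next
    case (Cons w ws)
    have s: "bas (w # ws) = (emb (bas w) * bas ws :: _ \<Rightarrow>\<^sub>0 'b)" by simp
    have w: "hom C (wdeg C w) (bas w)" by simp
    show ?case
      unfolding s perm_sum_emb_mult diag_op_insert_factor[OF assms w] diag_op_emb_mult[OF degree_op_plin[OF assms] w]
        plin_add[OF plin_perm_sum] plin_psc[OF plin_perm_sum] Cons.IH ..
  qed
qed (intro plin_comp[OF plin_diag_op] plin_comp[OF plin_perm_sum] plin_diag_op plin_perm_sum)+

section \<open>Signed permutations and symmetry relations on tensor powers of the Lie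
  algebra\<close>

lemma insert_factor_tens_in_lie_power:
  assumes "lie_mono C n x" "lie_monos C ys"
  shows "insert_factor C x (tens ys) \<in> lie_power C (Suc (length ys))"
  using assms(2)
proof (induction ys)
  case Nil
  show ?case
    using tens_in_lie_power[of "[x]" C] lie_mono_cobar_lie[OF assms(1)]
    by (simp add: insert_factor_Nil mult_bas_Nil)
next
  case (Cons y ys)
  then obtain k where y: "lie_mono C k y" by auto
  have "emb x * tens (y # ys) \<in> lie_power C (Suc (Suc (length ys)))"
    using tens_in_lie_power[of "x # y # ys" C] lie_monos_cobar_lie[of "x # y # ys"] Cons.prems assms(1)
    by auto
  moreover have "emb y * insert_factor C x (tens ys) \<in> lie_power C (Suc (Suc (length ys)))"
    by (rule emb_mult_lie_power[OF lie_mono_cobar_lie[OF y]]) (use Cons in auto)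
  ultimately show ?case
    by (simp add: insert_factor_emb_mult[OF lie_mono_hom[OF assms(1)] lie_mono_hom[OF y]]
        pm.subspace_add pm.subspace_scale subspace_lie_power)
qed

lemma insert_factor_in_lie_power:
  assumes "lie_mono C n x" "t \<in> lie_power C d"
  shows "insert_factor C x t \<in> lie_power C (Suc d)"
proof -
  have "t \<in> {t. insert_factor C x t \<in> lie_power C (Suc d)}"
    by (rule lie_power_induct[OF assms(2) subspace_vimage[OF plin_insert_factor_right subspace_lie_power]])
      (use insert_factor_tens_in_lie_power[OF assms(1)] in auto)
  then show ?thesis by simp
qed

lemma perm_sum_in_lie_power:
  assumes "t \<in> lie_power C d"
  shows "perm_sum C t \<in> lie_power C d"
proof -
  have *: "perm_sum C (tens xs) \<in> lie_power C (length xs)" if "lie_monos C xs" for xs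
    using that
    by (induction xs)
      (auto simp: perm_sum_emb_mult perm_sum_bas intro: insert_factor_in_lie_power tens_in_lie_power[of "[]", simplified])
  have "t \<in> {t. perm_sum C t \<in> lie_power C d}"
    by (rule lie_power_induct[OF assms subspace_vimage[OF plin_perm_sum subspace_lie_power]])
      (use * in auto)
  then show ?thesis by simp
qed

text \<open>The factors in front of \<open>x\<close> and \<open>y\<close> are inserted last, by
  linear maps, so the two terms of a relation cancel as soon as the insertions of \<open>x\<close>
  and \<open>y\<close> commute up to the Koszul sign.\<close>

lemma perm_sum_sym_relations:
  assumes "t \<in> pm.span (sym_relations C d)"
  shows "perm_sum C t = 0"
proof -
  have *: "perm_sum C (tens (xs @ ys)) = fold (\<lambda>x. insert_factor C x) (rev xs) (perm_sum C (tens ys))" for xs ys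
    by (induction xs) (simp_all add: perm_sum_emb_mult)
  have 0: "fold (\<lambda>x. insert_factor C x) xs (psc c t) = psc c (fold (\<lambda>x. insert_factor C x) xs t)" for xs t and c :: 'b
    by (induction xs arbitrary: t) (simp_all add: plin_psc[OF plin_insert_factor_right])
  have "t \<in> {t. perm_sum C t = 0}"
  proof (rule span_induct_mem[OF assms subspace_ker[OF plin_perm_sum plin_zero]])
    fix r assume "r \<in> sym_relations C d"
    then obtain xs x y ys m n where
      r: "r = tens (xs @ [x, y] @ ys) - psc (ksign m n) (tens (xs @ [y, x] @ ys))"
      and xy: "x \<in> cobar_lie_grd C m" "y \<in> cobar_lie_grd C n"
      by (auto simp: sym_relations_def ksign_def)
    have h: "hom C m x" "hom C n y" using xy by (auto simp: cobar_lie_grd_iff)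
    show "r \<in> {t. perm_sum C t = 0}"
      unfolding r mem_Collect_eq plin_diff[OF plin_perm_sum] plin_psc[OF plin_perm_sum] *
      by (simp add: perm_sum_emb_mult insert_factor_commute[OF h] 0)
  qed
  then show ?thesis by simp
qed

lemma emb_mult_sym_relations:
  assumes "z \<in> cobar_lie C" "r \<in> pm.span (sym_relations C d)"
  shows "emb z * r \<in> pm.span (sym_relations C (Suc d))"
proof -
  have "r \<in> {r. emb z * r \<in> pm.span (sym_relations C (Suc d))}"
  proof (rule span_induct_mem[OF assms(2)])
    show "pm.subspace {r. emb z * r \<in> pm.span (sym_relations C (Suc d))}"
      by (intro subspace_vimage plin_intros pm.subspace_span)
    fix r assume "r \<in> sym_relations C d"
    then obtain xs x y ys m n where
      r: "r = tens (xs @ [x, y] @ ys) - psc ((-1) powi (m * n)) (tens (xs @ [y, x] @ ys))"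
      and *: "length (xs @ [x, y] @ ys) = d" "set xs \<subseteq> cobar_lie C" "set ys \<subseteq> cobar_lie C"
      "x \<in> cobar_lie_grd C m" "y \<in> cobar_lie_grd C n"
      by (auto simp: sym_relations_def)
    have "emb z * r = tens ((z # xs) @ [x, y] @ ys) - psc ((-1) powi (m * n)) (tens ((z # xs) @ [y, x] @ ys))"
      by (simp add: r right_diff_distrib)
    then have "emb z * r \<in> sym_relations C (Suc d)"
      unfolding sym_relations_def using * assms(1) by fastforce
    then show "r \<in> {r. emb z * r \<in> pm.span (sym_relations C (Suc d))}"
      by (auto intro: pm.span_base)
  qed
  then show ?thesis by simp
qed

text \<open>Modulo the symmetry relations, each of the \<open>length ys + 1\<close> insertions of
  \<open>x\<close> can be moved to the front; the sign of the move cancels the sign of the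
  insertion.\<close>

lemma insert_factor_tens_sym_relations:
  assumes x: "lie_mono C n x" and "lie_monos C ys"
  shows "insert_factor C x (tens ys) - psc (of_nat (Suc (length ys))) (emb x * tens ys)
    \<in> pm.span (sym_relations C (Suc (length ys)))"
  using assms(2)
proof (induction ys)
  case Nil
  show ?case
    by (simp add: insert_factor_Nil mult_bas_Nil pm.span_zero)
next
  case (Cons y ys)
  then obtain k where y: "lie_mono C k y" by auto
  let ?N = "of_nat (Suc (length ys)) :: 'b"
  let ?R = "pm.span (sym_relations C (Suc (Suc (length ys))))"
  have 1: "emb y * (insert_factor C x (tens ys) - psc ?N (emb x * tens ys)) \<in> ?R"
    by (rule emb_mult_sym_relations[OF lie_mono_cobar_lie[OF y]]) (use Cons in auto)
  have "tens ([] @ [x, y] @ ys) - psc ((-1) powi (n * k)) (tens ([] @ [y, x] @ ys))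
      \<in> sym_relations C (Suc (Suc (length ys)))"
    unfolding sym_relations_def
    using lie_mono_grd[OF x] lie_mono_grd[OF y] lie_monos_cobar_lie[of ys C] Cons.prems
    by (intro CollectI exI conjI) (rule refl, auto)
  then have "tens ([] @ [x, y] @ ys) - psc (ksign n k) (tens ([] @ [y, x] @ ys)) \<in> ?R"
    unfolding ksign_def by (rule pm.span_base)
  then have 2: "emb x * (emb y * tens ys) - psc (ksign n k) (emb y * (emb x * tens ys)) \<in> ?R"
    by simp
  define A B I N where "A = emb x * (emb y * tens ys)" and "B = emb y * (emb x * tens ys)"
    and "I = emb y * insert_factor C x (tens ys)" and "N = ?N"
  have "insert_factor C x (tens (y # ys)) - psc (of_nat (Suc (length (y # ys)))) (emb x * tens (y # ys)) =
      A + psc (ksign n k) I - psc (1 + N) A"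
    by (simp add: insert_factor_emb_mult[OF lie_mono_hom[OF x] lie_mono_hom[OF y]] A_def I_def N_def)
  \<comment> \<open>\<open>B\<close>, with \<open>y\<close> in front of \<open>x\<close>, is added
    and subtracted: the induction hypothesis compares \<open>I\<close> with \<open>N\<close> copies
    of \<open>B\<close>, and one transposition compares \<open>B\<close> with
    \<open>A\<close>.\<close>
  also have "\<dots> = psc (ksign n k) (I - psc N B) - psc N (A - psc (ksign n k) B)"
    by (simp add: pm.scale_right_diff_distrib pm.scale_left_distrib mult.commute)
  also have "\<dots> = psc (ksign n k) (emb y * (insert_factor C x (tens ys) - psc ?N (emb x * tens ys)))
      - psc ?N (emb x * (emb y * tens ys) - psc (ksign n k) (emb y * (emb x * tens ys)))"
    by (simp only: right_diff_distrib psc_mult_right A_def B_def I_def N_def)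
  also have "\<dots> \<in> ?R"
    by (intro pm.span_diff pm.span_scale 1 2)
  finally show ?case by simp
qed

lemma insert_factor_sym_relations:
  assumes x: "lie_mono C n x" and t: "t \<in> lie_power C d"
  shows "insert_factor C x t - psc (of_nat (Suc d)) (emb x * t) \<in> pm.span (sym_relations C (Suc d))"
proof -
  have "t \<in> {t. insert_factor C x t - psc (of_nat (Suc d)) (emb x * t) \<in> pm.span (sym_relations C (Suc d))}"
    by (rule lie_power_induct[OF t], intro subspace_vimage plin_intros plin_insert_factor_right pm.subspace_span)
      (use insert_factor_tens_sym_relations[OF x] in auto)
  then show ?thesis by simp
qed

lemma perm_sum_tens_sym_relations:
  assumes "lie_monos C xs"
  shows "perm_sum C (tens xs) - psc (fact (length xs)) (tens xs) \<in> pm.span (sym_relations C (length xs))"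
  using assms
proof (induction xs)
  case Nil
  then show ?case by (simp add: perm_sum_bas pm.span_zero)
next
  case (Cons x xs)
  then obtain n where x: "lie_mono C n x" by auto
  let ?t = "tens xs" and ?N = "of_nat (Suc (length xs)) :: 'b" and ?F = "fact (length xs) :: 'b"
  have "perm_sum C ?t \<in> lie_power C (length xs)"
    using Cons.prems lie_monos_cobar_lie[of xs C] by (intro perm_sum_in_lie_power tens_in_lie_power) auto
  then have 1: "insert_factor C x (perm_sum C ?t) - psc ?N (emb x * perm_sum C ?t) \<in> pm.span (sym_relations C (Suc (length xs)))"
    by (rule insert_factor_sym_relations[OF x])
  have 2: "emb x * (perm_sum C ?t - psc ?F ?t) \<in> pm.span (sym_relations C (Suc (length xs)))"
    by (rule emb_mult_sym_relations[OF lie_mono_cobar_lie[OF x]]) (use Cons in auto)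
  have "perm_sum C (tens (x # xs)) - psc (fact (length (x # xs))) (tens (x # xs)) =
      (insert_factor C x (perm_sum C ?t) - psc ?N (emb x * perm_sum C ?t)) + psc ?N (emb x * (perm_sum C ?t - psc ?F ?t))"
    by (simp only: tens_Cons perm_sum_emb_mult length_Cons fact_Suc right_diff_distrib psc_mult_right
        pm.scale_right_diff_distrib pm.scale_scale) simp
  then show ?case
    using pm.span_add[OF 1 pm.span_scale[OF 2, of ?N]] by simp
qed

text \<open>In the symmetric power all \<open>d!\<close> signed permutations of a tensor
  coincide.\<close>

lemma perm_sum_minus_fact:
  assumes "t \<in> lie_power C d"
  shows "perm_sum C t - psc (fact d) t \<in> pm.span (sym_relations C d)"
proof -
  have "t \<in> {t. perm_sum C t - psc (fact d) t \<in> pm.span (sym_relations C d)}"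
    by (rule lie_power_induct[OF assms], intro subspace_vimage plin_intros plin_perm_sum pm.subspace_span)
      (use perm_sum_tens_sym_relations in auto)
  then show ?thesis by simp
qed

text \<open>Modulo products of fewer factors, Lie elements commute.\<close>

lemma iter_prod_sym_relations:
  assumes "r \<in> pm.span (sym_relations C (Suc d))"
  shows "\<exists>t\<in>lie_power C d. iter_prod r = iter_prod t"
proof -
  have "r \<in> {r. iter_prod r \<in> iter_prod ` lie_power C d}"
  proof (rule span_induct_mem[OF assms subspace_vimage[OF plin_iter_prod
        subspace_image[OF plin_iter_prod subspace_lie_power]]])
    fix r assume "r \<in> sym_relations C (Suc d)"
    then obtain xs x y ys m n where
      r: "r = tens (xs @ [x, y] @ ys) - psc (ksign m n) (tens (xs @ [y, x] @ ys))"
      and *: "length (xs @ [x, y] @ ys) = Suc d" "set xs \<subseteq> cobar_lie C" "set ys \<subseteq> cobar_lie C"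
      and xy: "x \<in> cobar_lie_grd C m" "y \<in> cobar_lie_grd C n"
      by (auto simp: sym_relations_def ksign_def)
    have h: "hom C m x" "hom C n y" and l: "x \<in> cobar_lie C" "y \<in> cobar_lie C"
      using xy by (auto simp: cobar_lie_grd_iff)
    \<comment> \<open>The two neighbouring factors merge into the single Lie factor
      \<open>gcomm C x y\<close>, which lowers the number of factors by one.\<close>
    have "iter_prod r = iter_prod (tens (xs @ [gcomm C x y] @ ys))"
      by (simp add: r plin_diff[OF plin_iter_prod] plin_psc[OF plin_iter_prod] tens_append
          gcomm_hom[OF h] algebra_simps)
    moreover have "tens (xs @ [gcomm C x y] @ ys) \<in> lie_power C d"
      using * l tens_in_lie_power[of "xs @ [gcomm C x y] @ ys" C] by (auto intro: cobar_lie.bracket)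
    ultimately show "r \<in> {r. iter_prod r \<in> iter_prod ` lie_power C d}"
      by auto
  qed
  then show ?thesis by auto
qed

text \<open>
  The symmetric group enters through \<open>permutations_of_set {..<d}\<close>: removing the first letter of a
  permutation gives a recursion that makes invariance under transpositions evident, and inserting the
  smallest letter gives the recursion of \<open>perm_sum_words\<close>.
\<close>

definition psign :: "('b, 'k::field) dgcoalg \<Rightarrow> 'b list list \<Rightarrow> nat set \<Rightarrow> nat \<Rightarrow> 'k"
  where "psign C ws A a = (\<Prod>b\<in>{b\<in>A. b < a}. ksign (wdeg C (ws ! a)) (wdeg C (ws ! b)))"

text \<open>One sign for each pair in which a larger index stands before a smaller one, collected at
  the larger index.\<close>

fun lsign :: "('b, 'k::field) dgcoalg \<Rightarrow> 'b list list \<Rightarrow> nat list \<Rightarrow> 'k"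
  where
    "lsign C ws [] = 1"
  | "lsign C ws (a # l) = psign C ws (set l) a * lsign C ws l"

definition index_perm_sum :: "('b, 'k::field) dgcoalg \<Rightarrow> 'b list list \<Rightarrow> nat set \<Rightarrow> 'b list list \<Rightarrow>\<^sub>0 'k"
  where "index_perm_sum C ws A = (\<Sum>l\<in>permutations_of_set A. psc (lsign C ws l) (bas (map ((!) ws) l)))"

lemma index_perm_sum_empty [simp]: "index_perm_sum C ws {} = bas []"
  by (simp add: index_perm_sum_def)

lemma psign_Diff_self [simp]: "psign C ws (A - {a}) a = psign C ws A a"
  unfolding psign_def by (rule prod.cong) auto

lemma index_perm_sum_rec:
  assumes "finite A" "A \<noteq> {}"
  shows "index_perm_sum C ws A = (\<Sum>a\<in>A. psc (psign C ws A a) (bas [ws ! a] * index_perm_sum C ws (A - {a})))"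
proof -
  have "index_perm_sum C ws A = (\<Sum>l\<in>(\<Union>a\<in>A. (#) a ` permutations_of_set (A - {a})).
      psc (lsign C ws l) (bas (map ((!) ws) l)))"
    unfolding index_perm_sum_def permutations_of_set_nonempty[OF assms(2)] ..
  also have "\<dots> = (\<Sum>a\<in>A. \<Sum>l\<in>(#) a ` permutations_of_set (A - {a}).
      psc (lsign C ws l) (bas (map ((!) ws) l)))"
    by (rule sum.UNION_disjoint) (use assms in auto)
  also have "\<dots> = (\<Sum>a\<in>A. psc (psign C ws A a) (bas [ws ! a] * index_perm_sum C ws (A - {a})))"
  proof (rule sum.cong[OF refl])
    fix a assume "a \<in> A"
    have "(\<Sum>l\<in>(#) a ` permutations_of_set (A - {a}). psc (lsign C ws l) (bas (map ((!) ws) l))) =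
        (\<Sum>l\<in>permutations_of_set (A - {a}). psc (lsign C ws (a # l)) (bas (map ((!) ws) (a # l))))"
      by (subst sum.reindex) auto
    also have "\<dots> = (\<Sum>l\<in>permutations_of_set (A - {a}).
        psc (psign C ws A a) (bas [ws ! a] * psc (lsign C ws l) (bas (map ((!) ws) l))))"
      by (rule sum.cong) (auto simp: permutations_of_setD(1))
    also have "\<dots> = psc (psign C ws A a) (bas [ws ! a] * index_perm_sum C ws (A - {a}))"
      by (simp only: index_perm_sum_def sum_distrib_left pm.scale_sum_right)
    finally show "(\<Sum>l\<in>(#) a ` permutations_of_set (A - {a}). psc (lsign C ws l) (bas (map ((!) ws) l))) =
        psc (psign C ws A a) (bas [ws ! a] * index_perm_sum C ws (A - {a}))" .
  qed
  finally show ?thesis .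
qed

lemma psign_insert_less:
  assumes "finite A" "b \<notin> A" "b < a"
  shows "psign C ws (insert b A) a = ksign (wdeg C (ws ! a)) (wdeg C (ws ! b)) * psign C ws A a"
proof -
  have "{x \<in> insert b A. x < a} = insert b {x\<in>A. x < a}" using assms by auto
  then show ?thesis using assms by (simp add: psign_def)
qed

lemma psign_insert_greater:
  "\<not> b < a \<Longrightarrow> psign C ws (insert b A) a = psign C ws A a"
  unfolding psign_def by (rule prod.cong) auto

text \<open>Placed in front, the smallest index \<open>m\<close> causes no inversion; behind a first
  letter \<open>a\<close> it causes one with \<open>a\<close>. The recursion by first letters thus
  turns into that of \<open>insert_word\<close>.\<close>

lemma index_perm_sum_insert_min:
  assumes "finite A" "\<And>a. a \<in> A \<Longrightarrow> m < a"
  shows "index_perm_sum C ws (insert m A) = lin (insert_word C (ws ! m)) (index_perm_sum C ws A)"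
  using assms
proof (induction "card A" arbitrary: A)
  case 0
  moreover have "psign C ws {m} m = 1"
    unfolding psign_def by (rule prod.neutral) auto
  ultimately show ?case by (auto simp: index_perm_sum_rec[of "{m}"])
next
  case (Suc n)
  then have A: "A \<noteq> {}" "finite A" "m \<notin> A" by auto
  have "index_perm_sum C ws (insert m A) = bas [ws ! m] * index_perm_sum C ws A +
      (\<Sum>a\<in>A. psc (psign C ws (insert m A) a) (bas [ws ! a] * index_perm_sum C ws (insert m A - {a})))"
  proof -
    have "psign C ws (insert m A) m = 1"
      unfolding psign_def by (rule prod.neutral) (use Suc.prems in fastforce)
    then show ?thesis
      using A by (subst index_perm_sum_rec) auto
  qed
  also have "(\<Sum>a\<in>A. psc (psign C ws (insert m A) a) (bas [ws ! a] * index_perm_sum C ws (insert m A - {a}))) =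
      (\<Sum>a\<in>A. psc (psign C ws A a) (psc (ksign (wdeg C (ws ! m)) (wdeg C (ws ! a)))
        (bas [ws ! a] * lin (insert_word C (ws ! m)) (index_perm_sum C ws (A - {a})))))"
  proof (rule sum.cong[OF refl])
    fix a assume a: "a \<in> A"
    then have e: "insert m A - {a} = insert m (A - {a})" using A by auto
    have "index_perm_sum C ws (insert m (A - {a})) = lin (insert_word C (ws ! m)) (index_perm_sum C ws (A - {a}))"
      by (rule Suc.hyps) (use Suc a A in auto)
    moreover have "psign C ws (insert m A) a = ksign (wdeg C (ws ! m)) (wdeg C (ws ! a)) * psign C ws A a"
      using psign_insert_less[of A m a C ws] A Suc.prems a by (simp add: ksign_commute)
    ultimately show "psc (psign C ws (insert m A) a) (bas [ws ! a] * index_perm_sum C ws (insert m A - {a})) =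
      psc (psign C ws A a) (psc (ksign (wdeg C (ws ! m)) (wdeg C (ws ! a)))
        (bas [ws ! a] * lin (insert_word C (ws ! m)) (index_perm_sum C ws (A - {a}))))"
      by (simp add: e mult.commute)
  qed
  also have "bas [ws ! m] * index_perm_sum C ws A + \<dots> = (\<Sum>a\<in>A. psc (psign C ws A a)
      (bas [ws ! m, ws ! a] * index_perm_sum C ws (A - {a}) + psc (ksign (wdeg C (ws ! m)) (wdeg C (ws ! a)))
        (bas [ws ! a] * lin (insert_word C (ws ! m)) (index_perm_sum C ws (A - {a})))))"
    unfolding pm.scale_right_distrib sum.distrib
    by (subst index_perm_sum_rec[OF A(2,1)]) (simp add: sum_distrib_left)
  also have "\<dots> = lin (insert_word C (ws ! m)) (\<Sum>a\<in>A. psc (psign C ws A a) (bas [ws ! a] * index_perm_sum C ws (A - {a})))"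
    unfolding lin_sum lin_psc using insert_factor_bas_bas_mult[of C "ws ! m"] by (simp add: insert_factor_bas)
  also have "\<dots> = lin (insert_word C (ws ! m)) (index_perm_sum C ws A)"
    by (simp only: index_perm_sum_rec[OF A(2,1)])
  finally show ?case .
qed

text \<open>Downward induction on the start \<open>k\<close> of a tail of the index range:
  \<open>k\<close> is its smallest index and is inserted into the arrangements of the later
  ones.\<close>

lemma perm_sum_words_eq_index_perm_sum: "perm_sum_words C ws = index_perm_sum C ws {..<length ws}"
proof -
  have "index_perm_sum C ws {k..<length ws} = perm_sum_words C (drop k ws)" if "k \<le> length ws" for k
    using that
  proof (induction rule: inc_induct)
    case (step k)
    then have "{k..<length ws} = insert k {Suc k..<length ws}" by auto
    moreover have "index_perm_sum C ws (insert k {Suc k..<length ws}) = lin (insert_word C (ws ! k)) (index_perm_sum C ws {Suc k..<length ws})"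
      by (rule index_perm_sum_insert_min) auto
    moreover have "drop k ws = ws ! k # drop (Suc k) ws"
      using step.hyps by (simp add: Cons_nth_drop_Suc)
    ultimately show ?case using step.IH by simp
  qed simp
  from this[of 0] show ?thesis by (simp add: atLeast0LessThan)
qed

section \<open>Invariance of the sum of signed permutations under transpositions\<close>

lemma lin_swap_at_Suc: "lin (swap_at C (Suc i)) (bas [a] * t) = bas [a] * lin (swap_at C i) t"
  by (rule plin_eqI[of "\<lambda>t. lin (swap_at C (Suc i)) (bas [a] * t)"]) (simp | intro plin_intros)+

lemma lin_swap_at_0: "lin (swap_at C 0) (bas [a, b] * t) = psc (ksign (wdeg C [a]) (wdeg C [b])) (bas [b, a] * t)"
  by (rule plin_eqI[of "\<lambda>t. lin (swap_at C 0) (bas [a, b] * t)"]) (simp | intro plin_intros)+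

text \<open>For positions behind the first the leading letter is split off. For the first position
  both leading letters are split off, and the transposition exchanges their roles in the double
  sum.\<close>

lemma symmetric_tensor_index_perm_sum:
  assumes "finite A"
  shows "symmetric_tensor (lift C) (index_perm_sum C ws A)"
  unfolding symmetric_tensor_def
proof
  fix i
  show "lin (swap_at (lift C) i) (index_perm_sum C ws A) = index_perm_sum C ws A"
    using assms
  proof (induction i arbitrary: A)
    case 0
    show ?case
    proof (cases "\<exists>a. A \<subseteq> {a}")
      \<comment> \<open>With at most one index there is nothing to exchange, and
        \<open>swap_at\<close> acts as the identity.\<close>
      case True
      then obtain a where "A = {} \<or> A = {a}" by auto
      then show ?thesis by (auto simp: index_perm_sum_rec[of "{a}"] lin_psc)
    next
      case False
      let ?ks = "\<lambda>a b. ksign (wdeg C (ws ! a)) (wdeg C (ws ! b)) :: 'b"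
      let ?g = "\<lambda>a b. psign C ws A a * psign C ws (A - {a}) b"
      let ?t = "\<lambda>a b. bas [ws ! a, ws ! b] * index_perm_sum C ws (A - {a} - {b})"
      have e: "index_perm_sum C ws A = (\<Sum>a\<in>A. \<Sum>b | b \<in> A \<and> b \<noteq> a. psc (?g a b) (?t a b))"
      proof -
        have "index_perm_sum C ws A = (\<Sum>a\<in>A. psc (psign C ws A a) (bas [ws ! a] * index_perm_sum C ws (A - {a})))"
          using False 0 by (intro index_perm_sum_rec) auto
        also have "\<dots> = (\<Sum>a\<in>A. \<Sum>b | b \<in> A \<and> b \<noteq> a. psc (?g a b) (?t a b))"
        proof (rule sum.cong[OF refl])
          fix a assume "a \<in> A"
          have "A - {a} \<noteq> {}" using False by auto
          moreover have "A - {a} = {b. b \<in> A \<and> b \<noteq> a}" by auto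
          ultimately show "psc (psign C ws A a) (bas [ws ! a] * index_perm_sum C ws (A - {a})) =
              (\<Sum>b | b \<in> A \<and> b \<noteq> a. psc (?g a b) (?t a b))"
            using 0 index_perm_sum_rec[of "A - {a}" C ws]
            by (simp add: sum_distrib_left pm.scale_sum_right)
        qed
        finally show ?thesis .
      qed
      \<comment> \<open>For \<open>b < a\<close>, choosing \<open>a\<close> first counts the
        inversion with \<open>b\<close>, while choosing \<open>b\<close> first does not; the two
        signs differ by the Koszul sign of the pair.\<close>
      have sgn: "?g a b * ?ks a b = ?g b a" if "a \<in> A" "b \<in> A" "b < a" for a b
      proof -
        have "A - {b} = insert a (A - {a, b})" "A - {a} = insert b (A - {a, b})" "A = insert b (A - {b})"
          using that by auto
        have "psign C ws A a = ?ks a b * psign C ws (A - {b}) a"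
          using psign_insert_less[of "A - {b}" b a C ws] 0 that by (simp add: insert_absorb)
        moreover have "psign C ws A b = psign C ws (A - {a}) b"
          using psign_insert_greater[of a b C ws "A - {a}"] that by (simp add: insert_absorb)
        ultimately show ?thesis by (simp add: mult_ac)
      qed
      have sgn': "?g a b * ?ks a b = ?g b a" if "a \<in> A" "b \<in> A" "b \<noteq> a" for a b
      proof (cases "b < a")
        case False
        then have "?g b a * ?ks b a = ?g a b" using that by (intro sgn) auto
        then show ?thesis
          by (metis ksign_commute ksign_square mult.assoc mult.right_neutral)
      qed (use sgn that in auto)
      have "lin (swap_at (lift C) 0) (index_perm_sum C ws A) =
          (\<Sum>a\<in>A. \<Sum>b | b \<in> A \<and> b \<noteq> a. psc (?g a b * ?ks a b) (?t b a))"
        unfolding e lin_sum lin_psc lin_swap_at_0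
        by (simp add: Diff_insert2[symmetric] insert_commute flip: Diff_insert)
      also have "\<dots> = (\<Sum>a\<in>A. \<Sum>b | b \<in> A \<and> b \<noteq> a. psc (?g b a) (?t b a))"
        by (intro sum.cong refl) (use sgn' in auto)
      also have "\<dots> = (\<Sum>b\<in>A. \<Sum>a | a \<in> A \<and> b \<noteq> a. psc (?g b a) (?t b a))"
        by (rule sum.swap_restrict) (use 0 in auto)
      also have "\<dots> = index_perm_sum C ws A"
        unfolding e by (intro sum.cong refl) auto
      finally show ?thesis .
    qed
  next
    case (Suc i)
    show ?case
    proof (cases "A = {}")
      case False
      show ?thesis
        unfolding index_perm_sum_rec[OF Suc.prems False] lin_sum lin_psc lin_swap_at_Suc
        by (intro sum.cong refl) (use Suc in auto)
    qed simp
  qed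
qed

lemma symmetric_tensor_lift_perm_sum: "symmetric_tensor (lift C) (perm_sum C t)"
  unfolding symmetric_tensor_def
proof
  fix i
  have "lin (swap_at (lift C) i) (perm_sum_words C ws) = perm_sum_words C ws" for ws
    using symmetric_tensor_index_perm_sum[of "{..<length ws}" C ws] by (simp add: perm_sum_words_eq_index_perm_sum symmetric_tensor_def)
  then show "lin (swap_at (lift C) i) (perm_sum C t) = perm_sum C t"
    by (simp add: perm_sum_def lin_lin)
qed

section \<open>Comparison with the Koszul sign of the symmetrization map\<close>

lemma lsign_eq_prod:
  "distinct l \<Longrightarrow> lsign C ws l = (\<Prod>(i, j)\<in>{(i, j). i < j \<and> j < length l \<and> l ! j < l ! i}.
    ksign (wdeg C (ws ! (l ! i))) (wdeg C (ws ! (l ! j))))"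
  for C :: "('b, 'k::field) dgcoalg"
proof (induction l)
  case (Cons a l)
  let ?P = "\<lambda>l. {(i, j). i < j \<and> j < length l \<and> l ! j < l ! i}"
  let ?f = "\<lambda>l (i, j). ksign (wdeg C (ws ! (l ! i))) (wdeg C (ws ! (l ! j))) :: 'k"
  let ?A = "(\<lambda>j. (0::nat, Suc j)) ` {j. j < length l \<and> l ! j < a}"
  let ?B = "(\<lambda>(i, j). (Suc i, Suc j)) ` ?P l"
  have fin: "finite (?P l)"
    by (rule finite_subset[of _ "{..<length l} \<times> {..<length l}"]) auto
  \<comment> \<open>An inversion of \<open>a # l\<close> either involves the head, at position 0, or
    is a shifted inversion of \<open>l\<close>.\<close>
  have split: "?P (a # l) = ?A \<union> ?B"
  proof (rule set_eqI)
    fix p show "p \<in> ?P (a # l) \<longleftrightarrow> p \<in> ?A \<union> ?B"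
    proof (cases p)
      case (Pair i j)
      then show ?thesis
        by (cases i; cases j) (auto simp: image_iff)
    qed
  qed
  have "prod (?f (a # l)) (?P (a # l)) = prod (?f (a # l)) ?A * prod (?f (a # l)) ?B"
    unfolding split by (rule prod.union_disjoint) (use fin in auto)
  also have "prod (?f (a # l)) ?B = prod (?f l) (?P l)"
    by (subst prod.reindex) (auto simp: inj_on_def intro!: prod.cong)
  also have "prod (?f (a # l)) ?A = (\<Prod>j | j < length l \<and> l ! j < a. ksign (wdeg C (ws ! a)) (wdeg C (ws ! (l ! j))))"
    by (subst prod.reindex) (auto simp: inj_on_def)
  also have "\<dots> = psign C ws (set l) a"
  proof -
    have *: "{b \<in> set l. b < a} = (!) l ` {j. j < length l \<and> l ! j < a}"
      by (auto simp: in_set_conv_nth)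
    show ?thesis
      unfolding psign_def *
      by (subst prod.reindex) (use Cons.prems in \<open>auto simp: inj_on_def nth_eq_iff_index_eq\<close>)
  qed
  finally show ?case using Cons by simp
qed simp

lemma sum_permutes_eq_index_perm_sum:
  "(\<Sum>\<sigma> | \<sigma> permutes {..<length ws}. psc (koszul_sign C ws \<sigma>) (bas (map (\<lambda>i. ws ! \<sigma> i) [0..<length ws]))) =
    index_perm_sum C ws {..<length ws}"
proof -
  let ?n = "length ws"
  let ?P = "{\<sigma>. \<sigma> permutes {..<?n}}" and ?m = "\<lambda>\<sigma> :: nat \<Rightarrow> nat. map \<sigma> [0..<?n]"
  have inj: "inj_on ?m ?P"
  proof (rule inj_onI)
    fix \<sigma> \<tau> assume *: "\<sigma> \<in> ?P" "\<tau> \<in> ?P" "?m \<sigma> = ?m \<tau>"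
    then have "\<sigma> i = \<tau> i" for i
      by (cases "i < ?n") (auto simp: permutes_not_in)
    then show "\<sigma> = \<tau>" by auto
  qed
  have sub: "?m ` ?P \<subseteq> permutations_of_set {..<?n}"
  proof safe
    fix \<sigma> assume \<sigma>: "\<sigma> permutes {..<?n}"
    then show "?m \<sigma> \<in> permutations_of_set {..<?n}"
      using permutes_image[OF \<sigma>] permutes_inj_on[OF \<sigma>]
      by (intro permutations_of_setI) (auto simp: distinct_map atLeast0LessThan)
  qed
  \<comment> \<open>Surjectivity onto the arrangements by counting: both sets have
    \<open>?n!\<close> elements.\<close>
  have "card (?m ` ?P) = card (permutations_of_set {..<?n})"
    by (simp add: card_image[OF inj] card_permutations)
  then have im: "?m ` ?P = permutations_of_set {..<?n}"
    by (intro card_subset_eq sub) simp_all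
  have sign: "koszul_sign C ws \<sigma> = lsign C ws (?m \<sigma>)" if "\<sigma> permutes {..<?n}" for \<sigma>
  proof -
    have "distinct (?m \<sigma>)" using permutes_inj_on[OF that] by (simp add: distinct_map)
    then show ?thesis
      unfolding lsign_eq_prod[OF \<open>distinct (?m \<sigma>)\<close>] koszul_sign_def ksign_def
      by (intro prod.cong) auto
  qed
  show ?thesis
    unfolding index_perm_sum_def im[symmetric]
    by (subst sum.reindex[OF inj]) (auto intro!: sum.cong simp: sign comp_def)
qed

lemma symmetrize_words_eq:
  "symmetrize_words C ws = psc (1 / fact (length ws)) (iter_prod (perm_sum_words C ws))"
  unfolding symmetrize_words_def perm_sum_words_eq_index_perm_sum sum_permutes_eq_index_perm_sum[symmetric] plin_sum[OF plin_iter_prod]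
  by (simp add: plin_psc[OF plin_iter_prod])

lemma plin_symmetrize: "plin (symmetrize C)"
  by (simp add: symmetrize_def plin_lin)

text \<open>All words of an element of \<open>lie_power C d\<close> have \<open>d\<close> factors,
  so the normalization is one constant that can be pulled out.\<close>

lemma symmetrize_eq_perm_sum:
  assumes "t \<in> lie_power C d"
  shows "symmetrize C t = psc (1 / fact d) (iter_prod (perm_sum C t))"
proof -
  have "symmetrize C t = lin (\<lambda>ws. psc (1 / fact d) (iter_prod (perm_sum_words C ws))) t"
    unfolding symmetrize_def
    by (rule lin_cong) (use lie_power_length[OF assms] in \<open>auto simp: supp_def symmetrize_words_eq\<close>)
  also have "\<dots> = psc (1 / fact d) (iter_prod (perm_sum C t))"
    unfolding lin_psc_fun perm_sum_def plin_lin_image[OF plin_iter_prod] ..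
  finally show ?thesis .
qed

lemma psi_symmetrize:
  assumes "t \<in> lie_power C d"
  shows "psi C p (symmetrize C t) = psc (of_nat p ^ d) (symmetrize C t)"
  unfolding symmetrize_eq_perm_sum[OF assms] plin_psc[OF plin_psi]
    symmetric_tensor_lift_psi[OF perm_sum_in_lie_power[OF assms] symmetric_tensor_lift_perm_sum]
  by (simp add: mult.commute)

lemma symmetrize_sym_relations:
  assumes "t \<in> lie_power C d" "t \<in> pm.span (sym_relations C d)"
  shows "symmetrize C t = 0"
  by (simp add: symmetrize_eq_perm_sum[OF assms(1)] perm_sum_sym_relations[OF assms(2)] plin_0[OF plin_iter_prod])

section \<open>Derivations preserving the Lie elements\<close>

definition lie_derivation :: "('b, 'k::field) dgcoalg \<Rightarrow> int \<Rightarrow> (('b list \<Rightarrow>\<^sub>0 'k) \<Rightarrow> 'b list \<Rightarrow>\<^sub>0 'k) \<Rightarrow> bool"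
  where "lie_derivation C m D \<longleftrightarrow> derivation C m D \<and> D ` cobar_lie C \<subseteq> cobar_lie C"

lemma lie_derivation_gcomm: "lie_mono C n x \<Longrightarrow> lie_derivation C n (gcomm C x)"
  unfolding lie_derivation_def
  by (auto intro: derivation_gcomm lie_mono_hom cobar_lie.bracket lie_mono_cobar_lie)

text \<open>A graded derivation satisfies \<open>D [x, y] = [D x, y] +- [x, D y]\<close>, so
  preservation of the Lie elements is decided on the letters.\<close>

lemma lie_derivationI:
  assumes D: "derivation C m D" and letter: "\<And>c. c \<noteq> coaug C \<Longrightarrow> D (bas [c]) \<in> cobar_lie C"
  shows "lie_derivation C m D"
proof -
  have op: "degree_op C m D" and pD: "plin D"
    using D by (auto simp: derivation_def degree_op_def)
  have mono: "D x \<in> cobar_lie C" if "lie_mono C n x" for n x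
    using that
  proof induction
    case (letter c)
    then show ?case by (rule assms(2))
  next
    case (bracket k x n y)
    note hx = lie_mono_hom[OF bracket.hyps(1)] and hy = lie_mono_hom[OF bracket.hyps(2)]
    have "D (gcomm C x y) = gcomm C (D x) y + psc (ksign m k) (gcomm C x (D y))"
      by (simp add: gcomm_hom[OF hx hy] gcomm_hom[OF degree_op_hom[OF op hx] hy]
          gcomm_hom[OF hx degree_op_hom[OF op hy]] plin_diff[OF pD] plin_psc[OF pD]
          derivation_mult[OF D hx] derivation_mult[OF D hy] pm.scale_right_distrib
          pm.scale_right_diff_distrib ksign_add_left ksign_add_right ksign_commute[of k m]
          ksign_commute[of k n] ksign_commute[of n m] mult_ac)
    then show ?case
      using bracket lie_mono_cobar_lie by (auto intro!: cobar_lie.intros)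
  qed
  have "D x \<in> cobar_lie C" if "x \<in> cobar_lie C" for x
    using cobar_lie_induct[OF that subspace_vimage[OF pD subspace_cobar_lie]] mono by auto
  then show ?thesis using D by (auto simp: lie_derivation_def)
qed

lemma lie_derivation_degree_op: "lie_derivation C m D \<Longrightarrow> degree_op C m D"
  by (simp add: lie_derivation_def derivation_def)

lemma diag_op_lie_power:
  assumes D: "lie_derivation C m D" and t: "t \<in> lie_power C d"
  shows "diag_op C m D t \<in> lie_power C d"
proof -
  have pD: "plin D" using D by (simp add: lie_derivation_def derivation_def degree_op_def)
  have *: "diag_op C m D (tens xs) \<in> lie_power C (length xs)" if "lie_monos C xs" for xs
    using that
  proof (induction xs)
    case Nil
    then show ?case by (simp add: diag_op_bas pm.subspace_0[OF subspace_lie_power])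
  next
    case (Cons x xs)
    then obtain n where x: "lie_mono C n x" by auto
    then have "x \<in> cobar_lie C" "D x \<in> cobar_lie C"
      using D lie_mono_cobar_lie[OF x] by (auto simp: lie_derivation_def)
    moreover have "tens xs \<in> lie_power C (length xs)"
      using Cons.prems lie_monos_cobar_lie[of xs C] by (intro tens_in_lie_power) auto
    ultimately show ?case
      using Cons by (simp add: diag_op_emb_mult[OF pD lie_mono_hom[OF x]] emb_mult_lie_power
          pm.subspace_add pm.subspace_scale subspace_lie_power)
  qed
  have "t \<in> {t. diag_op C m D t \<in> lie_power C d}"
    by (rule lie_power_induct[OF t subspace_vimage[OF plin_diag_op subspace_lie_power]]) (use * in auto)
  then show ?thesis by simp
qed

text \<open>On tensors the operator commutes with signed permutations, and the product turns it into
  \<open>D\<close> by the Leibniz rule.\<close>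

lemma symmetrize_diag_op:
  assumes D: "lie_derivation C m D" and t: "t \<in> lie_power C d"
  shows "symmetrize C (diag_op C m D t) = D (symmetrize C t)"
proof -
  have der: "derivation C m D" and pD: "plin D"
    using D by (auto simp: lie_derivation_def derivation_def degree_op_def)
  show ?thesis
    by (simp add: symmetrize_eq_perm_sum[OF t] symmetrize_eq_perm_sum[OF diag_op_lie_power[OF D t]] plin_psc[OF pD]
        diag_op_perm_sum[OF lie_derivation_degree_op[OF D], symmetric] iter_prod_diag_op[OF der])
qed

lemma ad_words_eq_diag_op_words: "ad_words C u ws = diag_op_words C (wdeg C u) (gcomm C (bas u)) ws"
  by (induction ws) (simp_all add: ksign_def)

lemma ad_action_eq_diag_op:
  assumes "hom C n x"
  shows "ad_action C x t = diag_op C n (gcomm C x) t"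
proof -
  have "ad_action C x t = lin (\<lambda>u. diag_op C n (gcomm C (bas u)) t) x"
    unfolding ad_action_def diag_op_def
    by (intro lin_cong) (use assms in \<open>auto simp: hom_def ad_words_eq_diag_op_words\<close>)
  also have "\<dots> = diag_op C n (gcomm C x) t"
    by (rule diag_op_lin_fun[symmetric]) (rule plin_eq_lin[OF plin_gcomm_left])
  finally show ?thesis .
qed

lemma plin_ad_action_left: "plin (\<lambda>x. ad_action C x t)"
  unfolding ad_action_def by (rule plin_lin)

lemma ad_action_lie_power:
  assumes "x \<in> cobar_lie C" "t \<in> lie_power C d"
  shows "ad_action C x t \<in> lie_power C d" "symmetrize C (ad_action C x t) = gcomm C x (symmetrize C t)"
proof -
  have "x \<in> {x. ad_action C x t \<in> lie_power C d}"
    by (rule cobar_lie_induct[OF assms(1) subspace_vimage[OF plin_ad_action_left subspace_lie_power]])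
      (use assms(2) in \<open>auto simp: ad_action_eq_diag_op[OF lie_mono_hom] intro: diag_op_lie_power lie_derivation_gcomm\<close>)
  then show "ad_action C x t \<in> lie_power C d" by simp
  have "x \<in> {x. symmetrize C (ad_action C x t) = gcomm C x (symmetrize C t)}"
    by (rule cobar_lie_induct[OF assms(1)
        subspace_ker[OF plin_comp[OF plin_symmetrize plin_ad_action_left] plin_gcomm_left]])
      (use assms(2) in \<open>auto simp: ad_action_eq_diag_op[OF lie_mono_hom] intro!: symmetrize_diag_op lie_derivation_gcomm\<close>)
  then show "symmetrize C (ad_action C x t) = gcomm C x (symmetrize C t)" by simp
qed

subsection \<open>The cobar differential\<close>

lemma ksign_minus_one: "ksign (-1) n = (-1 :: 'k::field) powi n"
  by (simp add: ksign_def power_int_minus power_int_minus_left)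

lemma tensor_diff_words_eq_diag_op_words: "tensor_diff_words C ws = diag_op_words C (-1) (cobar_diff C) ws"
  by (induction ws) (simp_all add: ksign_minus_one)

lemma tensor_diff_eq_diag_op: "tensor_diff C = diag_op C (-1) (cobar_diff C)"
  unfolding tensor_diff_def diag_op_def by (rule arg_cong[of _ _ lin]) (simp add: fun_eq_iff tensor_diff_words_eq_diag_op_words)

lemma plin_cobar_diff: "plin (cobar_diff C)"
  by (simp add: cobar_diff_def plin_lin)

lemma reduced_coprod_supp:
  assumes "dg_coalgebra C"
  shows "reduced_coprod C c \<in>
    supp {(a, b). cdeg C a + cdeg C b = cdeg C c \<and> a \<noteq> coaug C \<and> b \<noteq> coaug C}"
proof -
  have "\<forall>(a, b)\<in>Poly_Mapping.keys (coprod C c). cdeg C a + cdeg C b = cdeg C c"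
    using assms by (simp add: dg_coalgebra_def)
  then show ?thesis
    unfolding reduced_coprod_def
    by (intro lin_in_subspace subspace_supp) (auto intro: pm.subspace_0[OF subspace_supp])
qed

text \<open>A letter has degree one less than its coalgebra element. The linear part lowers the
  degree by the differential and shifts once; the quadratic part keeps the total degree and shifts
  twice.\<close>

lemma hom_cobar_diff_letter:
  assumes "dg_coalgebra C"
  shows "hom C (cdeg C c - 2) (cobar_diff_letter C c)"
proof -
  have 1: "hom C (cdeg C c - 2) (lin (\<lambda>b. if b = coaug C then 0 else bas [b]) (cdiff C c))"
    by (rule hom_lin) (use assms in \<open>auto simp: dg_coalgebra_def wdeg_Cons\<close>)
  have 2: "hom C (cdeg C c - 2)
      (lin (\<lambda>(a, b). psc ((-1) powi cdeg C a) (bas [a, b])) (reduced_coprod C c))"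
    by (rule hom_lin)
      (use reduced_coprod_supp[OF assms, of c] in \<open>auto simp: supp_def wdeg_Cons intro!: hom_psc\<close>)
  show ?thesis
    unfolding cobar_diff_letter_def using hom_diff[OF 2 1] by simp
qed

lemma derivation_cobar_diff:
  assumes "dg_coalgebra C"
  shows "derivation C (-1) (cobar_diff C)"
proof -
  have bas: "cobar_diff C (bas w) = cobar_diff_word C w" for w
    by (simp add: cobar_diff_def)
  have hom: "hom C (wdeg C w - 1) (cobar_diff_word C w)" for w
  proof (induction w)
    case (Cons c w)
    have "hom C (cdeg C c - 2 + wdeg C w) (cobar_diff_letter C c * bas w)"
      by (intro hom_mult hom_cobar_diff_letter assms) simp
    moreover have "hom C (wdeg C [c] + (wdeg C w - 1)) (bas [c] * cobar_diff_word C w)"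
      by (intro hom_mult Cons) simp
    ultimately show ?case
      by (simp add: hom_add hom_psc wdeg_Cons algebra_simps)
  qed simp
  have mult: "cobar_diff_word C (u @ v) =
      cobar_diff_word C u * bas v + psc (ksign (-1) (wdeg C u)) (bas u * cobar_diff_word C v)" for u v
  proof (induction u)
    case Nil
    then show ?case by (simp add: bas_Nil_mult)
  next
    case (Cons c u)
    have "(-1) powi (cdeg C c - 1) = (ksign (-1) (cdeg C c - 1) :: 'b)"
      by (simp add: ksign_minus_one)
    then show ?case
      by (simp add: Cons.IH distrib_left distrib_right pm.scale_right_distrib wdeg_Cons
          ksign_add_right mult.assoc del: bas_mult_assoc) (simp flip: mult.assoc)
  qed
  show ?thesis
    unfolding derivation_def degree_op_def bas
    using hom mult by (auto simp: plin_cobar_diff)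
qed

lemma cocommutative_reduced_coprod:
  assumes "cocommutative C"
  shows "lin (\<lambda>(a, b). psc (ksign (cdeg C a) (cdeg C b)) (bas (b, a))) (reduced_coprod C c) =
    reduced_coprod C c"
proof -
  have "reduced_coprod C c = lin (\<lambda>(a, b). if a = coaug C \<or> b = coaug C then 0 else bas (a, b))
      (lin (\<lambda>(a, b). psc (ksign (cdeg C a) (cdeg C b)) (bas (b, a))) (coprod C c))"
    using assms by (simp add: cocommutative_def reduced_coprod_def ksign_def)
  also have "\<dots> = lin (\<lambda>(a, b). psc (ksign (cdeg C a) (cdeg C b)) (bas (b, a))) (reduced_coprod C c)"
    unfolding reduced_coprod_def lin_lin by (rule lin_cong) (auto simp: lin_psc)
  finally show ?thesis by simp
qed

text \<open>Cocommutativity pairs the term of \<open>(a, b)\<close> with that of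
  \<open>(b, a)\<close>, so twice the quadratic part is a combination of brackets of letters;
  characteristic 0 permits division by 2.\<close>

lemma cobar_diff_letter_in_cobar_lie:
  fixes C :: "('b, 'k::field_char_0) dgcoalg"
  assumes "dg_coalgebra C" "cocommutative C"
  shows "cobar_diff_letter C c \<in> cobar_lie C"
proof -
  let ?s = "\<lambda>a. ksign (-1) (cdeg C a) :: 'k"
  let ?R = "reduced_coprod C c"
  define Q where "Q = lin (\<lambda>(a, b). psc (?s a) (bas [a, b])) ?R"
  have "Q = lin (\<lambda>(a, b). psc (?s a) (bas [a, b]))
      (lin (\<lambda>(a, b). psc (ksign (cdeg C a) (cdeg C b)) (bas (b, a))) ?R)"
    unfolding Q_def cocommutative_reduced_coprod[OF assms(2)] ..
  also have "\<dots> = lin (\<lambda>(a, b). psc (ksign (cdeg C a) (cdeg C b) * ?s b) (bas [b, a])) ?R"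
    unfolding lin_lin by (rule lin_cong) (auto simp: lin_psc)
  finally have "Q + Q = lin (\<lambda>(a, b). psc (?s a) (gcomm C (bas [a]) (bas [b]))) ?R"
  proof -
    assume Q': "Q = lin (\<lambda>(a, b). psc (ksign (cdeg C a) (cdeg C b) * ?s b) (bas [b, a])) ?R"
    have "Q + Q = lin (\<lambda>(a, b). psc (?s a) (bas [a, b]) +
        psc (ksign (cdeg C a) (cdeg C b) * ?s b) (bas [b, a])) ?R"
      using Q' lin_plus_fun[of "\<lambda>(a, b). psc (?s a) (bas [a, b])"
          "\<lambda>(a, b). psc (ksign (cdeg C a) (cdeg C b) * ?s b) (bas [b, a])" ?R]
      by (simp add: case_prod_unfold flip: Q_def[unfolded case_prod_unfold])
    also have "\<dots> = lin (\<lambda>(a, b). psc (?s a) (gcomm C (bas [a]) (bas [b]))) ?R"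
    proof (rule lin_cong, clarify)
      fix a b
      \<comment> \<open>The shift by one in both degrees changes the sign by
        \<open>-(-1)^(|a| + |b|)\<close>, which turns graded symmetry of the coproduct into graded
        antisymmetry of the words.\<close>
      have "ksign (cdeg C a - 1) (cdeg C b - 1) = - (ksign (cdeg C a) (cdeg C b) * (?s a * ?s b))"
        unfolding diff_conv_add_uminus ksign_add_left ksign_add_right
        by (simp add: ksign_commute[of "cdeg C a" "-1"] ksign_def[of "-1" "-1"])
      then have "?s a * ksign (cdeg C a - 1) (cdeg C b - 1) = - (ksign (cdeg C a) (cdeg C b) * ?s b)"
        by (simp add: mult.left_commute)
      then show "psc (?s a) (bas [a, b]) + psc (ksign (cdeg C a) (cdeg C b) * ?s b) (bas [b, a]) =
          psc (?s a) (gcomm C (bas [a]) (bas [b]))"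
        by (simp add: gcomm_ksign wdeg_Cons pm.scale_right_diff_distrib)
    qed
    finally show ?thesis .
  qed
  also have "\<dots> \<in> cobar_lie C"
    by (rule lin_in_subspace[OF subspace_cobar_lie])
      (use reduced_coprod_supp[OF assms(1), of c] in \<open>auto simp: supp_def intro!: cobar_lie.intros\<close>)
  finally have "psc (1 / 2) (Q + Q) \<in> cobar_lie C" by (rule cobar_lie.scale)
  moreover have "psc (1 / 2) (Q + Q) = Q"
    by (simp add: pm.scale_right_distrib flip: pm.scale_left_distrib)
  ultimately have "Q \<in> cobar_lie C" by simp
  moreover have "lin (\<lambda>b. if b = coaug C then 0 else bas [b]) (cdiff C c) \<in> cobar_lie C"
    by (rule lin_in_subspace[OF subspace_cobar_lie]) (auto intro: cobar_lie.intros)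
  moreover have "cobar_diff_letter C c = Q - lin (\<lambda>b. if b = coaug C then 0 else bas [b]) (cdiff C c)"
    by (simp add: cobar_diff_letter_def Q_def ksign_minus_one)
  ultimately show ?thesis
    by (simp add: pm.subspace_diff subspace_cobar_lie)
qed

lemma lie_derivation_cobar_diff:
  fixes C :: "('b, 'k::field_char_0) dgcoalg"
  assumes "dg_coalgebra C" "cocommutative C"
  shows "lie_derivation C (-1) (cobar_diff C)"
proof (rule lie_derivationI[OF derivation_cobar_diff[OF assms(1)]])
  fix c
  have "cobar_diff C (bas [c]) = cobar_diff_letter C c"
    by (simp add: cobar_diff_def mult_bas_Nil)
  then show "cobar_diff C (bas [c]) \<in> cobar_lie C"
    using cobar_diff_letter_in_cobar_lie[OF assms] by simp
qed

section \<open>The eigenspace decomposition of the cobar construction\<close>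

lemma span_UN_sum:
  assumes "x \<in> pm.span (\<Union>j. A j)" "\<And>j. pm.subspace (A j)"
  shows "\<exists>J g. finite J \<and> (\<forall>j. g j \<in> A j) \<and> x = (\<Sum>j\<in>J. g j)"
proof -
  \<comment> \<open>The families vanish outside \<open>J\<close>, so that two of them can be added
    over the union of their index sets.\<close>
  let ?V = "{x. \<exists>J g. finite J \<and> (\<forall>j. g j \<in> A j) \<and> (\<forall>j. j \<notin> J \<longrightarrow> g j = 0) \<and> x = (\<Sum>j\<in>J. g j)}"
  have "x \<in> ?V"
  proof (rule span_induct_mem[OF assms(1)])
    show "pm.subspace ?V"
    proof (rule pm.subspaceI)
      show "0 \<in> ?V"
        using assms(2) by (intro CollectI exI[of _ "{}"] exI[of _ "\<lambda>_. 0"]) (auto simp: pm.subspace_0)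
      fix x y assume "x \<in> ?V" "y \<in> ?V"
      then obtain J g J' g' where *: "finite J" "\<forall>j. g j \<in> A j" "\<forall>j. j \<notin> J \<longrightarrow> g j = 0" "x = (\<Sum>j\<in>J. g j)"
        "finite J'" "\<forall>j. g' j \<in> A j" "\<forall>j. j \<notin> J' \<longrightarrow> g' j = 0" "y = (\<Sum>j\<in>J'. g' j)"
        by auto
      have "x = (\<Sum>j\<in>J \<union> J'. g j)" "y = (\<Sum>j\<in>J \<union> J'. g' j)"
        unfolding *(4,8) by (rule sum.mono_neutral_left; use * in auto)+
      then have "x + y = (\<Sum>j\<in>J \<union> J'. g j + g' j)" by (simp add: sum.distrib)
      then show "x + y \<in> ?V"
        using * assms(2)
        by (intro CollectI exI[of _ "J \<union> J'"] exI[of _ "\<lambda>j. g j + g' j"]) (auto intro: pm.subspace_add)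
    next
      fix c x assume "x \<in> ?V"
      then obtain J g where "finite J" "\<forall>j. g j \<in> A j" "\<forall>j. j \<notin> J \<longrightarrow> g j = 0" "x = (\<Sum>j\<in>J. g j)"
        by auto
      then show "psc c x \<in> ?V"
        using assms(2)
        by (intro CollectI exI[of _ J] exI[of _ "\<lambda>j. psc c (g j)"])
          (auto intro: pm.subspace_scale simp: pm.scale_sum_right)
    qed
    fix x assume "x \<in> (\<Union>j. A j)"
    then obtain j where "x \<in> A j" by auto
    then show "x \<in> ?V"
      using assms(2)
      by (intro CollectI exI[of _ "{j}"] exI[of _ "\<lambda>i. if i = j then x else 0"])
        (auto simp: pm.subspace_0)
  qed
  then show ?thesis by blast
qed

lemma iter_prod_in_span_symmetrize:
  "t \<in> lie_power C d \<Longrightarrow> iter_prod t \<in> pm.span (\<Union>j. symmetrize C ` lie_power C j)"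
proof (induction d arbitrary: t)
  case 0
  \<comment> \<open>A relation involves at least two factors, so in order 0 \<open>perm_sum\<close>
    is the identity.\<close>
  have "sym_relations C 0 = {}" by (auto simp: sym_relations_def)
  then have "perm_sum C t = t" using perm_sum_minus_fact[OF 0] by simp
  then have "iter_prod t = symmetrize C t" by (simp add: symmetrize_eq_perm_sum[OF 0])
  then show ?case using 0 by (auto intro: pm.span_base)
next
  case (Suc d)
  obtain t' where t': "t' \<in> lie_power C d" "iter_prod (perm_sum C t - psc (fact (Suc d)) t) = iter_prod t'"
    using iter_prod_sym_relations[OF perm_sum_minus_fact[OF Suc.prems]] by auto
  have "psc (1 / fact (Suc d)) (iter_prod (perm_sum C t - psc (fact (Suc d)) t)) = symmetrize C t - iter_prod t"
    unfolding symmetrize_eq_perm_sum[OF Suc.prems] plin_diff[OF plin_iter_prod] plin_psc[OF plin_iter_prod]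
      pm.scale_right_diff_distrib
    by (simp del: fact_Suc)
  then have "iter_prod t = symmetrize C t - psc (1 / fact (Suc d)) (iter_prod t')"
    unfolding t'(2) by (simp add: algebra_simps)
  moreover have "symmetrize C t \<in> pm.span (\<Union>j. symmetrize C ` lie_power C j)"
    using Suc.prems by (auto intro: pm.span_base)
  ultimately show ?case
    using Suc.IH[OF t'(1)] by (simp add: pm.span_diff pm.span_scale)
qed

lemma cobar_decomposition:
  assumes "x \<in> cobar C"
  shows "\<exists>J t. finite J \<and> (\<forall>j. t j \<in> lie_power C j) \<and> x = (\<Sum>j\<in>J. symmetrize C (t j))"
proof -
  have "x \<in> pm.span (\<Union>j. symmetrize C ` lie_power C j)"
  proof (rule cobar_induct[OF assms pm.subspace_span])
    fix w assume w: "coaug C \<notin> set w"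
    \<comment> \<open>A word is the product of its letters, which are Lie elements.\<close>
    have "iter_prod (tens (map (\<lambda>c. bas [c]) w)) = (bas w :: _ \<Rightarrow>\<^sub>0 'b)"
      by (induction w) simp_all
    moreover have "tens (map (\<lambda>c. bas [c]) w) \<in> lie_power C (length w)"
      using tens_in_lie_power[of "map (\<lambda>c. bas [c]) w" C] w
      by (force intro: cobar_lie.letter)
    ultimately show "bas w \<in> pm.span (\<Union>j. symmetrize C ` lie_power C j)"
      using iter_prod_in_span_symmetrize by metis
  qed
  from span_UN_sum[OF this subspace_image[OF plin_symmetrize subspace_lie_power]]
  obtain J g where J: "finite J" "\<forall>j. g j \<in> symmetrize C ` lie_power C j" "x = (\<Sum>j\<in>J. g j)"
    by (elim exE conjE)
  then have "\<forall>j. \<exists>t. t \<in> lie_power C j \<and> g j = symmetrize C t" by (simp add: image_iff Bex_def)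
  then obtain t where "\<forall>j. t j \<in> lie_power C j \<and> g j = symmetrize C (t j)"
    by (rule choice[THEN exE])
  then show ?thesis using J by (intro exI[of _ J] exI[of _ t]) simp
qed

lemma symmetrize_in_cobar: "t \<in> lie_power C d \<Longrightarrow> symmetrize C t \<in> cobar C"
proof -
  assume t: "t \<in> lie_power C d"
  have *: "iter_prod (tens xs) \<in> cobar C" if "lie_monos C xs" for xs
    using that
  proof (induction xs)
    case (Cons x xs)
    then show ?case
      using cobar_lie_subset[OF lie_mono_cobar_lie] by (auto intro!: cobar_mult)
  qed simp
  have "perm_sum C t \<in> {t. iter_prod t \<in> cobar C}"
    by (rule lie_power_induct[OF perm_sum_in_lie_power[OF t] subspace_vimage[OF plin_iter_prod subspace_cobar]])
      (use * in auto)
  then show ?thesis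
    by (simp add: symmetrize_eq_perm_sum[OF t] pm.subspace_scale[OF subspace_cobar])
qed

text \<open>Applying \<psi>^2 - 2^i removes component \<open>i\<close> and multiplies component
  \<open>j\<close> by \<open>2 ^ j - 2 ^ i\<close>, which is nonzero in characteristic 0; the
  induction continues with the rescaled tensors. The lemma serves for relations, for boundaries and
  for the zero subspace.\<close>

lemma sum_symmetrize_mem:
  fixes C :: "('b, 'k::field_char_0) dgcoalg"
  assumes R: "pm.subspace R" "\<And>x. x \<in> R \<Longrightarrow> psi C 2 x \<in> R"
    and "finite J" "\<forall>j\<in>J. t j \<in> lie_power C j" "(\<Sum>j\<in>J. symmetrize C (t j)) \<in> R"
  shows "\<forall>j\<in>J. symmetrize C (t j) \<in> R"
  using assms(3-)
proof (induction J arbitrary: t)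
  case (insert i J)
  let ?S = "\<lambda>t. symmetrize C t"
  let ?t' = "\<lambda>j. psc (2 ^ j - 2 ^ i) (t j)"
  let ?x = "\<Sum>j\<in>insert i J. ?S (t j)"
  have "psi C 2 (?S (t j)) = psc (2 ^ j) (?S (t j))" if "j \<in> insert i J" for j
  proof -
    have "t j \<in> lie_power C j" using insert.prems(1) that by blast
    then show ?thesis using psi_symmetrize[of "t j" C j 2] by simp
  qed
  then have "(\<Sum>j\<in>insert i J. psi C 2 (?S (t j))) = (\<Sum>j\<in>insert i J. psc (2 ^ j) (?S (t j)))"
    by (intro sum.cong refl)
  then have "psi C 2 ?x - psc (2 ^ i) ?x = (\<Sum>j\<in>insert i J. psc (2 ^ j) (?S (t j)) - psc (2 ^ i) (?S (t j)))"
    unfolding sum_subtractf pm.scale_sum_right plin_sum[OF plin_psi] by simp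
  also have "\<dots> = (\<Sum>j\<in>J. ?S (?t' j))"
    using insert.hyps by (simp add: plin_psc[OF plin_symmetrize] plin_diff[OF plin_symmetrize] pm.scale_left_diff_distrib)
  finally have eq: "psi C 2 ?x - psc (2 ^ i) ?x = (\<Sum>j\<in>J. ?S (?t' j))" .
  have "(\<Sum>j\<in>J. ?S (?t' j)) \<in> R"
    unfolding eq[symmetric] by (intro pm.subspace_diff[OF R(1)] pm.subspace_scale[OF R(1)] R(2) insert.prems(2))
  then have *: "\<forall>j\<in>J. ?S (?t' j) \<in> R"
    using insert.prems(1) by (intro insert.IH) (auto intro: pm.subspace_scale subspace_lie_power)
  have J: "?S (t j) \<in> R" if "j \<in> J" for j
  proof -
    have "j \<noteq> i" using that insert.hyps by auto
    then have "(of_nat (2 ^ j) :: 'k) \<noteq> of_nat (2 ^ i)"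
      unfolding of_nat_eq_iff by simp
    then have "(2 ^ j - 2 ^ i :: 'k) \<noteq> 0" by simp
    then have "?S (t j) = psc (1 / (2 ^ j - 2 ^ i)) (?S (?t' j))"
      by (simp add: plin_psc[OF plin_symmetrize])
    then show ?thesis using * that R(1) by (simp add: pm.subspace_scale)
  qed
  have "?S (t i) = ?x - (\<Sum>j\<in>J. ?S (t j))" using insert.hyps by simp
  also have "\<dots> \<in> R"
    by (intro pm.subspace_diff[OF R(1)] pm.subspace_sum[OF R(1)] insert.prems(2) J)
  finally show ?case using J by auto
qed simp

subsection \<open>Homogeneous components\<close>

definition proj :: "('b, 'k::field) dgcoalg \<Rightarrow> int \<Rightarrow> ('b list \<Rightarrow>\<^sub>0 'k) \<Rightarrow> 'b list \<Rightarrow>\<^sub>0 'k"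
  where "proj C n = lin (\<lambda>w. if wdeg C w = n then bas w else 0)"

lemma plin_proj: "plin (proj C n)"
  by (simp add: proj_def plin_lin)

lemma proj_hom_eq: "hom C n x \<Longrightarrow> proj C n x = x"
proof -
  assume "hom C n x"
  then have "proj C n x = lin bas x"
    unfolding proj_def by (intro lin_cong) (auto simp: hom_def)
  then show ?thesis by simp
qed

lemma proj_hom_neq: "hom C m x \<Longrightarrow> m \<noteq> n \<Longrightarrow> proj C n x = 0"
proof -
  assume "hom C m x" "m \<noteq> n"
  then have "proj C n x = lin (\<lambda>_. 0) x"
    unfolding proj_def by (intro lin_cong) (auto simp: hom_def)
  then show ?thesis by simp
qed

lemma hom_proj: "hom C n (proj C n x)"
  unfolding proj_def by (rule hom_lin) simp

lemma lie_power_grd_iff: "t \<in> lie_power_grd C d n \<longleftrightarrow> t \<in> lie_power C d \<and> hom (lift C) n t"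
  by (simp add: lie_power_grd_def hom_def wdeg_lift)

lemma hom_tens: "lie_monos C xs \<Longrightarrow> \<exists>n. hom (lift C) n (tens xs)"
proof (induction xs)
  case Nil
  show ?case by (auto intro!: exI[of _ 0])
next
  case (Cons x xs)
  then obtain m n where "lie_mono C m x" "hom (lift C) n (tens xs)" by auto
  then have "hom (lift C) (m + n) (emb x * tens xs)"
    using hom_mult[OF hom_emb[OF lie_mono_hom]] by blast
  then show ?case by auto
qed

lemma proj_lie_power_grd:
  assumes "t \<in> lie_power C d"
  shows "proj (lift C) n t \<in> lie_power_grd C d n"
proof -
  have "t \<in> {t. proj (lift C) n t \<in> lie_power C d}"
  proof (rule lie_power_induct[OF assms subspace_vimage[OF plin_proj subspace_lie_power]])
    fix xs assume xs: "length xs = d" "lie_monos C xs"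
    then obtain m where m: "hom (lift C) m (tens xs)" using hom_tens by blast
    have "tens xs \<in> lie_power C d"
      using xs tens_in_lie_power lie_monos_cobar_lie by metis
    then show "tens xs \<in> {t. proj (lift C) n t \<in> lie_power C d}"
      using proj_hom_eq[OF m] proj_hom_neq[OF m, of n] pm.subspace_0[OF subspace_lie_power]
      by (cases "m = n") auto
  qed
  then show ?thesis by (simp add: lie_power_grd_iff hom_proj)
qed

lemma hom_symmetrize_words: "hom C (wdeg (lift C) ws) (symmetrize_words C ws)"
proof -
  have "hom C (wdeg (lift C) ws) (bas (concat (map (\<lambda>i. ws ! \<sigma> i) [0..<length ws])))"
    if \<sigma>: "\<sigma> permutes {..<length ws}" for \<sigma>
  proof -
    have "wdeg C (concat (map (\<lambda>i. ws ! \<sigma> i) [0..<length ws])) = (\<Sum>i<length ws. wdeg C (ws ! \<sigma> i))"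
      by (simp add: wdeg_concat wdeg_lift comp_def interv_sum_list_conv_sum_set_nat atLeast0LessThan)
    also have "\<dots> = (\<Sum>i<length ws. wdeg C (ws ! i))"
      using sum.permute[OF \<sigma>, of "\<lambda>i. wdeg C (ws ! i)"] by (simp add: comp_def)
    also have "\<dots> = wdeg (lift C) ws"
      by (simp add: wdeg_lift sum_list_sum_nth atLeast0LessThan)
    finally show ?thesis by simp
  qed
  then show ?thesis
    unfolding symmetrize_words_def hom_iff_supp
    by (intro pm.subspace_scale pm.subspace_sum subspace_supp) auto
qed

lemma symmetrize_proj: "symmetrize C (proj (lift C) n t) = proj C n (symmetrize C t)"
proof (rule plin_eqI[of "\<lambda>t. symmetrize C (proj (lift C) n t)"])
  fix ws
  have b: "symmetrize C (bas ws) = symmetrize_words C ws" by (simp add: symmetrize_def)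
  have h: "hom (lift C) (wdeg (lift C) ws) (bas ws)" by simp
  show "symmetrize C (proj (lift C) n (bas ws)) = proj C n (symmetrize C (bas ws))"
    using proj_hom_eq[OF h] proj_hom_neq[OF h, of n] proj_hom_eq[OF hom_symmetrize_words, of C ws]
      proj_hom_neq[OF hom_symmetrize_words, of C ws n] plin_0[OF plin_symmetrize, of C]
    by (cases "wdeg (lift C) ws = n") (auto simp: b)
qed (intro plin_comp[OF plin_symmetrize] plin_comp[OF plin_proj] plin_proj plin_symmetrize)+

lemma symmetrize_grd: "t \<in> lie_power_grd C d n \<Longrightarrow> symmetrize C t \<in> cobar_grd C n"
  using symmetrize_in_cobar[of t C d] symmetrize_proj[of C n t] proj_hom_eq[of "lift C" n t] hom_proj[of C n]
  by (auto simp: lie_power_grd_iff hom_cobar_grd) metis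

text \<open>Symmetrization commutes with the projection to degree \<open>n\<close>, so the
  components of a homogeneous element may be replaced by their parts of degree
  \<open>n\<close>.\<close>

lemma cobar_grd_decomposition:
  assumes "x \<in> cobar_grd C n"
  shows "\<exists>J t. finite J \<and> (\<forall>j. t j \<in> lie_power_grd C j n) \<and> x = (\<Sum>j\<in>J. symmetrize C (t j))"
proof -
  obtain J t where J: "finite J" "\<forall>j. t j \<in> lie_power C j" "x = (\<Sum>j\<in>J. symmetrize C (t j))"
    using cobar_decomposition[of x C] assms by (auto simp: hom_cobar_grd)
  have "x = proj C n x" using assms by (simp add: hom_cobar_grd proj_hom_eq)
  also have "\<dots> = (\<Sum>j\<in>J. symmetrize C (proj (lift C) n (t j)))"
    unfolding J(3) plin_sum[OF plin_proj] symmetrize_proj ..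
  finally have "x = (\<Sum>j\<in>J. symmetrize C (proj (lift C) n (t j)))" .
  moreover have "\<forall>j. proj (lift C) n (t j) \<in> lie_power_grd C j n"
    using J(2) by (intro allI proj_lie_power_grd) simp
  ultimately show ?thesis
    using J(1) by (intro exI[of _ J] exI[of _ "\<lambda>j. proj (lift C) n (t j)"] conjI)
qed

text \<open>\<open>D\<close> maps a symmetrized tensor to a symmetrized tensor of the same order, so
  it preserves each eigenspace of \<psi>^p.\<close>

lemma psi_derivation:
  fixes C :: "('b, 'k::field_char_0) dgcoalg"
  assumes "lie_derivation C m D" "x \<in> cobar C"
  shows "psi C p (D x) = D (psi C p x)"
proof -
  have pD: "plin D" using assms(1) by (simp add: lie_derivation_def derivation_def degree_op_def)
  obtain J t where J: "finite J" "\<forall>j. t j \<in> lie_power C j" "x = (\<Sum>j\<in>J. symmetrize C (t j))"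
    using cobar_decomposition[OF assms(2)] by auto
  show ?thesis
    unfolding J(3) plin_sum[OF pD] plin_sum[OF plin_psi]
  proof (rule sum.cong[OF refl])
    fix j
    have t: "t j \<in> lie_power C j" using J by auto
    show "psi C p (D (symmetrize C (t j))) = D (psi C p (symmetrize C (t j)))"
      by (simp add: psi_symmetrize[OF t] plin_psc[OF pD]
          psi_symmetrize[OF diag_op_lie_power[OF assms(1) t]] flip: symmetrize_diag_op[OF assms(1) t])
  qed
qed

section \<open>The kernel of symmetrization\<close>

lemma proj_cobar_lie: "x \<in> cobar_lie C \<Longrightarrow> proj C n x \<in> cobar_lie C"
proof -
  assume x: "x \<in> cobar_lie C"
  have "proj C n y \<in> cobar_lie C" if "lie_mono C m y" for m y
    using lie_mono_cobar_lie[OF that] proj_hom_eq[OF lie_mono_hom[OF that]]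
      proj_hom_neq[OF lie_mono_hom[OF that], of n]
    by (cases "m = n") (auto intro: cobar_lie.zero)
  then show ?thesis
    using cobar_lie_induct[OF x subspace_vimage[OF plin_proj subspace_cobar_lie]] by auto
qed

lemma cobar_lie_nonempty: "x \<in> cobar_lie C \<Longrightarrow> x \<in> supp {w. w \<noteq> []}"
proof (induction rule: cobar_lie.induct)
  case (bracket x y)
  then show ?case
    unfolding gcomm_def
    by (intro lin_in_subspace subspace_supp pm.subspace_diff pm.subspace_scale) (auto simp: supp_def)
qed (auto intro: pm.subspace_add pm.subspace_scale pm.subspace_0 subspace_supp)

text \<open>An arbitrary linear projection onto the Lie elements is corrected word by word: its
  value is cut down to the degree of the word, and the empty word is sent to 0. Lie elements are
  still fixed, because Lie monomials are homogeneous and do not involve the empty word. Degrees must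
  be preserved since the symmetry relations exchange homogeneous factors.\<close>

lemma lie_projection_exists:
  fixes C :: "('b, 'k::field) dgcoalg"
  shows "\<exists>e. plin e \<and> (\<forall>w. e (bas w) \<in> cobar_lie_grd C (wdeg C w)) \<and>
    (\<forall>x\<in>cobar_lie C. e x = x) \<and> e (bas []) = 0"
proof -
  interpret vp: vector_space_pair "psc :: 'k \<Rightarrow> ('b list \<Rightarrow>\<^sub>0 'k) \<Rightarrow> _" "psc :: 'k \<Rightarrow> ('b list \<Rightarrow>\<^sub>0 'k) \<Rightarrow> _"
    by unfold_locales
  have "\<exists>g. g ` UNIV \<subseteq> cobar_lie C \<and> Vector_Spaces.linear psc psc g \<and> (\<forall>v\<in>cobar_lie C. g (id v) = v)"
    by (rule vp.linear_exists_left_inverse_on[OF pm.linear_id subspace_cobar_lie]) simp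
  then obtain g where g: "\<And>x. g x \<in> cobar_lie C" "Vector_Spaces.linear psc psc g" "\<And>v. v \<in> cobar_lie C \<Longrightarrow> g v = v"
    by auto
  have pg: "plin g"
    using g(2) by (auto intro!: plinI simp: Vector_Spaces.linear_iff)
  define e where "e = lin (\<lambda>w. if w = [] then 0 else proj C (wdeg C w) (g (bas w)))"
  have pe: "plin e" by (simp add: e_def plin_lin)
  have mono: "e x = x" if x: "lie_mono C n x" for n x
  proof -
    have "e x = lin (\<lambda>w. proj C n (g (bas w))) x"
      unfolding e_def
      by (rule lin_cong)
        (use lie_mono_hom[OF x] cobar_lie_nonempty[OF lie_mono_cobar_lie[OF x]] in
          \<open>auto simp: hom_def supp_def\<close>)
    also have "\<dots> = proj C n (g x)"
      by (rule plin_eq_lin[OF plin_comp[OF plin_proj pg], symmetric])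
    also have "\<dots> = x"
      by (simp add: g(3) lie_mono_cobar_lie[OF x] proj_hom_eq[OF lie_mono_hom[OF x]])
    finally show ?thesis .
  qed
  have "e x = x" if "x \<in> cobar_lie C" for x
    using cobar_lie_induct[OF that subspace_ker[OF pe plin_id]] mono by auto
  moreover have "e (bas w) \<in> cobar_lie_grd C (wdeg C w)" for w
    by (auto simp: e_def cobar_lie_grd_iff hom_proj proj_cobar_lie g(1) cobar_lie.zero)
  ultimately show ?thesis
    using pe by (intro exI[of _ e]) (auto simp: e_def)
qed

text \<open>The symmetry relations of a tensor algebra, stated for words. Over
  \<open>lift C\<close>, the tensor power of a degree-preserving projection onto the Lie elements
  carries them into \<open>sym_relations C\<close>.\<close>

definition swap_relations :: "('b, 'k::field) dgcoalg \<Rightarrow> nat \<Rightarrow> ('b list \<Rightarrow>\<^sub>0 'k) set"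
  where "swap_relations C n = pm.span {bas (u @ [x, y] @ v) -
    psc (ksign (wdeg C [x]) (wdeg C [y])) (bas (u @ [y, x] @ v)) | u x y v. length (u @ [x, y] @ v) = n}"

lemma subspace_swap_relations: "pm.subspace (swap_relations C n)"
  by (simp add: swap_relations_def)

lemma swap_relations_Cons:
  assumes "r \<in> swap_relations C n"
  shows "bas [c] * r \<in> swap_relations C (Suc n)"
proof -
  have "r \<in> {r. bas [c] * r \<in> swap_relations C (Suc n)}"
  proof (rule span_induct_mem[OF assms[unfolded swap_relations_def]])
    show "pm.subspace {r. bas [c] * r \<in> swap_relations C (Suc n)}"
      by (intro subspace_vimage plin_intros subspace_swap_relations)
    fix r :: "'a list \<Rightarrow>\<^sub>0 'b"
    assume "r \<in> {bas (u @ [x, y] @ v) -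
    psc (ksign (wdeg C [x]) (wdeg C [y])) (bas (u @ [y, x] @ v)) | u x y v. length (u @ [x, y] @ v) = n}"
    then obtain u x y v where r: "r = bas (u @ [x, y] @ v) -
      psc (ksign (wdeg C [x]) (wdeg C [y])) (bas (u @ [y, x] @ v))" "length (u @ [x, y] @ v) = n" by auto
    have "bas [c] * r = bas ((c # u) @ [x, y] @ v) -
        psc (ksign (wdeg C [x]) (wdeg C [y])) (bas ((c # u) @ [y, x] @ v))"
      by (simp add: r right_diff_distrib)
    moreover have "length ((c # u) @ [x, y] @ v) = Suc n" using r by simp
    ultimately show "r \<in> {r. bas [c] * r \<in> swap_relations C (Suc n)}"
      unfolding swap_relations_def by (intro CollectI pm.span_base exI conjI)
  qed
  then show ?thesis by simp
qed

text \<open>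
  Distributing \<open>d\<close> letters over \<open>d\<close> factors without leaving one empty means permuting them; this map
  selects those terms of the \<open>d\<close>-fold coproduct.
\<close>

definition single_letters :: "'b list list \<Rightarrow> 'b list \<Rightarrow>\<^sub>0 'k::field"
  where "single_letters ws = (if \<forall>w\<in>set ws. length w \<le> 1 then bas (concat ws) else 0)"

lemma lin_single_letters_mult:
  "lin single_letters (bas [w] * t) = (if length w \<le> 1 then bas w * lin single_letters t else 0)"
proof (rule plin_eqI[of "\<lambda>t. lin single_letters (bas [w] * t)"])
  show "plin (\<lambda>t. if length w \<le> 1 then bas w * lin single_letters t else 0)"
    by (cases "length w \<le> 1") (simp_all only: if_True if_False, (intro plin_intros)+)
qed (simp add: single_letters_def | intro plin_intros)+

text \<open>A new letter has to be put into one of the empty factors.\<close>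

lemma single_letters_diag_op_words:
  "lin single_letters (diag_op_words C (wdeg C [c]) ((*) (bas [c])) ws) -
     psc (of_nat (length (filter (\<lambda>w. w = []) ws))) (bas [c] * single_letters ws)
   \<in> swap_relations C (Suc (\<Sum>w\<leftarrow>ws. length w))"
proof (induction ws)
  case Nil
  then show ?case by (simp add: pm.subspace_0[OF subspace_swap_relations])
next
  case (Cons w ws)
  let ?D = "lin single_letters (diag_op_words C (wdeg C [c]) ((*) (bas [c])) ws)"
  let ?N = "of_nat (length (filter (\<lambda>w. w = []) ws)) :: 'b"
  consider "w = []" | b where "w = [b]" | "\<not> length w \<le> 1"
    by (cases w; cases "tl w") auto
  then show ?case
  proof cases
    \<comment> \<open>An empty factor accepts \<open>c\<close>, which gives one term; the terms in
      which \<open>c\<close> goes further right are counted by the remaining factors.\<close>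
    case 1
    have "single_letters ([c] # ws) = (bas [c] * single_letters ws :: 'a list \<Rightarrow>\<^sub>0 'b)"
      "single_letters ([] # ws) = (single_letters ws :: 'a list \<Rightarrow>\<^sub>0 'b)"
      by (simp_all add: single_letters_def)
    then show ?thesis
      using Cons 1 by (simp add: lin_add lin_psc lin_single_letters_mult bas_Nil_mult pm.scale_left_distrib)
  next
    \<comment> \<open>A factor \<open>[b]\<close> is closed to \<open>c\<close>, which has to cross
      \<open>b\<close>; a swap relation then brings it back in front of \<open>b\<close>.\<close>
    case 2
    let ?s = "ksign (wdeg C [c]) (wdeg C [b]) :: 'b"
    have z: "single_letters ((c # [b]) # ws) = (0 :: 'a list \<Rightarrow>\<^sub>0 'b)"
      "single_letters ([b] # ws) = (bas [b] * single_letters ws :: 'a list \<Rightarrow>\<^sub>0 'b)"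
      by (simp_all add: single_letters_def)
    have sw: "bas [c, b] * single_letters ws - psc ?s (bas [b, c] * single_letters ws)
        \<in> swap_relations C (Suc (Suc (\<Sum>w\<leftarrow>ws. length w)))"
    proof (cases "\<forall>w\<in>set ws. length w \<le> 1")
      case True
      have "bas ([] @ [c, b] @ concat ws) - psc ?s (bas ([] @ [b, c] @ concat ws))
          \<in> swap_relations C (Suc (Suc (\<Sum>w\<leftarrow>ws. length w)))"
        unfolding swap_relations_def
        by (intro pm.span_base CollectI exI conjI) (rule refl, simp add: length_concat)
      then show ?thesis using True by (simp add: single_letters_def)
    next
      case False
      then show ?thesis
        using pm.subspace_0[OF subspace_swap_relations] unfolding single_letters_def if_not_P[OF False] by simp
    qed
    have "lin single_letters (diag_op_words C (wdeg C [c]) ((*) (bas [c])) (w # ws)) -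
        psc (of_nat (length (filter (\<lambda>w. w = []) (w # ws)))) (bas [c] * single_letters (w # ws)) =
        psc ?s (bas [b] * ?D) - psc ?N (bas [c, b] * single_letters ws)"
      by (simp add: 2 lin_add lin_psc lin_single_letters_mult z)
    also have "\<dots> = psc ?s (bas [b] * (?D - psc ?N (bas [c] * single_letters ws)))
        - psc ?N (bas [c, b] * single_letters ws - psc ?s (bas [b, c] * single_letters ws))"
      by (simp add: right_diff_distrib pm.scale_right_diff_distrib mult.commute)
    also have "\<dots> \<in> swap_relations C (Suc (Suc (\<Sum>w\<leftarrow>ws. length w)))"
      by (intro pm.subspace_diff pm.subspace_scale subspace_swap_relations swap_relations_Cons sw Cons.IH)
    finally show ?thesis using 2 by simp
  next
    case 3
    then have "single_letters ((c # w) # ws) = (0 :: 'a list \<Rightarrow>\<^sub>0 'b)"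
      "single_letters (w # ws) = (0 :: 'a list \<Rightarrow>\<^sub>0 'b)"
      by (auto simp: single_letters_def)
    then show ?thesis
      using 3 by (simp add: lin_add lin_psc lin_single_letters_mult pm.subspace_0[OF subspace_swap_relations])
  qed
qed

lemma iter_coprod_word_supp:
  "iter_coprod_word C p w \<in> supp {ws. length ws = p \<and> (\<Sum>u\<leftarrow>ws. length u) = length w}"
proof (induction w)
  case Nil
  then show ?case by (simp add: iter_coprod_word_Nil sum_list_replicate)
next
  case (Cons c w)
  have *: "diag_op_words C m ((*) (bas [c])) ws \<in>
      supp {vs. length vs = length ws \<and> (\<Sum>u\<leftarrow>vs. length u) = Suc (\<Sum>u\<leftarrow>ws. length u)}" for m ws
  proof (induction ws)
    case Nil
    then show ?case by (simp add: pm.subspace_0[OF subspace_supp])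
  next
    case (Cons u ws)
    have "bas [u] * diag_op_words C m ((*) (bas [c])) ws \<in>
        supp {vs. length vs = length (u # ws) \<and> (\<Sum>u\<leftarrow>vs. length u) = Suc (\<Sum>u\<leftarrow>u # ws. length u)}"
    proof (rule plin_in_subspace[of "\<lambda>t. bas [u] * t", OF _ subspace_supp])
      fix vs assume "vs \<in> Poly_Mapping.keys (diag_op_words C m ((*) (bas [c])) ws)"
      then show "bas [u] * bas vs \<in>
        supp {vs. length vs = length (u # ws) \<and> (\<Sum>u\<leftarrow>vs. length u) = Suc (\<Sum>u\<leftarrow>u # ws. length u)}"
        using Cons by (auto simp: supp_def)
    qed (intro plin_intros)
    then show ?case
      by (auto intro!: pm.subspace_add pm.subspace_scale subspace_supp)
  qed
  show ?case
    unfolding iter_coprod_word_Cons diag_op_def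
  proof (rule lin_in_subspace[OF subspace_supp])
    fix ws assume "ws \<in> Poly_Mapping.keys (iter_coprod_word C p w)"
    then have "length ws = p" "(\<Sum>u\<leftarrow>ws. length u) = length w" using Cons by (auto simp: supp_def)
    then show "diag_op_words C (wdeg C [c]) ((*) (bas [c])) ws \<in>
        supp {ws. length ws = p \<and> (\<Sum>u\<leftarrow>ws. length u) = length (c # w)}"
      using *[of "wdeg C [c]" ws] by simp
  qed
qed

lemma count_empty:
  "\<forall>w\<in>set ws. length w \<le> 1 \<Longrightarrow> length (filter (\<lambda>w. w = []) ws) + (\<Sum>w\<leftarrow>ws. length w) = length ws"
proof (induction ws)
  case (Cons w ws)
  then show ?case by (cases w) auto
qed simp

text \<open>A new letter finds as many empty factors as there are factors minus letters already
  placed, whence the falling factorial. The differences are formed in the field, so the product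
  vanishes when there are more letters than factors.\<close>

lemma single_letters_iter_coprod:
  "lin single_letters (iter_coprod_word C p w) -
     psc (\<Prod>i<length w. of_nat p - of_nat i) (bas w) \<in> swap_relations C (length w)"
proof (induction w)
  case Nil
  have "single_letters (replicate p []) = (bas [] :: 'a list \<Rightarrow>\<^sub>0 'b)"
    by (simp add: single_letters_def)
  then show ?case
    by (simp add: iter_coprod_word_Nil pm.subspace_0[OF subspace_swap_relations])
next
  case (Cons c w)
  let ?T = "iter_coprod_word C p w"
  let ?a = "of_nat p - of_nat (length w) :: 'b"
  have keys: "length ws = p" "(\<Sum>u\<leftarrow>ws. length u) = length w" if "ws \<in> Poly_Mapping.keys ?T" for ws
    using that iter_coprod_word_supp[of C p w] by (auto simp: supp_def)
  let ?E = "\<lambda>ws. psc (of_nat (length (filter (\<lambda>w. w = []) ws))) (bas [c] * single_letters ws) :: 'a list \<Rightarrow>\<^sub>0 'b"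
  have "lin (\<lambda>ws. lin single_letters (diag_op_words C (wdeg C [c]) ((*) (bas [c])) ws) - ?E ws) ?T
      \<in> swap_relations C (Suc (length w))"
    by (rule lin_in_subspace[OF subspace_swap_relations])
      (use keys single_letters_diag_op_words[of C c] in metis)
  moreover have "lin (\<lambda>ws. lin single_letters (diag_op_words C (wdeg C [c]) ((*) (bas [c])) ws) - ?E ws) ?T =
      lin single_letters (iter_coprod_word C p (c # w)) - lin ?E ?T"
    unfolding iter_coprod_word_Cons diag_op_def lin_lin
    by (simp add: lin_def sum_subtractf pm.scale_right_diff_distrib)
  moreover have "lin ?E ?T = psc ?a (bas [c] * lin single_letters ?T)"
  proof -
    have "lin ?E ?T = lin (\<lambda>ws. psc ?a (bas [c] * single_letters ws)) ?T"
    proof (rule lin_cong)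
      fix ws assume ws: "ws \<in> Poly_Mapping.keys ?T"
      show "?E ws = psc ?a (bas [c] * single_letters ws)"
      proof (cases "\<forall>w\<in>set ws. length w \<le> 1")
        case True
        then have "of_nat (length (filter (\<lambda>w. w = []) ws)) = ?a"
          using count_empty[OF True] keys[OF ws] by (metis add_diff_cancel_right' of_nat_add)
        then show ?thesis by simp
      next
        case False
        then have "single_letters ws = (0 :: 'a list \<Rightarrow>\<^sub>0 'b)" unfolding single_letters_def by (rule if_not_P)
        then show ?thesis by simp
      qed
    qed
    also have "\<dots> = psc ?a (bas [c] * lin single_letters ?T)"
      by (rule plin_lin_image[symmetric]) (intro plin_intros)
    finally show ?thesis .
  qed
  ultimately have 1: "lin single_letters (iter_coprod_word C p (c # w)) - psc ?a (bas [c] * lin single_letters ?T)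
      \<in> swap_relations C (Suc (length w))" by simp
  have 2: "bas [c] * (lin single_letters ?T - psc (\<Prod>i<length w. of_nat p - of_nat i) (bas w))
      \<in> swap_relations C (Suc (length w))"
    by (rule swap_relations_Cons[OF Cons])
  show ?case
    using pm.subspace_add[OF subspace_swap_relations 1 pm.subspace_scale[OF subspace_swap_relations 2, of ?a]]
    by (simp add: right_diff_distrib pm.scale_right_diff_distrib mult.commute)
qed

lemma prod_of_nat_diff: "(\<Prod>i<d. of_nat d - of_nat i :: 'k::field_char_0) = fact d"
proof -
  have "(\<Prod>i<d. of_nat d - of_nat i :: 'k) = (\<Prod>i<d. of_nat (d - i))"
    by (intro prod.cong) (auto simp: of_nat_diff)
  also have "\<dots> = of_nat (\<Prod>i<d. d - i)" by simp
  also have "(\<Prod>i<d. d - i) = \<Prod>{1..d}"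
    by (rule prod.reindex_bij_witness[of _ "\<lambda>i. d - i" "\<lambda>i. d - i"]) auto
  finally show ?thesis by (simp add: fact_prod)
qed

lemma tens_eq_0: "0 \<in> set xs \<Longrightarrow> tens xs = 0"
  by (induction xs) (auto simp: plin_0[OF plin_emb])

text \<open>Pigeonhole: nonempty lists with as many entries in total as there are lists must be
  singletons. Multiplying inside the places then amounts to forgetting the division into
  places.\<close>

lemma all_singletons:
  "[] \<notin> set ws \<Longrightarrow> length ws \<le> (\<Sum>w\<leftarrow>ws. length w) \<and>
    ((\<Sum>w\<leftarrow>ws. length w) = length ws \<longrightarrow> map concat ws = concat ws \<and> (\<forall>w\<in>set ws. length w \<le> 1))"
  for ws :: "'b list list list"
proof (induction ws)
  case (Cons w ws)
  then obtain a v where w: "w = a # v" by (cases w) auto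
  with Cons have IH: "length ws \<le> (\<Sum>w\<leftarrow>ws. length w)"
    "(\<Sum>w\<leftarrow>ws. length w) = length ws \<longrightarrow> map concat ws = concat ws \<and> (\<forall>w\<in>set ws. length w \<le> 1)"
    by auto
  show ?case
  proof (cases v)
    case Nil
    then show ?thesis using IH w by auto
  qed (use IH w in auto)
qed simp

text \<open>The product of \<open>s = perm_sum C t\<close> vanishes, hence so does its
  \<open>d\<close>-fold coproduct; applying the projection in each factor recovers
  \<open>d! s\<close> modulo the symmetry relations, and \<open>s\<close> is congruent to
  \<open>d! t\<close>. Characteristic 0 allows the division by factorials.\<close>

lemma symmetrize_eq_0:
  fixes C :: "('b, 'k::field_char_0) dgcoalg"
  assumes t: "t \<in> lie_power C d" and "symmetrize C t = 0"
  shows "t \<in> pm.span (sym_relations C d)"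
proof -
  obtain e where e: "plin e" "\<And>w. e (bas w) \<in> cobar_lie_grd C (wdeg C w)"
    "\<And>x. x \<in> cobar_lie C \<Longrightarrow> e x = x" "e (bas []) = 0"
    using lie_projection_exists[of C] by blast
  define E where "E = lin (\<lambda>ws. tens (map (\<lambda>w. e (bas w)) ws))"
  have pE: "plin E" by (simp add: E_def plin_lin)
  have E_mult: "E (emb x * s) = emb (e x) * E s" for x s
  proof (rule plin_eqI[of "\<lambda>x. E (emb x * s)"])
    fix w
    show "E (emb (bas w) * s) = emb (e (bas w)) * E s"
      by (rule plin_eqI[of "\<lambda>s. E (emb (bas w) * s)"])
        (simp add: E_def | intro plin_intros plin_comp[OF pE] pE)+
  qed (intro plin_intros plin_comp[OF pE] plin_comp[OF plin_emb e(1)] plin_emb)+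
  have E_tens: "E (tens xs) = tens xs" if "set xs \<subseteq> cobar_lie C" for xs
    using that by (induction xs) (simp_all add: E_mult e(3), simp add: E_def)
  have E_id: "E s = s" if "s \<in> lie_power C d" for s
    using lie_power_induct[OF that subspace_ker[OF pE plin_id]] E_tens[OF lie_monos_cobar_lie] by simp
  \<comment> \<open>The projection preserves degrees, so the sign of a relation between words is
    also the right one for their images.\<close>
  have E_swap: "E r \<in> pm.span (sym_relations C d)" if "r \<in> swap_relations (lift C) d" for r
  proof -
    have "r \<in> {r. E r \<in> pm.span (sym_relations C d)}"
    proof (rule span_induct_mem[OF that[unfolded swap_relations_def]])
      fix r :: "'b list list \<Rightarrow>\<^sub>0 'k"
      assume "r \<in> {bas (u @ [x, y] @ v) - psc (ksign (wdeg (lift C) [x]) (wdeg (lift C) [y]))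
        (bas (u @ [y, x] @ v)) | u x y v. length (u @ [x, y] @ v) = d}"
      then obtain u x y v where r: "r = bas (u @ [x, y] @ v) -
          psc (ksign (wdeg C x) (wdeg C y)) (bas (u @ [y, x] @ v))" "length (u @ [x, y] @ v) = d"
        by auto
      let ?e = "map (\<lambda>w. e (bas w))"
      have Er: "E r = tens (?e u @ [e (bas x), e (bas y)] @ ?e v) -
          psc ((-1) powi (wdeg C x * wdeg C y)) (tens (?e u @ [e (bas y), e (bas x)] @ ?e v))"
        by (simp add: r E_def lin_diff lin_psc ksign_def)
      have sub: "set (?e u) \<subseteq> cobar_lie C" "set (?e v) \<subseteq> cobar_lie C"
        using e(2) by (auto simp: cobar_lie_grd_iff)
      have len': "length (?e u @ [e (bas x), e (bas y)] @ ?e v) = d" using r(2) by simp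
      have "E r \<in> sym_relations C d"
        unfolding sym_relations_def by (intro CollectI exI conjI, rule Er) (rule sub e(2) len')+
      then show "r \<in> {r. E r \<in> pm.span (sym_relations C d)}" by (simp add: pm.span_base)
    qed (rule subspace_vimage[OF pE pm.subspace_span])
    then show ?thesis by simp
  qed
  define s where "s = perm_sum C t"
  have s: "s \<in> lie_power C d" using perm_sum_in_lie_power[OF t] by (simp add: s_def)
  let ?T = "iter_coprod (lift C) d s"
  have len: "length ws = d" if "ws \<in> Poly_Mapping.keys s" for ws
    using that lie_power_length[OF s] by (auto simp: supp_def)
  have "iter_prod s = 0"
    using assms(2) by (simp add: symmetrize_eq_perm_sum[OF t] s_def)
  then have "E (map_concat ?T) = 0"
    by (simp add: plin_0[OF pE] plin_0[OF plin_iter_coprod] flip: iter_coprod_iter_prod[OF s])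
  \<comment> \<open>Terms with an empty place vanish on the left because \<open>e\<close> kills the
    unit, and on the right because some other place is then overfull. In all other terms every place
    holds exactly one factor.\<close>
  moreover have "E (map_concat ?T) = E (lin single_letters ?T)"
  proof (rule plin_eqI[of "\<lambda>T. E (map_concat T)"])
    show "plin (\<lambda>T. E (map_concat T))" "plin (\<lambda>T. E (lin single_letters T))"
      by (intro plin_comp[OF pE] plin_map_concat plin_lin)+
    have "?T \<in> supp {wss. length wss = d \<and> (\<Sum>ws\<leftarrow>wss. length ws) = d}"
      unfolding iter_coprod_def
    proof (rule lin_in_subspace[OF subspace_supp])
      fix ws assume "ws \<in> Poly_Mapping.keys s"
      then show "iter_coprod_word (lift C) d ws \<in> supp {wss. length wss = d \<and> (\<Sum>ws\<leftarrow>wss. length ws) = d}"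
        using iter_coprod_word_supp[of "lift C" d ws] len[of ws] by simp
    qed
    then have T: "length wss = d" "(\<Sum>ws\<leftarrow>wss. length ws) = d" if "wss \<in> Poly_Mapping.keys ?T" for wss
      using that by (auto simp: supp_def)
    fix wss assume wss: "wss \<in> Poly_Mapping.keys ?T"
    show "E (map_concat (bas wss)) = E (lin single_letters (bas wss))"
    proof (cases "[] \<in> set wss")
      case True
      then have "E (map_concat (bas wss)) = 0"
        using e(4) by (auto simp: E_def intro!: tens_eq_0 image_eqI[of _ _ "[]"])
      moreover have "\<not> (\<forall>ws\<in>set wss. length ws \<le> 1)"
        using count_empty[of wss] T[OF wss] True by (auto simp: filter_empty_conv)
      then have "single_letters wss = (0 :: 'b list list \<Rightarrow>\<^sub>0 'k)"
        unfolding single_letters_def by (rule if_not_P)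
      ultimately show ?thesis by (simp add: plin_0[OF pE] del: map_concat_bas)
    next
      case False
      then show ?thesis
        using all_singletons[of wss] T[OF wss] by (simp add: single_letters_def)
    qed
  qed
  moreover have "E (lin single_letters ?T) - psc (fact d) (E s) \<in> pm.span (sym_relations C d)"
  proof -
    have "s \<in> {s. E (lin single_letters (iter_coprod (lift C) d s)) - psc (fact d) (E s) \<in> pm.span (sym_relations C d)}"
    proof (rule plin_in_subspace[of "\<lambda>s. s"])
      show "pm.subspace {s. E (lin single_letters (iter_coprod (lift C) d s)) - psc (fact d) (E s) \<in> pm.span (sym_relations C d)}"
        by (intro subspace_vimage pm.subspace_span plin_minus plin_scale pE plin_comp[OF pE]
            plin_lin_comp plin_iter_coprod)
      fix ws assume "ws \<in> Poly_Mapping.keys s"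
      then have "lin single_letters (iter_coprod_word (lift C) d ws) - psc (fact d) (bas ws)
          \<in> swap_relations (lift C) d"
        using single_letters_iter_coprod[of "lift C" d ws] len by (simp add: prod_of_nat_diff)
      from E_swap[OF this]
      show "bas ws \<in> {s. E (lin single_letters (iter_coprod (lift C) d s)) - psc (fact d) (E s)
          \<in> pm.span (sym_relations C d)}"
        by (simp add: plin_diff[OF pE] plin_psc[OF pE] iter_coprod_bas)
    qed (rule plin_id)
    then show ?thesis by simp
  qed
  ultimately have "- psc (fact d) s \<in> pm.span (sym_relations C d)"
    by (simp add: E_id[OF s])
  from pm.span_scale[OF this, of "- 1 / fact d"] have "s \<in> pm.span (sym_relations C d)"
    by simp
  \<comment> \<open>The congruence between \<open>s\<close> and \<open>d! t\<close> carries the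
    membership over to \<open>t\<close>.\<close>
  then have "s - (s - psc (fact d) t) \<in> pm.span (sym_relations C d)"
    using perm_sum_minus_fact[OF t] unfolding s_def by (rule pm.span_diff)
  from pm.span_scale[OF this, of "1 / fact d"] show ?thesis by simp
qed

section \<open>Commutators and the relations of the coinvariants\<close>

lemma gcomm_one: "gcomm C (bas []) x = 0"
proof (rule plin_eqI[OF plin_gcomm_right plin_zero])
  show "gcomm C (bas []) (bas w) = 0" for w
    by (simp add: gcomm_ksign)
qed

text \<open>The identity \<open>[c u, v] = [c, u v] +- [u, v c]\<close> strips the letters of the
  first argument one at a time. Bracketing with a letter is a derivation preserving the Lie
  elements, so the remaining generators are accessible to \<open>psi_derivation\<close>.\<close>

lemma rel_cobar_natural:
  "rel (cobar_natural C) =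
    pm.span (insert (bas []) {gcomm C (bas [c]) x | c x. c \<noteq> coaug C \<and> x \<in> cobar C})"
  (is "_ = pm.span ?B")
proof
  have word: "gcomm C (bas u) (bas v) \<in> pm.span ?B" if "coaug C \<notin> set u" "coaug C \<notin> set v" for u v
    using that
  proof (induction u arbitrary: v)
    case Nil
    then show ?case by (simp add: gcomm_one pm.span_zero)
  next
    case (Cons c u)
    let ?s = "ksign (wdeg C [c]) (wdeg C u + wdeg C v) :: 'b"
    have w: "wdeg C (c # u) = wdeg C [c] + wdeg C u" by (simp add: wdeg_Cons)
    have w': "wdeg C (v @ [c]) = wdeg C [c] + wdeg C v" by simp
    have "gcomm C (bas (c # u)) (bas v) =
        gcomm C (bas [c]) (bas (u @ v)) + psc ?s (gcomm C (bas u) (bas (v @ [c])))"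
      unfolding gcomm_ksign lin_bas w w' wdeg_append ksign_add_left ksign_add_right
      by (simp add: pm.scale_right_diff_distrib ksign_commute[of "wdeg C u" "wdeg C [c]"] mult_ac)
    moreover have "gcomm C (bas [c]) (bas (u @ v)) \<in> pm.span ?B"
      by (intro pm.span_base insertI2 CollectI exI conjI) (rule refl, use Cons.prems in auto)
    moreover have "gcomm C (bas u) (bas (v @ [c])) \<in> pm.span ?B"
      using Cons by auto
    ultimately show ?case by (auto intro: pm.span_add pm.span_scale)
  qed
  have "gcomm C x y \<in> pm.span ?B" if x: "x \<in> cobar C" and y: "y \<in> cobar C" for x y
  proof -
    have "x \<in> {x. gcomm C x y \<in> pm.span ?B}"
    proof (rule cobar_induct[OF x subspace_vimage[OF plin_gcomm_left pm.subspace_span]])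
      fix u assume u: "coaug C \<notin> set u"
      have "y \<in> {y. gcomm C (bas u) y \<in> pm.span ?B}"
        by (rule cobar_induct[OF y subspace_vimage[OF plin_gcomm_right pm.subspace_span]])
          (use word u in auto)
      then show "bas u \<in> {x. gcomm C x y \<in> pm.span ?B}" by simp
    qed
    then show ?thesis by simp
  qed
  then show "rel (cobar_natural C) \<subseteq> pm.span ?B"
    unfolding cobar_natural_def qcomplex.simps one_eq_bas
    by (intro pm.span_minimal pm.subspace_span) (auto intro: pm.span_base)
  show "pm.span ?B \<subseteq> rel (cobar_natural C)"
    unfolding cobar_natural_def qcomplex.simps one_eq_bas
  proof (intro pm.span_mono insert_mono subsetI)
    fix z assume "z \<in> {gcomm C (bas [c]) x | c x. c \<noteq> coaug C \<and> x \<in> cobar C}"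
    then obtain c x where "z = gcomm C (bas [c]) x" "c \<noteq> coaug C" "x \<in> cobar C" by auto
    then show "z \<in> {gcomm C x y | x y. x \<in> cobar C \<and> y \<in> cobar C}"
      by (intro CollectI exI[of _ "bas [c]"] exI[of _ x]) simp
  qed
qed

lemma subspace_rel_natural: "pm.subspace (rel (cobar_natural C))"
  unfolding rel_cobar_natural by (rule pm.subspace_span)

lemma bas_Nil_rel: "bas [] \<in> rel (cobar_natural C)"
  unfolding rel_cobar_natural by (intro pm.span_base insertI1)

lemma gcomm_rel: "x \<in> cobar C \<Longrightarrow> y \<in> cobar C \<Longrightarrow> gcomm C x y \<in> rel (cobar_natural C)"
  unfolding cobar_natural_def qcomplex.simps by (rule pm.span_base) auto

section \<open>Stability of graded pieces and relations under the Adams operations\<close>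

lemma subspace_cobar_grd: "pm.subspace (cobar_grd C n)"
proof -
  have "cobar_grd C n = cobar C \<inter> supp {w. wdeg C w = n}"
    by (auto simp: cobar_grd_def supp_def)
  then show ?thesis by (simp add: pm.subspace_inter subspace_cobar subspace_supp)
qed

lemma subspace_lie_power_grd: "pm.subspace (lie_power_grd C d n)"
proof -
  have "lie_power_grd C d n = lie_power C d \<inter> supp {ws. wdeg (lift C) ws = n}"
    by (auto simp: lie_power_grd_def supp_def wdeg_lift)
  then show ?thesis by (simp add: pm.subspace_inter subspace_lie_power subspace_supp)
qed

lemma psi_in_cobar_grd:
  fixes C :: "('b, 'k::field_char_0) dgcoalg"
  assumes "x \<in> cobar_grd C n"
  shows "psi C p x \<in> cobar_grd C n"
proof -
  obtain J t where J: "finite J" "\<forall>j. t j \<in> lie_power_grd C j n" "x = (\<Sum>j\<in>J. symmetrize C (t j))"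
    using cobar_grd_decomposition[OF assms] by auto
  have "psi C p (symmetrize C (t j)) \<in> cobar_grd C n" for j
  proof -
    have "t j \<in> lie_power_grd C j n" using J(2) by simp
    then show ?thesis
      using symmetrize_grd[of "t j" C j n] psi_symmetrize[of "t j" C j p]
      by (simp add: lie_power_grd_iff pm.subspace_scale[OF subspace_cobar_grd])
  qed
  then show ?thesis
    unfolding J(3) plin_sum[OF plin_psi] by (intro pm.subspace_sum[OF subspace_cobar_grd])
qed

lemma psi_in_cobar:
  fixes C :: "('b, 'k::field_char_0) dgcoalg"
  assumes "x \<in> cobar C"
  shows "psi C p x \<in> cobar C"
proof (rule plin_in_subspace[OF plin_psi subspace_cobar])
  fix w assume "w \<in> Poly_Mapping.keys x"
  then have "bas w \<in> cobar_grd C (wdeg C w)"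
    using assms by (auto simp: hom_cobar_grd cobar_def)
  then show "psi C p (bas w) \<in> cobar C"
    using psi_in_cobar_grd[of "bas w" C _ p] by (auto simp: hom_cobar_grd)
qed

lemma symmetrize_Nil: "symmetrize C (bas []) = bas []"
  by (simp add: symmetrize_def symmetrize_words_eq)

lemma bas_Nil_lie_power: "bas [] \<in> lie_power C 0"
  using tens_in_lie_power[of "[]" C] by simp

lemma psi_rel:
  fixes C :: "('b, 'k::field_char_0) dgcoalg"
  assumes "x \<in> rel (cobar_natural C)"
  shows "psi C p x \<in> rel (cobar_natural C)"
proof -
  have "x \<in> {x. psi C p x \<in> rel (cobar_natural C)}"
  proof (rule span_induct_mem[OF assms[unfolded rel_cobar_natural] subspace_vimage[OF plin_psi subspace_rel_natural]])
    fix x assume "x \<in> insert (bas []) {gcomm C (bas [c]) x | c x. c \<noteq> coaug C \<and> x \<in> cobar C}"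
    then consider "x = bas []" | c y where "x = gcomm C (bas [c]) y" "c \<noteq> coaug C" "y \<in> cobar C"
      by blast
    then show "x \<in> {x. psi C p x \<in> rel (cobar_natural C)}"
    proof cases
      case 1
      have "psi C p (bas []) = bas []"
        using psi_symmetrize[OF bas_Nil_lie_power, of C p] by (simp add: symmetrize_Nil)
      then show ?thesis using 1 bas_Nil_rel by simp
    next
      case 2
      have "psi C p x = gcomm C (bas [c]) (psi C p y)"
        unfolding 2(1)
        by (rule psi_derivation[OF lie_derivation_gcomm[OF lie_mono.letter[OF 2(2)]] 2(3)])
      also have "\<dots> \<in> rel (cobar_natural C)"
        by (rule gcomm_rel[OF _ psi_in_cobar[OF 2(3)]]) (use 2(2) in simp)
      finally show ?thesis by simp
    qed
  qed
  then show ?thesis by simp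
qed

lemma sym_relations_lie_power: "r \<in> sym_relations C d \<Longrightarrow> r \<in> lie_power C d"
proof -
  assume "r \<in> sym_relations C d"
  then obtain xs x y ys m n where
    r: "r = tens (xs @ [x, y] @ ys) - psc ((-1) powi (m * n)) (tens (xs @ [y, x] @ ys))"
    and *: "length (xs @ [x, y] @ ys) = d" "set xs \<subseteq> cobar_lie C" "set ys \<subseteq> cobar_lie C"
    "x \<in> cobar_lie_grd C m" "y \<in> cobar_lie_grd C n"
    by (auto simp: sym_relations_def)
  have "tens (xs @ [x, y] @ ys) \<in> lie_power C d" "tens (xs @ [y, x] @ ys) \<in> lie_power C d"
    using * tens_in_lie_power[of "xs @ [x, y] @ ys" C] tens_in_lie_power[of "xs @ [y, x] @ ys" C]
    by (auto simp: cobar_lie_grd_iff)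
  then show ?thesis
    unfolding r by (intro pm.subspace_diff pm.subspace_scale subspace_lie_power)
qed

lemma rel_sym_coinvariants: "rel (sym_coinvariants C d) =
    pm.span (sym_relations C d \<union> {ad_action C x t | x t. x \<in> cobar_lie C \<and> t \<in> lie_power C d})"
  by (simp add: sym_coinvariants_def)

lemma subspace_rel_sym: "pm.subspace (rel (sym_coinvariants C d))"
  unfolding rel_sym_coinvariants by (rule pm.subspace_span)

lemma symmetrize_rel:
  assumes "t \<in> rel (sym_coinvariants C d)"
  shows "symmetrize C t \<in> rel (cobar_natural C)"
proof -
  have "t \<in> {t. symmetrize C t \<in> rel (cobar_natural C)}"
  proof (rule span_induct_mem[OF assms[unfolded rel_sym_coinvariants]
        subspace_vimage[OF plin_symmetrize subspace_rel_natural]])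
    fix r assume "r \<in> sym_relations C d \<union> {ad_action C x t | x t. x \<in> cobar_lie C \<and> t \<in> lie_power C d}"
    then consider "r \<in> sym_relations C d"
      | x t where "r = ad_action C x t" "x \<in> cobar_lie C" "t \<in> lie_power C d" by blast
    then show "r \<in> {t. symmetrize C t \<in> rel (cobar_natural C)}"
    proof cases
      case 1
      then have "symmetrize C r = 0"
        by (intro symmetrize_sym_relations[OF sym_relations_lie_power]) (auto intro: pm.span_base)
      then show ?thesis using pm.subspace_0[OF subspace_rel_natural] by simp
    next
      case 2
      then show ?thesis
        using gcomm_rel[OF cobar_lie_subset symmetrize_in_cobar] by (simp add: ad_action_lie_power(2))
    qed
  qed
  then show ?thesis by simp
qed

text \<open>\<open>t\<close> is regarded as a family concentrated in index \<open>d\<close>, so that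
  the difference becomes one sum over \<open>insert d J\<close> to which the separation of
  eigenvalues applies.\<close>

lemma component_mem:
  fixes C :: "('b, 'k::field_char_0) dgcoalg"
  assumes R: "pm.subspace R" "\<And>x. x \<in> R \<Longrightarrow> psi C 2 x \<in> R"
    and "finite J" "\<forall>j. u j \<in> lie_power C j" "t \<in> lie_power C d"
    and mem: "symmetrize C t - (\<Sum>j\<in>J. symmetrize C (u j)) \<in> R"
  shows "symmetrize C (t - (if d \<in> J then u d else 0)) \<in> R"
proof -
  let ?S = "symmetrize C"
  define v where "v j = (if j = d then t else 0) - (if j \<in> J then u j else 0)" for j
  have v: "\<forall>j\<in>insert d J. v j \<in> lie_power C j"
    using assms(4,5) by (auto simp: v_def intro!: pm.subspace_diff pm.subspace_neg pm.subspace_0 subspace_lie_power)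
  have "(\<Sum>j\<in>insert d J. ?S (v j)) =
      (\<Sum>j\<in>insert d J. if j = d then ?S t else 0) - (\<Sum>j\<in>insert d J. if j \<in> J then ?S (u j) else 0)"
    unfolding sum_subtractf[symmetric]
    by (intro sum.cong) (auto simp: v_def plin_diff[OF plin_symmetrize] plin_0[OF plin_symmetrize])
  also have "(\<Sum>j\<in>insert d J. if j = d then ?S t else 0) = ?S t"
    using assms(3) by simp
  also have "(\<Sum>j\<in>insert d J. if j \<in> J then ?S (u j) else 0) = (\<Sum>j\<in>J. ?S (u j))"
    using assms(3) by (intro sum.mono_neutral_cong_right) auto
  finally have "(\<Sum>j\<in>insert d J. ?S (v j)) \<in> R" using mem by simp
  then have "?S (v d) \<in> R"
    using sum_symmetrize_mem[OF R, of "insert d J" v] assms(3) v by simp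
  then show ?thesis by (simp add: v_def)
qed

lemma rel_decomposition:
  fixes C :: "('b, 'k::field_char_0) dgcoalg"
  assumes "x \<in> rel (cobar_natural C)"
  shows "\<exists>J u. finite J \<and> (\<forall>j. u j \<in> lie_power C j) \<and>
    (\<forall>j>0. u j \<in> rel (sym_coinvariants C j)) \<and> x = (\<Sum>j\<in>J. symmetrize C (u j))"
proof -
  define A where "A j = (if j = 0 then lie_power C 0 else lie_power C j \<inter> rel (sym_coinvariants C j))" for j
  have A: "pm.subspace (A j)" for j
    by (simp add: A_def pm.subspace_inter subspace_lie_power subspace_rel_sym)
  have "x \<in> pm.span (\<Union>j. symmetrize C ` A j)"
  proof (rule span_induct_mem[OF assms[unfolded rel_cobar_natural] pm.subspace_span])
    fix y assume "y \<in> insert (bas []) {gcomm C (bas [c]) x | c x. c \<noteq> coaug C \<and> x \<in> cobar C}"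
    then consider "y = bas []" | c z where "y = gcomm C (bas [c]) z" "c \<noteq> coaug C" "z \<in> cobar C"
      by blast
    then show "y \<in> pm.span (\<Union>j. symmetrize C ` A j)"
    proof cases
      case 1
      have "symmetrize C (bas []) \<in> symmetrize C ` A 0"
        unfolding A_def using bas_Nil_lie_power[of C] by (simp only: if_P refl) (rule imageI)
      then show ?thesis using 1 unfolding symmetrize_Nil by (intro pm.span_base) auto
    next
      case 2
      obtain J t where J: "finite J" "\<forall>j. t j \<in> lie_power C j" "z = (\<Sum>j\<in>J. symmetrize C (t j))"
        using cobar_decomposition[OF 2(3)] by auto
      have c: "bas [c] \<in> cobar_lie C" using 2(2) by (rule cobar_lie.letter)
      have "gcomm C (bas [c]) (symmetrize C (t j)) \<in> pm.span (\<Union>j. symmetrize C ` A j)" for j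
      proof -
        have t: "t j \<in> lie_power C j" using J(2) by simp
        have "ad_action C (bas [c]) (t j) \<in> A j"
          unfolding A_def rel_sym_coinvariants
          using ad_action_lie_power(1)[OF c t] c t by (auto intro: pm.span_base)
        then show ?thesis
          unfolding ad_action_lie_power(2)[OF c t, symmetric] by (intro pm.span_base) blast
      qed
      then show ?thesis
        unfolding 2(1) J(3) plin_sum[OF plin_gcomm_right] by (intro pm.span_sum)
    qed
  qed
  from span_UN_sum[OF this subspace_image[OF plin_symmetrize A]]
  obtain J g where J: "finite J" "\<forall>j. g j \<in> symmetrize C ` A j" "x = (\<Sum>j\<in>J. g j)"
    by (elim exE conjE)
  then have "\<forall>j. \<exists>u. u \<in> A j \<and> g j = symmetrize C u" by (simp add: image_iff Bex_def)
  then obtain u where u: "\<forall>j. u j \<in> A j \<and> g j = symmetrize C (u j)"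
    by (rule choice[THEN exE])
  have "u j \<in> lie_power C j" "j > 0 \<Longrightarrow> u j \<in> rel (sym_coinvariants C j)" for j
    using u[rule_format, of j] by (auto simp: A_def split: if_splits)
  then show ?thesis using J u by (intro exI[of _ J] exI[of _ u]) simp
qed

text \<open>The component of index \<open>d\<close> of a relation comes from the coinvariants, and
  the difference to \<open>t\<close> lies in the kernel of symmetrization. Positivity of
  \<open>d\<close> matters: the unit is a relation of the natural quotient, while
  \<open>bas []\<close> is not one of the coinvariants in order 0.\<close>

lemma rel_of_symmetrize_rel:
  fixes C :: "('b, 'k::field_char_0) dgcoalg"
  assumes t: "t \<in> lie_power C d" and d: "d > 0" and "symmetrize C t \<in> rel (cobar_natural C)"
  shows "t \<in> rel (sym_coinvariants C d)"
proof -
  obtain J u where J: "finite J" "\<forall>j. u j \<in> lie_power C j" "\<forall>j>0. u j \<in> rel (sym_coinvariants C j)"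
    "symmetrize C t = (\<Sum>j\<in>J. symmetrize C (u j))"
    using rel_decomposition[OF assms(3)] by auto
  let ?u = "if d \<in> J then u d else 0"
  \<comment> \<open>The eigenvalues are separated inside the zero subspace.\<close>
  have "symmetrize C (t - ?u) \<in> {0}"
    by (rule component_mem[OF _ _ J(1,2) t]) (use J in \<open>auto simp: plin_0[OF plin_psi]\<close>)
  moreover have "?u \<in> lie_power C d" "?u \<in> rel (sym_coinvariants C d)"
    using J d pm.subspace_0[OF subspace_lie_power] pm.subspace_0[OF subspace_rel_sym] by auto
  ultimately have "t - ?u \<in> pm.span (sym_relations C d)"
    using t by (intro symmetrize_eq_0) (auto intro: pm.subspace_diff subspace_lie_power)
  then have "t - ?u \<in> rel (sym_coinvariants C d)"
    unfolding rel_sym_coinvariants using pm.span_mono by blast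
  from pm.subspace_add[OF subspace_rel_sym this \<open>?u \<in> rel (sym_coinvariants C d)\<close>]
  show ?thesis by simp
qed

section \<open>Passage to homology\<close>

definition linear_qcomplex :: "('x \<Rightarrow>\<^sub>0 'k::field) qcomplex \<Rightarrow> bool"
  where "linear_qcomplex X \<longleftrightarrow> (\<forall>n. pm.subspace (grd X n)) \<and> pm.subspace (rel X) \<and> plin (dif X)"

lemma subspace_bdr:
  assumes "linear_qcomplex X"
  shows "pm.subspace (bdr X n)"
proof -
  have G: "pm.subspace (grd X k)" for k using assms by (simp add: linear_qcomplex_def)
  have R: "pm.subspace (rel X)" and D: "plin (dif X)"
    using assms by (auto simp: linear_qcomplex_def)
  show ?thesis
  proof (rule pm.subspaceI)
    show "0 \<in> bdr X n"
      using pm.subspace_0[OF G] pm.subspace_0[OF R] plin_0[OF D] by (force simp: bdr_def)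
  next
    fix x y assume "x \<in> bdr X n" "y \<in> bdr X n"
    then obtain x' y' where *: "x \<in> grd X n" "y \<in> grd X n" "x' \<in> grd X (n + 1)" "y' \<in> grd X (n + 1)"
      "x - dif X x' \<in> rel X" "y - dif X y' \<in> rel X" by (auto simp: bdr_def)
    have "(x + y) - dif X (x' + y') = (x - dif X x') + (y - dif X y')"
      by (simp add: plin_add[OF D])
    also have "\<dots> \<in> rel X" by (intro pm.subspace_add[OF R] *)
    finally show "x + y \<in> bdr X n"
      using * pm.subspace_add[OF G] by (auto simp: bdr_def)
  next
    fix c x assume "x \<in> bdr X n"
    then obtain x' where *: "x \<in> grd X n" "x' \<in> grd X (n + 1)" "x - dif X x' \<in> rel X"
      by (auto simp: bdr_def)
    have "psc c x - dif X (psc c x') = psc c (x - dif X x')"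
      by (simp add: plin_psc[OF D] pm.scale_right_diff_distrib)
    also have "\<dots> \<in> rel X" by (intro pm.subspace_scale[OF R] *)
    finally show "psc c x \<in> bdr X n"
      using * pm.subspace_scale[OF G] by (auto simp: bdr_def)
  qed
qed

lemma hclass_eq_iff:
  assumes "linear_qcomplex X"
  shows "hclass X n x = hclass X n y \<longleftrightarrow> x - y \<in> bdr X n"
proof
  assume "hclass X n x = hclass X n y"
  moreover have "x \<in> hclass X n x"
    using pm.subspace_0[OF subspace_bdr[OF assms]] by (simp add: hclass_def)
  ultimately show "x - y \<in> bdr X n" by (simp add: hclass_def)
next
  assume *: "x - y \<in> bdr X n"
  note B = subspace_bdr[OF assms, of n]
  have "z - x \<in> bdr X n \<longleftrightarrow> z - y \<in> bdr X n" for z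
    using pm.subspace_add[OF B _ *, of "z - x"] pm.subspace_diff[OF B _ *, of "z - y"] by auto
  then show "hclass X n x = hclass X n y" by (simp add: hclass_def)
qed

text \<open>The maps in question are linear on the whole ambient free space, so linearity is asked
  there, and compatibility with the differentials on the graded pieces.\<close>

definition linear_chain_map ::
  "(('x \<Rightarrow>\<^sub>0 'k::field) \<Rightarrow> 'y \<Rightarrow>\<^sub>0 'k) \<Rightarrow> ('x \<Rightarrow>\<^sub>0 'k) qcomplex \<Rightarrow> ('y \<Rightarrow>\<^sub>0 'k) qcomplex \<Rightarrow> bool"
  where "linear_chain_map F X Y \<longleftrightarrow> plin F \<and> (\<forall>n. F ` grd X n \<subseteq> grd Y n) \<and> F ` rel X \<subseteq> rel Y \<and>
    (\<forall>n. \<forall>x\<in>grd X n. F (dif X x) - dif Y (F x) \<in> rel Y)"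

lemma linear_chain_map_bdr:
  assumes "linear_qcomplex Y" "linear_chain_map F X Y" "x \<in> bdr X n"
  shows "F x \<in> bdr Y n"
proof -
  have R: "pm.subspace (rel Y)" using assms by (simp add: linear_qcomplex_def)
  have F: "plin F" using assms by (simp add: linear_chain_map_def)
  obtain y where y: "x \<in> grd X n" "y \<in> grd X (n + 1)" "x - dif X y \<in> rel X"
    using assms(3) by (auto simp: bdr_def)
  have "F x - dif Y (F y) = F (x - dif X y) + (F (dif X y) - dif Y (F y))"
    by (simp add: plin_diff[OF F])
  also have "\<dots> \<in> rel Y"
    using assms(2) y by (intro pm.subspace_add[OF R]) (auto simp: linear_chain_map_def)
  finally show ?thesis
    using assms(2) y by (auto simp: bdr_def linear_chain_map_def)
qed

lemma linear_chain_map_cyc: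
  assumes "linear_qcomplex Y" "linear_chain_map F X Y" "x \<in> cyc X n"
  shows "F x \<in> cyc Y n"
proof -
  have R: "pm.subspace (rel Y)" using assms by (simp add: linear_qcomplex_def)
  have x: "x \<in> grd X n" "F (dif X x) \<in> rel Y" "F (dif X x) - dif Y (F x) \<in> rel Y" "F x \<in> grd Y n"
    using assms by (auto simp: linear_chain_map_def cyc_def)
  have "dif Y (F x) = F (dif X x) - (F (dif X x) - dif Y (F x))" by simp
  then show ?thesis
    using pm.subspace_diff[OF R x(2,3)] x(4) by (simp add: cyc_def)
qed

text \<open>The union over representatives in \<open>hmap\<close> collapses, because all of them
  give the same class and \<open>hclass\<close> is nonempty.\<close>

lemma hmap_hclass:
  assumes "linear_qcomplex X" "linear_qcomplex Y" "linear_chain_map F X Y"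
  shows "hmap F Y n (hclass X n x) = hclass Y n (F x)"
proof -
  have F: "plin F" using assms by (simp add: linear_chain_map_def)
  have *: "hclass Y n (F y) = hclass Y n (F x)" if "y \<in> hclass X n x" for y
    using linear_chain_map_bdr[OF assms(2,3), of "y - x" n] that
    unfolding hclass_eq_iff[OF assms(2)] by (simp add: hclass_def plin_diff[OF F])
  have "x \<in> hclass X n x"
    using pm.subspace_0[OF subspace_bdr[OF assms(1)]] by (simp add: hclass_def)
  then have "hclass X n x \<noteq> {}" by auto
  have "hmap F Y n (hclass X n x) = (\<Union>y\<in>hclass X n x. hclass Y n (F x))"
    unfolding hmap_def by (rule SUP_cong[OF refl *])
  also have "\<dots> = hclass Y n (F x)"
    unfolding UN_constant using \<open>hclass X n x \<noteq> {}\<close> by (rule if_not_P)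
  finally show ?thesis .
qed

context
  fixes C :: "('b, 'k::field_char_0) dgcoalg"
  assumes dg: "dg_coalgebra C" and coc: "cocommutative C"
begin

lemma natural_simps [simp]:
  "grd (cobar_natural C) = cobar_grd C" "dif (cobar_natural C) = cobar_diff C"
  by (simp_all add: cobar_natural_def)

lemma sym_simps [simp]:
  "grd (sym_coinvariants C d) = lie_power_grd C d" "dif (sym_coinvariants C d) = tensor_diff C"
  by (simp_all add: sym_coinvariants_def)

lemma cobar_grd_cobar: "x \<in> cobar_grd C n \<Longrightarrow> x \<in> cobar C"
  by (simp add: hom_cobar_grd)

lemma linear_natural: "linear_qcomplex (cobar_natural C)"
  by (simp add: linear_qcomplex_def subspace_cobar_grd subspace_rel_natural plin_cobar_diff)

lemma linear_sym: "linear_qcomplex (sym_coinvariants C d)"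
  by (simp add: linear_qcomplex_def subspace_lie_power_grd subspace_rel_sym tensor_diff_eq_diag_op plin_diag_op)

lemma total_natural: "total psc (cobar_natural C) = cobar C"
proof
  show "total psc (cobar_natural C) \<subseteq> cobar C"
    unfolding total_def by (rule pm.span_minimal[OF _ subspace_cobar]) (auto simp: hom_cobar_grd)
  have "bas w \<in> total psc (cobar_natural C)" if "coaug C \<notin> set w" for w
    unfolding total_def by (rule pm.span_base) (use that in \<open>auto simp: hom_cobar_grd\<close>)
  then show "cobar C \<subseteq> total psc (cobar_natural C)"
    using cobar_induct[of _ C "total psc (cobar_natural C)"] by (auto simp: total_def)
qed

lemma total_sym: "total psc (sym_coinvariants C d) = lie_power C d"
proof
  show "total psc (sym_coinvariants C d) \<subseteq> lie_power C d"
    unfolding total_def by (rule pm.span_minimal[OF _ subspace_lie_power]) (auto simp: lie_power_grd_iff)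
  have "tens xs \<in> total psc (sym_coinvariants C d)" if xs: "length xs = d" "lie_monos C xs" for xs
  proof -
    obtain n where "hom (lift C) n (tens xs)" using hom_tens[OF xs(2)] by auto
    moreover have "tens xs \<in> lie_power C d"
      using tens_in_lie_power[OF lie_monos_cobar_lie[OF xs(2)]] xs(1) by simp
    ultimately show ?thesis
      unfolding total_def by (intro pm.span_base) (auto simp: lie_power_grd_iff)
  qed
  then show "lie_power C d \<subseteq> total psc (sym_coinvariants C d)"
    using lie_power_induct[of _ C d "total psc (sym_coinvariants C d)"] by (auto simp: total_def)
qed

lemma tensor_diff_lie_power: "t \<in> lie_power C d \<Longrightarrow> tensor_diff C t \<in> lie_power C d"
  unfolding tensor_diff_eq_diag_op by (rule diag_op_lie_power[OF lie_derivation_cobar_diff[OF dg coc]])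

lemma symmetrize_tensor_diff:
  "t \<in> lie_power C d \<Longrightarrow> symmetrize C (tensor_diff C t) = cobar_diff C (symmetrize C t)"
  unfolding tensor_diff_eq_diag_op by (rule symmetrize_diag_op[OF lie_derivation_cobar_diff[OF dg coc]])

lemma psi_cobar_diff: "x \<in> cobar C \<Longrightarrow> psi C p (cobar_diff C x) = cobar_diff C (psi C p x)"
  by (rule psi_derivation[OF lie_derivation_cobar_diff[OF dg coc]])

lemma linear_chain_map_psi: "linear_chain_map (psi C p) (cobar_natural C) (cobar_natural C)"
  using pm.subspace_0[OF subspace_rel_natural[of C]]
  by (auto simp: linear_chain_map_def plin_psi psi_in_cobar_grd psi_rel psi_cobar_diff cobar_grd_cobar)

lemma linear_chain_map_psc: "linear_chain_map (psc c) (cobar_natural C) (cobar_natural C)"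
  using pm.subspace_0[OF subspace_rel_natural[of C]]
  by (auto simp: linear_chain_map_def plin_scale[OF plin_id] plin_psc[OF plin_cobar_diff]
      pm.subspace_scale[OF subspace_cobar_grd] pm.subspace_scale[OF subspace_rel_natural])

lemma linear_chain_map_symmetrize: "linear_chain_map (symmetrize C) (sym_coinvariants C d) (cobar_natural C)"
  using pm.subspace_0[OF subspace_rel_natural[of C]] symmetrize_grd[of _ C d]
  by (auto simp: linear_chain_map_def plin_symmetrize symmetrize_rel symmetrize_tensor_diff lie_power_grd_iff)

lemma chain_map_psi: "chain_map psc psc (psi C p) (cobar_natural C) (cobar_natural C)"
  unfolding chain_map_def total_natural
  using linear_chain_map_psi[of p] pm.subspace_0[OF subspace_rel_natural[of C]]
  by (auto simp: linear_chain_map_def plin_add[OF plin_psi] plin_psc[OF plin_psi] psi_cobar_diff)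

lemma chain_map_symmetrize: "chain_map psc psc (symmetrize C) (sym_coinvariants C d) (cobar_natural C)"
  unfolding chain_map_def total_sym
  using linear_chain_map_symmetrize[of d] pm.subspace_0[OF subspace_rel_natural[of C]]
  by (auto simp: linear_chain_map_def plin_add[OF plin_symmetrize] plin_psc[OF plin_symmetrize]
      symmetrize_tensor_diff)

section \<open>Adams operations, direct sum decomposition and eigenspaces in homology\<close>

lemma adams_hclass:
  "adams C p n (hclass (cobar_natural C) n z) = hclass (cobar_natural C) n (psi C p z)"
  unfolding adams_def by (rule hmap_hclass[OF linear_natural linear_natural linear_chain_map_psi])

lemma adams_reduced_HC: "adams C p n \<in> reduced_HC C n \<rightarrow> reduced_HC C n"
proof
  fix K assume "K \<in> reduced_HC C n"
  then obtain z where z: "z \<in> cyc (cobar_natural C) n" "K = hclass (cobar_natural C) n z"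
    by (auto simp: reduced_HC_def homology_def)
  then show "adams C p n K \<in> reduced_HC C n"
    using linear_chain_map_cyc[OF linear_natural linear_chain_map_psi z(1)]
    by (simp add: adams_hclass reduced_HC_def homology_def)
qed

lemma direct_sum: "direct_sum_decomposition psc (cobar_natural C) {d. d \<ge> 1}
  psc (sym_coinvariants C) (\<lambda>d. symmetrize C)"
  unfolding direct_sum_decomposition_def total_natural total_sym
proof (intro conjI ballI allI impI)
  fix x assume "x \<in> cobar C"
  then obtain J t where J: "finite J" "\<forall>j. t j \<in> lie_power C j" "x = (\<Sum>j\<in>J. symmetrize C (t j))"
    using cobar_decomposition by blast
  \<comment> \<open>The component of order 0 is a scalar and vanishes in the natural quotient, which
    is why the index set can start at 1.\<close>
  have S0: "symmetrize C s \<in> rel (cobar_natural C)" if "s \<in> lie_power C 0" for s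
  proof -
    have "s \<in> {s. symmetrize C s \<in> rel (cobar_natural C)}"
      by (rule lie_power_induct[OF that subspace_vimage[OF plin_symmetrize subspace_rel_natural]])
        (simp add: symmetrize_Nil bas_Nil_rel)
    then show ?thesis by simp
  qed
  have "x - (\<Sum>j\<in>J - {0}. symmetrize C (t j)) = (if 0 \<in> J then symmetrize C (t 0) else 0)"
    using J(1) by (simp add: J(3) sum_diff1)
  also have "\<dots> \<in> rel (cobar_natural C)"
    using S0 J(2) pm.subspace_0[OF subspace_rel_natural[of C]] by simp
  finally show "\<exists>J t. finite J \<and> J \<subseteq> {d. 1 \<le> d} \<and> (\<forall>i\<in>J. t i \<in> lie_power C i) \<and>
      x - (\<Sum>i\<in>J. symmetrize C (t i)) \<in> rel (cobar_natural C)"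
    using J by (intro exI[of _ "J - {0}"] exI[of _ t]) auto
next
  fix J t i
  assume *: "finite J \<and> J \<subseteq> {d. 1 \<le> d} \<and> (\<forall>i\<in>J. t i \<in> lie_power C i) \<and>
    (\<Sum>i\<in>J. symmetrize C (t i)) \<in> rel (cobar_natural C)" and i: "i \<in> J"
  then have "symmetrize C (t i) \<in> rel (cobar_natural C)"
    using sum_symmetrize_mem[OF subspace_rel_natural psi_rel, where J = J and t = t] by blast
  then show "t i \<in> rel (sym_coinvariants C i)"
    using * i by (intro rel_of_symmetrize_rel) auto
qed (rule chain_map_symmetrize)

text \<open>A chain bounding \<open>symmetrize C t\<close> may have components of all orders. The
  differential preserves the order, so the component of order \<open>d\<close> already bounds
  \<open>t\<close> modulo relations.\<close>

lemma bdr_of_symmetrize_bdr: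
  assumes t: "t \<in> lie_power_grd C d n" and d: "d > 0" and "symmetrize C t \<in> bdr (cobar_natural C) n"
  shows "t \<in> bdr (sym_coinvariants C d) n"
proof -
  obtain y where y: "y \<in> cobar_grd C (n + 1)" "symmetrize C t - cobar_diff C y \<in> rel (cobar_natural C)"
    using assms(3) by (auto simp: bdr_def)
  obtain J u where J: "finite J" "\<forall>j. u j \<in> lie_power_grd C j (n + 1)" "y = (\<Sum>j\<in>J. symmetrize C (u j))"
    using cobar_grd_decomposition[OF y(1)] by auto
  have u: "u j \<in> lie_power C j" for j using J(2) by (simp add: lie_power_grd_iff)
  let ?v = "if d \<in> J then u d else 0"
  have v: "?v \<in> lie_power_grd C d (n + 1)"
    using J(2) pm.subspace_0[OF subspace_lie_power_grd[of C]] by simp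
  have "cobar_diff C y = (\<Sum>j\<in>J. symmetrize C (tensor_diff C (u j)))"
    unfolding J(3) plin_sum[OF plin_cobar_diff] symmetrize_tensor_diff[OF u] ..
  then have "symmetrize C t - (\<Sum>j\<in>J. symmetrize C (tensor_diff C (u j))) \<in> rel (cobar_natural C)"
    using y(2) by simp
  then have "symmetrize C (t - (if d \<in> J then tensor_diff C (u d) else 0)) \<in> rel (cobar_natural C)"
    using t by (intro component_mem[OF subspace_rel_natural psi_rel J(1)])
      (auto simp: lie_power_grd_iff tensor_diff_lie_power u)
  moreover have "(if d \<in> J then tensor_diff C (u d) else 0) = tensor_diff C ?v"
    by (simp add: tensor_diff_eq_diag_op plin_0[OF plin_diag_op])
  moreover have "t - tensor_diff C ?v \<in> lie_power C d"
    using t v by (intro pm.subspace_diff[OF subspace_lie_power] tensor_diff_lie_power)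
      (auto simp: lie_power_grd_iff)
  ultimately have "t - tensor_diff C ?v \<in> rel (sym_coinvariants C d)"
    using d by (intro rel_of_symmetrize_rel) auto
  then show ?thesis using t v by (auto simp: bdr_def)
qed

lemma HC_Lie_inclusion_hclass:
  "HC_Lie_inclusion C n (hclass (sym_coinvariants C d) n t) = hclass (cobar_natural C) n (symmetrize C t)"
  unfolding HC_Lie_inclusion_def
  by (rule hmap_hclass[OF linear_sym linear_natural linear_chain_map_symmetrize])

lemma inj_HC_Lie_inclusion:
  assumes "d > 0"
  shows "inj_on (HC_Lie_inclusion C n) (HC_Lie C d n)"
proof (rule inj_onI)
  fix K L assume "K \<in> HC_Lie C d n" "L \<in> HC_Lie C d n" and eq: "HC_Lie_inclusion C n K = HC_Lie_inclusion C n L"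
  then obtain s t where st: "s \<in> cyc (sym_coinvariants C d) n" "K = hclass (sym_coinvariants C d) n s"
    "t \<in> cyc (sym_coinvariants C d) n" "L = hclass (sym_coinvariants C d) n t"
    by (auto simp: HC_Lie_def homology_def)
  have "symmetrize C (s - t) \<in> bdr (cobar_natural C) n"
    using eq unfolding st HC_Lie_inclusion_hclass hclass_eq_iff[OF linear_natural]
    by (simp add: plin_diff[OF plin_symmetrize])
  then have "s - t \<in> bdr (sym_coinvariants C d) n"
    using st assms by (intro bdr_of_symmetrize_bdr pm.subspace_diff[OF subspace_lie_power_grd]) (auto simp: cyc_def)
  then show "K = L" unfolding st hclass_eq_iff[OF linear_sym] .
qed

lemma heigenspace_psi_iff:
  "hclass (cobar_natural C) n z \<in> heigenspace psc (cobar_natural C) (psi C p) c n \<longleftrightarrow>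
    hclass (cobar_natural C) n z \<in> homology (cobar_natural C) n \<and>
    psi C p z - psc c z \<in> bdr (cobar_natural C) n"
  unfolding heigenspace_def mem_Collect_eq hmap_hclass[OF linear_natural linear_natural linear_chain_map_psi]
    hmap_hclass[OF linear_natural linear_natural linear_chain_map_psc] hclass_eq_iff[OF linear_natural] ..

text \<open>For an eigenclass, the boundary that expresses the eigenvalue equation splits by order,
  so every component of \<open>z\<close> of order other than \<open>d\<close> is a boundary. The
  remaining component is a cycle because the differential of \<open>z\<close>, a relation, splits in
  the same way.\<close>

lemma HC_Lie_inclusion_image:
  assumes d: "d > 0" and p: "p \<ge> 2"
  shows "HC_Lie_inclusion C n ` HC_Lie C d n =
    heigenspace psc (cobar_natural C) (psi C p) (of_nat p ^ d) n"
proof (intro equalityI subsetI)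
  fix K assume "K \<in> HC_Lie_inclusion C n ` HC_Lie C d n"
  then obtain t where t: "t \<in> cyc (sym_coinvariants C d) n"
    "K = hclass (cobar_natural C) n (symmetrize C t)"
    by (auto simp: HC_Lie_def homology_def HC_Lie_inclusion_hclass)
  have "t \<in> lie_power C d" using t(1) by (auto simp: cyc_def lie_power_grd_iff)
  then have "psi C p (symmetrize C t) - psc (of_nat p ^ d) (symmetrize C t) = 0"
    by (simp add: psi_symmetrize)
  then show "K \<in> heigenspace psc (cobar_natural C) (psi C p) (of_nat p ^ d) n"
    unfolding t(2) heigenspace_psi_iff
    using linear_chain_map_cyc[OF linear_natural linear_chain_map_symmetrize t(1)]
      pm.subspace_0[OF subspace_bdr[OF linear_natural]] by (auto simp: homology_def)
next
  fix K assume K: "K \<in> heigenspace psc (cobar_natural C) (psi C p) (of_nat p ^ d) n"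
  then obtain z where z: "z \<in> cyc (cobar_natural C) n" "K = hclass (cobar_natural C) n z"
    by (auto simp: heigenspace_def homology_def)
  have ev: "psi C p z - psc (of_nat p ^ d) z \<in> bdr (cobar_natural C) n"
    using K unfolding z(2) heigenspace_psi_iff by simp
  note B = subspace_bdr[OF linear_natural, of n]
  have "z \<in> cobar_grd C n" using z(1) by (simp add: cyc_def)
  then obtain J t where J: "finite J" "\<forall>j. t j \<in> lie_power_grd C j n" "z = (\<Sum>j\<in>J. symmetrize C (t j))"
    using cobar_grd_decomposition by blast
  have t: "t j \<in> lie_power C j" for j using J(2) by (simp add: lie_power_grd_iff)
  let ?c = "\<lambda>j. of_nat p ^ j - of_nat p ^ d :: 'k"
  have "psi C p z - psc (of_nat p ^ d) z = (\<Sum>j\<in>J. symmetrize C (psc (?c j) (t j)))"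
    unfolding J(3) plin_sum[OF plin_psi] psi_symmetrize[OF t] pm.scale_sum_right sum_subtractf[symmetric]
    by (simp add: plin_psc[OF plin_symmetrize] plin_diff[OF plin_symmetrize] pm.scale_left_diff_distrib)
  then have "\<forall>j\<in>J. symmetrize C (psc (?c j) (t j)) \<in> bdr (cobar_natural C) n"
    using ev J(1) t
    by (intro sum_symmetrize_mem[OF B linear_chain_map_bdr[OF linear_natural linear_chain_map_psi]])
      (auto intro: pm.subspace_scale[OF subspace_lie_power])
  then have other: "symmetrize C (t j) \<in> bdr (cobar_natural C) n" if "j \<in> J" "j \<noteq> d" for j
  proof -
    \<comment> \<open>This is where \<open>p \<ge> 2\<close> enters; characteristic 0 then keeps the
      two powers apart in the field.\<close>
    have "p ^ j \<noteq> p ^ d" using p that(2) by simp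
    then have "(of_nat (p ^ j) :: 'k) \<noteq> of_nat (p ^ d)" unfolding of_nat_eq_iff .
    then have "?c j \<noteq> 0" by simp
    then have "symmetrize C (t j) = psc (1 / ?c j) (symmetrize C (psc (?c j) (t j)))"
      by (simp add: plin_psc[OF plin_symmetrize])
    then show ?thesis
      using \<open>\<forall>j\<in>J. symmetrize C (psc (?c j) (t j)) \<in> bdr (cobar_natural C) n\<close> that(1)
        pm.subspace_scale[OF B] by metis
  qed
  \<comment> \<open>If order \<open>d\<close> does not occur in \<open>z\<close>, the representative
    is 0 and the class is trivial.\<close>
  let ?t = "if d \<in> J then t d else 0"
  have "z - symmetrize C ?t = (\<Sum>j\<in>J - {d}. symmetrize C (t j))"
    using J(1) by (simp add: J(3) sum_diff1 plin_0[OF plin_symmetrize])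
  also have "\<dots> \<in> bdr (cobar_natural C) n"
    by (rule pm.subspace_sum[OF B]) (use other in auto)
  finally have K': "K = hclass (cobar_natural C) n (symmetrize C ?t)"
    unfolding z(2) hclass_eq_iff[OF linear_natural] .
  have "cobar_diff C z = (\<Sum>j\<in>J. symmetrize C (tensor_diff C (t j)))"
    unfolding J(3) plin_sum[OF plin_cobar_diff] symmetrize_tensor_diff[OF t] ..
  then have "(\<Sum>j\<in>J. symmetrize C (tensor_diff C (t j))) \<in> rel (cobar_natural C)"
    using z(1) by (simp add: cyc_def)
  then have "\<forall>j\<in>J. symmetrize C (tensor_diff C (t j)) \<in> rel (cobar_natural C)"
    using J(1) t by (intro sum_symmetrize_mem[OF subspace_rel_natural psi_rel]) (auto intro: tensor_diff_lie_power)
  then have "tensor_diff C ?t \<in> rel (sym_coinvariants C d)"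
    using rel_of_symmetrize_rel[OF tensor_diff_lie_power[OF t] d] pm.subspace_0[OF subspace_rel_sym[of C]]
    by (auto simp: tensor_diff_eq_diag_op plin_0[OF plin_diag_op])
  moreover have "?t \<in> lie_power_grd C d n"
    using J(2) pm.subspace_0[OF subspace_lie_power_grd[of C]] by simp
  ultimately have "?t \<in> cyc (sym_coinvariants C d) n" by (simp only: cyc_def sym_simps mem_Collect_eq)
  then have "hclass (sym_coinvariants C d) n ?t \<in> HC_Lie C d n"
    unfolding HC_Lie_def homology_def by (rule imageI)
  then show "K \<in> HC_Lie_inclusion C n ` HC_Lie C d n"
    using K' HC_Lie_inclusion_hclass[of n d ?t] by (metis imageI)
qed

end

theorem corollary7p1:
  fixes scale :: "'k::field_char_0 \<Rightarrow> 'a::ab_group_add \<Rightarrow> 'a"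
    and G :: "int \<Rightarrow> 'a set"
    and bracket :: "'a \<Rightarrow> 'a \<Rightarrow> 'a"
    and \<delta> :: "'a \<Rightarrow> 'a"
    and C :: "('b, 'k) dgcoalg"
    and f :: "('b list \<Rightarrow>\<^sub>0 'k) \<Rightarrow> 'a"
  assumes "dg_lie_algebra scale G bracket \<delta>"
    and "dg_coalgebra C" and "cocommutative C" and "coaugmented C" and "conilpotent C"
    and "koszul_dual_via C scale G bracket \<delta> f"
  shows
    "(\<forall>p\<ge>2. chain_map psc psc (psi C p) (cobar_natural C) (cobar_natural C) \<and>
       (\<forall>n. adams C p n \<in> reduced_HC C n \<rightarrow> reduced_HC C n \<and>
         (\<forall>z\<in>cyc (cobar_natural C) n.
            adams C p n (hclass (cobar_natural C) n z) = hclass (cobar_natural C) n (psi C p z)))) \<and>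
     direct_sum_decomposition psc (cobar_natural C) {d. d \<ge> 1}
       psc (sym_coinvariants C) (\<lambda>d. symmetrize C) \<and>
     (\<forall>d\<ge>1. \<forall>n. inj_on (HC_Lie_inclusion C n) (HC_Lie C d n) \<and>
       (\<forall>p\<ge>2. HC_Lie_inclusion C n ` HC_Lie C d n =
         heigenspace psc (cobar_natural C) (psi C p) (of_nat p ^ d) n))"
proof -
  note hyps = \<open>dg_coalgebra C\<close> \<open>cocommutative C\<close>
  show ?thesis
    using chain_map_psi[OF hyps] adams_reduced_HC[OF hyps] adams_hclass[OF hyps] direct_sum[OF hyps]
      inj_HC_Lie_inclusion[OF hyps] HC_Lie_inclusion_image[OF hyps]
    by (intro conjI allI impI ballI) simp_all
qed

end
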